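(* Consider the configuration model $\mathrm{CM}_n(\boldsymbol{D})$ on $[n]$ whose degrees are i.i.d. copies of $D$, where $c_1x^{-(\tau-1)}\le \mathbb{P}(D>x)\le C_1x^{-(\tau-1)}$ for all $x\ge 1$, with constants $0<c_1\le C_1<\infty$ and $\tau\in(2,3)$, and $\mathbb{P}(D\ge 2)=1$. Let the edges carry i.i.d. weights distributed as $Y=1+X$, where $X$ has a continuous distribution and $\inf\mathrm{supp}(X)=0$. If $u$ and $v$ are two uniformly chosen vertices of $[n]$, then, as $n\to\infty$, $$\frac{W_n(u,v)}{\log\log n}\overset{d}{\longrightarrow}\frac{2}{|\log(\tau-2)|},\qquad \frac{H_n(u,v)}{\log\log n}\overset{d}{\longrightarrow}\frac{2}{|\log(\tau-2)|}.$$
   Context: Configuration model $\mathrm{CM}_n(\boldsymbol{D})$: vertex $i\in[n]=\{1,\dots,n\}$ receives $D_i$ half-edges, with $(D_i)_{i\in[n]}$ i.i.d. copies of the integer-valued random variable $D$; if $\sum_i D_i$ is odd, one extra half-edge is added to vertex $n$. The half-edges are paired uniformly at random without replacement, each pair forming an edge (self-loops and multiple edges are allowed). The edge weights $(Y_e)$ are i.i.d. and independent of the graph, and the uniform vertices $u,v$ are chosen independently of each other and of everything else. Passage time: $W_n(u,v)=\min_{\pi:u\to v}\sum_{e\in\pi}Y_e$, the minimum being over all paths $\pi$ from $u$ to $v$; $W_n(u,v)=0$ if $u=v$ and $W_n(u,v)=\infty$ if $u$ and $v$ are not connected. Hopcount: $H_n(u,v)$ is the number of edges in the shortest-weight path between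 $u$ and $v$, i.e. the path attaining the minimum in $W_n(u,v)$ (with $H_n(u,v)=\infty$ if $u$ and $v$ are not connected). $\mathrm{supp}(X)$ denotes the support of the distribution of $X$. *)

theory Defs
  imports "HOL-Probability.Probability" "Graph_Theory.Arc_Walk"
begin

(* The pair (i, k) is the k-th half-edge (counted from 0) incident to vertex i. *)
type_synonym half_edge = "nat \<times> nat"

(* d' is the degree sequence after the parity correction at vertex n. *)
definition half_edges :: "nat \<Rightarrow> (nat \<Rightarrow> nat) \<Rightarrow> half_edge set" where
  "half_edges n d =
     (let d' = (if even (\<Sum>i\<in>{1..n}. d i) then d else d(n := d n + 1))
      in SIGMA i:{1..n}. {..<d' i})"

definition pairings :: "'a set \<Rightarrow> 'a set set set" where
  "pairings H = {M. partition_on H M \<and> (\<forall>e\<in>M. card e = 2)}"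

(* The configuration model with i.i.d. degrees distributed as D, as a random pairing of half-edges.
   The blocks of the pairing are the edges, so loops and parallel edges remain distinguishable. *)
definition configuration_model :: "nat pmf \<Rightarrow> nat \<Rightarrow> half_edge set set pmf" where
  "configuration_model D n =
     bind_pmf (Pi_pmf {1..n} 0 (\<lambda>_. D)) (\<lambda>d. pmf_of_set (pairings (half_edges n d)))"

(* The multigraph of a pairing M, as a symmetric digraph: each edge {h, h'} is represented
   by the two opposite arcs (h, h') and (h', h). *)
definition pairing_graph :: "nat \<Rightarrow> half_edge set set \<Rightarrow> (nat, half_edge \<times> half_edge) pre_digraph" where
  "pairing_graph n M =
     \<lparr>verts = {1..n}, arcs = {(h, h'). {h, h'} \<in> M}, tail = (\<lambda>(h, h'). fst h), head = (\<lambda>(h, h'). fst h')\<rparr>"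

(* Weights are attached to undirected edges, hence both arcs of an edge have the same weight. *)
definition path_weight :: "(half_edge set \<Rightarrow> real) \<Rightarrow> (half_edge \<times> half_edge) list \<Rightarrow> real" where
  "path_weight Y p = (\<Sum>(h, h')\<leftarrow>p. Y {h, h'})"

(* There are only finitely many self-avoiding paths in a finite graph, so the infimum is a minimum
   unless u and v are not connected, in which case it is infinite. *)
definition passage_time ::
    "nat \<Rightarrow> half_edge set set \<Rightarrow> (half_edge set \<Rightarrow> real) \<Rightarrow> nat \<Rightarrow> nat \<Rightarrow> ereal" where
  "passage_time n M Y u v =
     (INF p\<in>{p. pre_digraph.apath (pairing_graph n M) u p v}. ereal (path_weight Y p))"

(* For a continuous weight distribution the minimising path is almost surely unique. Off this event
   the smallest number of edges of a minimising path is taken. It is infinite without paths. *)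
definition hopcount ::
    "nat \<Rightarrow> half_edge set set \<Rightarrow> (half_edge set \<Rightarrow> real) \<Rightarrow> nat \<Rightarrow> nat \<Rightarrow> enat" where
  "hopcount n M Y u v =
     (INF p\<in>{p. pre_digraph.apath (pairing_graph n M) u p v \<and>
                ereal (path_weight Y p) = passage_time n M Y u v}. enat (length p))"

(* A sample point is ((M, u, v), Y): pairing, two uniform vertices, and edge weights with law F.
   The family of weights is indexed by all sets of half-edges, which makes it independent of M;
   only the weights of the edges of M are ever used. *)
definition weighted_cm ::
    "nat pmf \<Rightarrow> real measure \<Rightarrow> nat
      \<Rightarrow> ((half_edge set set \<times> nat \<times> nat) \<times> (half_edge set \<Rightarrow> real)) measure" where
  "weighted_cm D F n =
     measure_pmf (pair_pmf (configuration_model D n)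
                   (pair_pmf (pmf_of_set {1..n}) (pmf_of_set {1..n})))
     \<Otimes>\<^sub>M Pi\<^sub>M UNIV (\<lambda>_. F)"

definition passage_time_rv ::
    "nat \<Rightarrow> (half_edge set set \<times> nat \<times> nat) \<times> (half_edge set \<Rightarrow> real) \<Rightarrow> ereal" where
  "passage_time_rv n = (\<lambda>((M, u, v), Y). passage_time n M Y u v)"

definition hopcount_rv ::
    "nat \<Rightarrow> (half_edge set set \<times> nat \<times> nat) \<times> (half_edge set \<Rightarrow> real) \<Rightarrow> ereal" where
  "hopcount_rv n = (\<lambda>((M, u, v), Y). ereal_of_enat (hopcount n M Y u v))"

(* Weak convergence of laws: the library's weak_conv_m only covers laws on the real line, whereas
   passage times and hopcounts can be infinite. *)
definition converges_in_law ::
    "(nat \<Rightarrow> 'b measure) \<Rightarrow> (nat \<Rightarrow> 'b \<Rightarrow> 'a) \<Rightarrow> 'a::topological_space measure \<Rightarrow> bool" where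
  "converges_in_law P Z \<nu> \<longleftrightarrow>
     (\<forall>f :: 'a \<Rightarrow> real. continuous_on UNIV f \<and> bounded (range f) \<longrightarrow>
        (\<lambda>n. \<integral>x. f x \<partial>distr (P n) borel (Z n)) \<longlonglongrightarrow> (\<integral>x. f x \<partial>\<nu>))"

definition supp :: "'a::topological_space measure \<Rightarrow> 'a set" where
  "supp \<mu> = {x. \<forall>U. open U \<and> x \<in> U \<longrightarrow> emeasure \<mu> U > 0}"

end

theory Submission imports Defs "HOL-Real_Asymp.Real_Asymp"
begin

text \<open>All weights are at least 1, so the graph distance is at most the hopcount, which is at most the
  passage time. Hence a lower bound on the distance and an upper bound on the passage time suffice.

  Lower bound: if the distance is at most \<open>2 m\<close>, then with \<open>g j = exp (A * B ^ j)\<close> and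
  \<open>B > 1 / (\<tau> - 2)\<close> either a path from one of the end points has its first degree above \<open>g j\<close> at
  some position \<open>j \<le> m\<close>, or the end points are joined by a path of degrees at most \<open>g m\<close>. The
  expected numbers of such paths are controlled by truncated moments of \<open>D\<close>.

  Upper bound: from each end point follow a single path until it meets a vertex whose degree is a large
  constant; this takes boundedly many steps. From there climb through windows of degrees around
  \<open>z i\<close> with \<open>z (i + 1) = z i powr B\<close> and \<open>B < 1 / (\<tau> - 2)\<close>, using only edges of weight at most
  \<open>1 + \<epsilon>\<close>, up to degree \<open>n powr \<alpha>\<close> with \<open>\<alpha> > 1 / 2\<close>. Any two vertices of the last window are
  joined by an edge of weight at most \<open>1 + \<epsilon>\<close>.\<close>

section \<open>Uniform pairings\<close>

text \<open>The limit comes from one exponent. A half-edge is matched to a vertex of degree about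
  \<open>y\<close> with probability of order \<open>y powr (- (\<tau> - 2))\<close>, so a vertex of
  degree \<open>z\<close> has of order \<open>z powr (1 - B * (\<tau> - 2))\<close> neighbours of
  degree about \<open>z powr B\<close>: many for \<open>B < 1 / (\<tau> - 2)\<close>, hardly any for
  larger \<open>B\<close>. The logarithm of the degree is thus multiplied by at most about
  \<open>1 / (\<tau> - 2)\<close> per step, and about
  \<open>ln (ln n) / \<bar>ln (\<tau> - 2)\<bar>\<close> steps lead from either end to a power of
  \<open>n\<close>; the two ends give the factor 2. The weights do not change this: edges of weight
  at most \<open>1 + \<epsilon>\<close> have a fixed positive probability \<open>p\<close>, which
  only scales the exponents of the failure probabilities, while \<open>\<epsilon>\<close> is as
  small as desired. The obstacle is that the edges of a pairing are not independent. Everything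
  rests on the fact that removing an edge from a uniform pairing leaves a uniform pairing of the
  other half-edges, and all events are defined recursively along such removals.\<close>

lemma finite_pairings: "finite H \<Longrightarrow> finite (pairings H)"
  unfolding pairings_def
  by (rule finite_subset[OF _ finitely_many_partition_on[of H]]) auto

lemma pairings_insertI:
  assumes "a \<in> H" "b \<in> H" "a \<noteq> b" "M \<in> pairings (H - {a, b})"
  shows "insert {a, b} M \<in> pairings H" "{a, b} \<notin> M"
proof -
  have P: "partition_on (H - {a, b}) M" and c: "\<forall>e\<in>M. card e = 2"
    using assms(4) by (auto simp: pairings_def)
  have U: "\<Union>M = H - {a, b}"
    using P by (auto simp: partition_on_def)
  have "disjnt {a, b} (\<Union>M)"
    using U by (auto simp: disjnt_def)
  from partition_on_insert[OF this, of H] P have "partition_on H (insert {a, b} M)"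
    using assms by auto
  with c assms(3) show "insert {a, b} M \<in> pairings H"
    by (auto simp: pairings_def)
  show "{a, b} \<notin> M"
    using U by auto
qed

lemma pairings_removeI:
  assumes "M \<in> pairings H" "{a, b} \<in> M"
  shows "M - {{a, b}} \<in> pairings (H - {a, b})" "a \<in> H" "b \<in> H" "a \<noteq> b"
proof -
  have P: "partition_on H M" and c: "\<forall>e\<in>M. card e = 2"
    using assms(1) by (auto simp: pairings_def)
  have "\<Union>M = H" and D: "disjoint M"
    using P by (auto simp: partition_on_def)
  then show "a \<in> H" "b \<in> H"
    using assms(2) by auto
  show "a \<noteq> b"
    using c assms(2) by fastforce
  have dj: "disjnt {a, b} (\<Union>(M - {{a, b}}))"
    using D assms(2) unfolding disjnt_def disjoint_def by fast
  have "insert {a, b} (M - {{a, b}}) = M"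
    using assms(2) by auto
  with partition_on_insert[OF dj, of H] P have "partition_on (H - {a, b}) (M - {{a, b}})"
    by auto
  with c show "M - {{a, b}} \<in> pairings (H - {a, b})"
    by (auto simp: pairings_def)
qed

lemma pairings_partner_unique:
  assumes "M \<in> pairings H" "{a, b} \<in> M" "{a, c} \<in> M"
  shows "b = c"
proof -
  have D: "disjoint M"
    using assms(1) by (simp add: pairings_def partition_on_def)
  have "{a, b} \<inter> {a, c} \<noteq> {}" by simp
  with D assms(2,3) have "{a, b} = {a, c}"
    by (metis disjointD)
  then show ?thesis
    unfolding doubleton_eq_iff by auto
qed

lemma pairings_partner_exists:
  assumes "M \<in> pairings H" "a \<in> H"
  obtains b where "{a, b} \<in> M"
proof -
  obtain e where "e \<in> M" "a \<in> e" "card e = 2"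
    using assms by (auto simp: pairings_def partition_on_def)
  then obtain x y where "e = {x, y}"
    by (auto simp: card_2_iff)
  then show ?thesis
    using \<open>e \<in> M\<close> \<open>a \<in> e\<close> that by (auto simp: insert_commute)
qed

lemma pairings_Union: "M \<in> pairings H \<Longrightarrow> \<Union>M = H"
  by (auto simp: pairings_def partition_on_def)

lemma inj_on_insert_pairings: "inj_on (insert {a, b}) (pairings (H - {a, b}))"
proof -
  have "{a, b} \<notin> M" if "M \<in> pairings (H - {a, b})" for M
  proof
    assume "{a, b} \<in> M"
    then have "a \<in> \<Union>M" by (rule UnionI) simp
    then show False using pairings_Union[OF that] by simp
  qed
  then show ?thesis
    by (intro inj_onI) (simp add: insert_ident)
qed

lemma pairings_eq_UN:
  assumes "a \<in> H"
  shows "pairings H = (\<Union>b\<in>H - {a}. insert {a, b} ` pairings (H - {a, b}))"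
proof (intro equalityI subsetI)
  fix M assume M: "M \<in> pairings H"
  obtain b where b: "{a, b} \<in> M"
    using pairings_partner_exists[OF M assms] .
  note R = pairings_removeI[OF M b]
  have "M = insert {a, b} (M - {{a, b}})"
    using b by auto
  then have "M \<in> insert {a, b} ` pairings (H - {a, b})"
    using R(1) by blast
  then show "M \<in> (\<Union>b\<in>H - {a}. insert {a, b} ` pairings (H - {a, b}))"
    using R by blast
next
  fix M assume "M \<in> (\<Union>b\<in>H - {a}. insert {a, b} ` pairings (H - {a, b}))"
  then obtain b N where "b \<in> H - {a}" "N \<in> pairings (H - {a, b})" "M = insert {a, b} N"
    by blast
  then show "M \<in> pairings H"
    using pairings_insertI(1)[of a H b N] assms by auto
qed

text \<open>Every half-edge has exactly one partner, so the classes given by the partner of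
  \<open>a\<close> partition the pairings. All recursions below go through this split.\<close>

lemma sum_pairings:
  fixes f :: "'a set set \<Rightarrow> real"
  assumes "finite H" "a \<in> H"
  shows "(\<Sum>M\<in>pairings H. f M) =
    (\<Sum>b\<in>H - {a}. \<Sum>M\<in>pairings (H - {a, b}). f (insert {a, b} M))"
proof -
  have dj: "insert {a, b} ` pairings (H - {a, b}) \<inter> insert {a, c} ` pairings (H - {a, c}) = {}"
    if "b \<in> H - {a}" "c \<in> H - {a}" "b \<noteq> c" for b c
  proof (rule equals0I)
    fix M assume "M \<in> insert {a, b} ` pairings (H - {a, b}) \<inter> insert {a, c} ` pairings (H - {a, c})"
    then obtain N N' where N: "N \<in> pairings (H - {a, b})" "M = insert {a, b} N" "M = insert {a, c} N'"
      by blast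
    have "M \<in> pairings H"
      unfolding N(2) using that assms(2) N(1) by (intro pairings_insertI) auto
    moreover have "{a, b} \<in> M"
      unfolding N(2) by (rule insertI1)
    moreover have "{a, c} \<in> M"
      unfolding N(3) by (rule insertI1)
    ultimately have "b = c"
      by (rule pairings_partner_unique)
    then show False
      using that(3) by simp
  qed
  have "(\<Sum>M\<in>pairings H. f M) = (\<Sum>b\<in>H - {a}. \<Sum>M\<in>insert {a, b} ` pairings (H - {a, b}). f M)"
    unfolding pairings_eq_UN[OF assms(2)]
    using dj assms(1) by (intro sum.UNION_disjoint ballI impI finite_imageI finite_pairings) auto
  also have "\<dots> = (\<Sum>b\<in>H - {a}. \<Sum>M\<in>pairings (H - {a, b}). f (insert {a, b} M))"
    by (rule sum.cong[OF refl], subst sum.reindex[OF inj_on_insert_pairings]) (simp add: comp_def)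
  finally show ?thesis .
qed

text \<open>The double factorial \<open>(n - 1)!!\<close> for even \<open>n\<close>, and 0 for odd
  \<open>n\<close>.\<close>

fun pairing_count :: "nat \<Rightarrow> nat" where
  "pairing_count 0 = 1"
| "pairing_count (Suc 0) = 0"
| "pairing_count (Suc (Suc n)) = Suc n * pairing_count n"

lemma card_Diff_pair:
  assumes "finite H" "a \<in> H" "b \<in> H" "a \<noteq> b"
  shows "card (H - {a, b}) = card H - 2"
  using assms by (simp add: card_Diff_subset)

lemma card_pairings:
  assumes "finite H" "card H = n"
  shows "card (pairings H) = pairing_count n"
  using assms
proof (induction n arbitrary: H rule: pairing_count.induct)
  case (1 H)
  then have "pairings H = {{}}"
    by (auto simp: pairings_def partition_on_empty)
  then show ?case by simp
next
  case 2
  then have "card H = 1" by simp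
  then obtain a where H: "H = {a}"
    by (rule card_1_singletonE)
  have "pairings H = {}"
    unfolding H by (subst pairings_eq_UN[OF insertI1]) simp
  then show ?case by simp
next
  case (3 n)
  note fin = \<open>finite H\<close> and cH = \<open>card H = Suc (Suc n)\<close>
  from cH have "H \<noteq> {}" by force
  then obtain a where a: "a \<in> H" by blast
  have cD: "card (H - {a}) = Suc n"
    unfolding card_Diff_singleton[OF a] cH by simp
  have each: "card (pairings (H - {a, b})) = pairing_count n" if "b \<in> H - {a}" for b
  proof (rule 3(1))
    show "finite (H - {a, b})" using fin by simp
    show "card (H - {a, b}) = n" using card_Diff_pair[OF fin a, of b] that cH by auto
  qed
  have "real (card (pairings H)) = (\<Sum>b\<in>H - {a}. real (card (pairings (H - {a, b}))))"
    using sum_pairings[OF fin a, of "\<lambda>_. 1"] by simp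
  also have "\<dots> = (\<Sum>b\<in>H - {a}. real (pairing_count n))"
    by (rule sum.cong[OF refl]) (simp only: each)
  also have "\<dots> = real (Suc n * pairing_count n)"
    by (simp only: sum_constant cD of_nat_mult)
  finally have "card (pairings H) = Suc n * pairing_count n"
    by (rule of_nat_eq_iff[THEN iffD1])
  then show ?case
    by (simp only: pairing_count.simps)
qed

lemma card_pairings_rec:
  assumes "finite H" "a \<in> H" "b \<in> H" "a \<noteq> b"
  shows "real (card (pairings H)) = (real (card H) - 1) * real (card (pairings (H - {a, b})))"
proof -
  have "card {a, b} \<le> card H"
    using assms by (intro card_mono) auto
  then have "2 \<le> card H"
    using assms(4) by simp
  then obtain n where n: "card H = Suc (Suc n)"
    by (metis add_2_eq_Suc le_Suc_ex)
  then show ?thesis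
    using card_pairings[OF assms(1) n] card_pairings[of "H - {a, b}" n] card_Diff_pair[OF assms] assms(1)
    by (simp add: algebra_simps)
qed

lemma pairing_count_pos: "even n \<Longrightarrow> 0 < pairing_count n"
  by (induction n rule: pairing_count.induct) auto

lemma pairings_ne:
  assumes "finite H" "even (card H)"
  shows "pairings H \<noteq> {}"
  using pairing_count_pos[OF assms(2)] card_pairings[OF assms(1) refl] by auto

text \<open>The expectation under a uniform pairing; it is 0 if \<open>H\<close> has odd cardinality.\<close>

definition avg :: "'a set \<Rightarrow> ('a set set \<Rightarrow> real) \<Rightarrow> real" where
  "avg H f = (\<Sum>M\<in>pairings H. f M) / real (card (pairings H))"

lemma avg_mono:
  assumes "\<And>M. M \<in> pairings H \<Longrightarrow> f M \<le> g M"
  shows "avg H f \<le> avg H g"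
  unfolding avg_def using assms by (intro divide_right_mono sum_mono) auto

lemma avg_cong:
  assumes "\<And>M. M \<in> pairings H \<Longrightarrow> f M = g M"
  shows "avg H f = avg H g"
  unfolding avg_def using assms by simp

lemma avg_add: "avg H (\<lambda>M. f M + g M) = avg H f + avg H g"
  by (simp add: avg_def sum.distrib add_divide_distrib)

lemma avg_cmult: "avg H (\<lambda>M. c * f M) = c * avg H f"
  by (simp add: avg_def sum_distrib_left)

lemma avg_divide: "avg H (\<lambda>M. f M / c) = avg H f / c"
  by (simp add: avg_def sum_divide_distrib[symmetric] divide_divide_eq_left mult.commute)

lemma avg_sum: "avg H (\<lambda>M. \<Sum>x\<in>A. f x M) = (\<Sum>x\<in>A. avg H (f x))"
  unfolding avg_def by (subst sum.swap) (simp add: sum_divide_distrib)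

lemma avg_const_le:
  assumes "0 \<le> c"
  shows "avg H (\<lambda>_. c) \<le> c"
  using assms by (cases "card (pairings H) = 0") (simp_all add: avg_def)

text \<open>The partner of \<open>a\<close> is uniform among the other \<open>card H - 1\<close>
  half-edges, and given the partner the rest is again a uniform pairing. For odd
  \<open>card H\<close> both sides are 0.\<close>

lemma avg_rec:
  assumes "finite H" "a \<in> H"
  shows "avg H f = (\<Sum>b\<in>H - {a}. avg (H - {a, b}) (\<lambda>M. f (insert {a, b} M))) / (real (card H) - 1)"
proof -
  have "(\<Sum>M\<in>pairings (H - {a, b}). f (insert {a, b} M)) / real (card (pairings H)) =
      avg (H - {a, b}) (\<lambda>M. f (insert {a, b} M)) / (real (card H) - 1)" if "b \<in> H - {a}" for b
    unfolding avg_def using card_pairings_rec[OF assms(1,2), of b] that by (auto simp: mult.commute)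
  then show ?thesis
    unfolding avg_def[of H] sum_pairings[OF assms] sum_divide_distrib by (intro sum.cong) auto
qed

text \<open>Deferred decisions: a given edge is present with probability
  \<open>1 / (card H - 1)\<close>, and what remains is uniform. \<open>f\<close> is evaluated at the
  pairing without the edge, which is the form in which the recursive events continue.\<close>

lemma avg_edge:
  assumes "finite H" "a \<in> H" "b \<in> H" "a \<noteq> b"
  shows "avg H (\<lambda>M. if {a, b} \<in> M then f (M - {{a, b}}) else 0) = avg (H - {a, b}) f / (real (card H) - 1)"
proof -
  have each: "avg (H - {a, c}) (\<lambda>M. if {a, b} \<in> insert {a, c} M then f (insert {a, c} M - {{a, b}}) else 0) =
      (if c = b then avg (H - {a, b}) f else 0)" if "c \<in> H - {a}" for c
  proof (cases "c = b")
    case True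
    have "avg (H - {a, b}) (\<lambda>M. if {a, b} \<in> insert {a, b} M then f (insert {a, b} M - {{a, b}}) else 0) =
        avg (H - {a, b}) f"
    proof (rule avg_cong)
      fix M assume "M \<in> pairings (H - {a, b})"
      then have "{a, b} \<notin> M" by (rule pairings_insertI(2)[OF assms(2,3,4)])
      then show "(if {a, b} \<in> insert {a, b} M then f (insert {a, b} M - {{a, b}}) else 0) = f M"
        by (simp only: insertI1 if_True Diff_insert_absorb not_False_eq_True)
    qed
    then show ?thesis by (simp only: True if_True simp_thms)
  next
    case False
    have "avg (H - {a, c}) (\<lambda>M. if {a, b} \<in> insert {a, c} M then f (insert {a, c} M - {{a, b}}) else 0) =
        avg (H - {a, c}) (\<lambda>_. 0)"
    proof (rule avg_cong)
      fix M assume M: "M \<in> pairings (H - {a, c})"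
      have "{a, b} \<notin> insert {a, c} M"
      proof
        assume "{a, b} \<in> insert {a, c} M"
        moreover have "insert {a, c} M \<in> pairings H"
          by (rule pairings_insertI(1)[OF assms(2) _ _ M]) (use that in auto)
        ultimately show False
          using pairings_partner_unique[of "insert {a, c} M" H a b c] False by blast
      qed
      then show "(if {a, b} \<in> insert {a, c} M then f (insert {a, c} M - {{a, b}}) else 0) = 0"
        by (simp only: if_False)
    qed
    then show ?thesis using False by (simp only: if_False) (simp add: avg_def)
  qed
  have "(\<Sum>c\<in>H - {a}. avg (H - {a, c}) (\<lambda>M. if {a, b} \<in> insert {a, c} M then f (insert {a, c} M - {{a, b}}) else 0)) =
      (\<Sum>c\<in>H - {a}. if c = b then avg (H - {a, b}) f else 0)"
    by (intro sum.cong refl each)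
  also have "\<dots> = avg (H - {a, b}) f"
    using assms by (subst sum.delta) auto
  finally show ?thesis
    by (simp only: avg_rec[OF assms(1,2)])
qed

definition edge_count :: "'a set set \<Rightarrow> 'a set \<Rightarrow> 'a set \<Rightarrow> nat" where
  "edge_count M S T = card {(a, b). a \<in> S \<and> b \<in> T \<and> {a, b} \<in> M}"

text \<open>If edges are light with probability \<open>p\<close>, the left-hand side is the probability that no light
  edge joins \<open>S\<close> to \<open>T\<close>. The partners of the half-edges of \<open>S\<close> are revealed one at a time; each step
  uses up at most two half-edges of \<open>S\<close>, whence the factor 2 in the exponent.\<close>

lemma avg_power_edge_count:
  fixes p m L :: real
  assumes "finite H" "even (card H)" "S \<subseteq> H" "T \<subseteq> H" "S \<inter> T = {}"
    and "m + card S \<le> card T" "0 \<le> m" "card H \<le> L" "0 \<le> p" "p \<le> 1"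
  shows "avg H (\<lambda>M. (1 - p) ^ edge_count M S T) \<le> exp (- (p * m / (2 * L)) * card S)"
proof -
  define c where "c = p * m / (2 * L)"
  have L0: "0 \<le> L" using assms(8) by linarith
  have c0: "0 \<le> c" using assms L0 by (simp add: c_def)
  obtain s where "card S = s" by blast
  then have "avg H (\<lambda>M. (1 - p) ^ edge_count M S T) \<le> exp (- c * s)"
    using assms(1-6,8)
  proof (induction s arbitrary: S T H rule: less_induct)
    case (less s)
    have fS: "finite S" and fT: "finite T"
      using less.prems finite_subset by blast+
    show ?case
    proof (cases "s = 0")
      case True
      then have "S = {}" using less.prems fS by simp
      then show ?thesis using True avg_const_le[of 1 H] by (simp add: edge_count_def)
    next
      case False
      then obtain a where a: "a \<in> S"
        using less.prems(1) by fastforce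
      then have aH: "a \<in> H" and aT: "a \<notin> T" using less.prems by auto
      have each: "avg (H - {a, b}) (\<lambda>M. (1 - p) ^ edge_count (insert {a, b} M) S T) \<le>
          exp (- c * (real s - 2)) * (if b \<in> T then 1 - p else 1)" if b: "b \<in> H - {a}" for b
      proof -
        have cH: "card (H - {a, b}) = card H - 2"
          using card_Diff_pair[of H a b] less.prems aH b by auto
        then have ev: "even (card (H - {a, b}))" using less.prems by simp
        have le: "real (card (H - {a, b})) \<le> L" using cH less.prems by linarith
        have fin: "finite {(x, y). x \<in> S \<and> y \<in> T \<and> {x, y} \<in> N}" for N
          by (rule finite_subset[of _ "S \<times> T"]) (use fS fT in auto)
        show ?thesis
        proof (cases "b \<in> T")
          case True
          have ec: "Suc (edge_count M (S - {a}) (T - {b})) \<le> edge_count (insert {a, b} M) S T" for M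
          proof -
            have "Suc (edge_count M (S - {a}) (T - {b})) =
                card (insert (a, b) {(x, y). x \<in> S - {a} \<and> y \<in> T - {b} \<and> {x, y} \<in> M})"
              unfolding edge_count_def
              by (subst card_insert_disjoint) (use fin[of M] in \<open>auto elim!: rev_finite_subset\<close>)
            also have "\<dots> \<le> edge_count (insert {a, b} M) S T"
              unfolding edge_count_def by (rule card_mono[OF fin]) (use True a in auto)
            finally show ?thesis .
          qed
          have "avg (H - {a, b}) (\<lambda>M. (1 - p) ^ edge_count (insert {a, b} M) S T)
              \<le> avg (H - {a, b}) (\<lambda>M. (1 - p) * (1 - p) ^ edge_count M (S - {a}) (T - {b}))"
            using power_decreasing[OF ec, of "1 - p"] assms(9,10) by (intro avg_mono) simp
          also have "\<dots> = (1 - p) * avg (H - {a, b}) (\<lambda>M. (1 - p) ^ edge_count M (S - {a}) (T - {b}))"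
            by (rule avg_cmult)
          also have "\<dots> \<le> (1 - p) * exp (- c * (real (s - 1)))"
          proof (intro mult_left_mono less.IH)
            show "card (S - {a}) = s - 1" using a less.prems by simp
            \<comment> \<open>\<open>T\<close> shrinks only when \<open>S\<close> does, so the
              reserve of \<open>m\<close> half-edges in \<open>T\<close> beyond the size of
              \<open>S\<close> lasts to the end.\<close>
            show "m + real (card (S - {a})) \<le> real (card (T - {b}))"
              using card_Diff_singleton[OF True] card_Diff_singleton[OF a] less.prems assms(7) False
              by (simp add: of_nat_diff)
            show "S - {a} \<subseteq> H - {a, b}" "T - {b} \<subseteq> H - {a, b}"
              using less.prems True aT by auto
          qed (use less.prems ev le False assms(10) in auto)
          also have "\<dots> \<le> (1 - p) * exp (- c * (real s - 2))"
            using False c0 assms(10) by (intro mult_left_mono) (auto simp: of_nat_diff mult_left_mono)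
          finally show ?thesis using True by (simp add: mult.commute)
        next
          case bT: False
          have ec: "edge_count M (S - {a, b}) T \<le> edge_count (insert {a, b} M) S T" for M
            unfolding edge_count_def by (rule card_mono[OF fin]) auto
          have cS: "card (S - {a, b}) \<le> s - 1" "s - 2 \<le> card (S - {a, b})"
          proof -
            have "card (S - {a, b}) \<le> card (S - {a})" by (intro card_mono) (use fS in auto)
            then show "card (S - {a, b}) \<le> s - 1" using a less.prems by simp
            have "card S - card {a, b} \<le> card (S - {a, b})" by (rule diff_card_le_card_Diff) simp
            moreover have "card {a, b} \<le> 2" by (simp add: card_insert_if)
            ultimately show "s - 2 \<le> card (S - {a, b})" using less.prems by linarith
          qed
          have "avg (H - {a, b}) (\<lambda>M. (1 - p) ^ edge_count (insert {a, b} M) S T)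
              \<le> avg (H - {a, b}) (\<lambda>M. (1 - p) ^ edge_count M (S - {a, b}) T)"
            using power_decreasing[OF ec, of "1 - p"] assms(9,10) by (intro avg_mono) simp
          also have "\<dots> \<le> exp (- c * card (S - {a, b}))"
          proof (intro less.IH refl)
            show "card (S - {a, b}) < s" using cS False by linarith
            show "m + real (card (S - {a, b})) \<le> real (card T)"
              using cS(1) less.prems by linarith
            show "T \<subseteq> H - {a, b}" using less.prems bT aT by auto
          qed (use less.prems ev le in auto)
          also have "\<dots> \<le> exp (- c * (real s - 2))"
            using cS c0 by (simp add: mult_left_mono)
          finally show ?thesis using bT by simp
        qed
      qed
      have cT: "1 \<le> real (card T)" using less.prems(1,7) False assms(7) by linarith
      have "T \<subseteq> H - {a}" using less.prems aT by auto
      then have "card T \<le> card (H - {a})" using less.prems by (intro card_mono) auto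
      then have TH: "real (card T) \<le> real (card H) - 1"
        using aH less.prems(2) card_gt_0_iff[of H] by (auto simp: of_nat_diff)
      have sumT: "(\<Sum>b\<in>H - {a}. if b \<in> T then 1 - p else 1) = (real (card H) - 1) - p * card T"
      proof -
        have "(\<Sum>b\<in>H - {a}. if b \<in> T then 1 - p else 1) = (\<Sum>b\<in>H - {a}. 1 - (if b \<in> T then p else 0))"
          by (intro sum.cong) auto
        also have "\<dots> = real (card (H - {a})) - (\<Sum>b\<in>H - {a}. if b \<in> T then p else 0)"
          by (simp add: sum_subtractf)
        also have "(\<Sum>b\<in>H - {a}. if b \<in> T then p else 0) = (\<Sum>b\<in>T. p)"
          using \<open>T \<subseteq> H - {a}\<close> less.prems by (intro sum.mono_neutral_cong_right) auto
        finally show ?thesis using aH less.prems(2) card_gt_0_iff[of H] by (auto simp: of_nat_diff mult.commute)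
      qed
      have "avg H (\<lambda>M. (1 - p) ^ edge_count M S T) \<le>
          (\<Sum>b\<in>H - {a}. exp (- c * (real s - 2)) * (if b \<in> T then 1 - p else 1)) / (real (card H) - 1)"
        unfolding avg_rec[OF less.prems(2) aH] using TH cT by (intro divide_right_mono sum_mono each) auto
      also have "\<dots> = exp (- c * (real s - 2)) * (((real (card H) - 1) - p * card T) / (real (card H) - 1))"
        unfolding sum_distrib_left[symmetric] sumT by simp
      also have "\<dots> \<le> exp (- c * (real s - 2)) * exp (- 2 * c)"
      proof (intro mult_left_mono)
        \<comment> \<open>A half-edge finds its partner in \<open>T\<close> with probability at
          least \<open>m / L\<close>, so revealing it multiplies the bound by at most
          \<open>1 - p * m / L = 1 - 2 * c\<close>.\<close>
        have "m \<le> real (card T)" using less.prems(7) by linarith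
        then have "2 * c \<le> p * card T / (real (card H) - 1)"
          unfolding c_def using assms(9) TH cT less.prems(8) assms(7)
          by (simp add: frac_le mult_left_mono mult_nonneg_nonneg)
        then have "((real (card H) - 1) - p * card T) / (real (card H) - 1) \<le> 1 - 2 * c"
          using TH cT by (simp add: diff_divide_distrib)
        also have "\<dots> \<le> exp (- 2 * c)" using exp_ge_add_one_self[of "- 2 * c"] by simp
        finally show "((real (card H) - 1) - p * card T) / (real (card H) - 1) \<le> exp (- 2 * c)" .
      qed simp
      also have "\<dots> = exp (- c * s)" by (simp add: exp_add[symmetric] algebra_simps)
      finally show ?thesis .
    qed
  qed
  then show ?thesis by (simp add: c_def \<open>card S = s\<close>)
qed

text \<open>\<open>edge_count\<close> counts ordered pairs; for disjoint \<open>S\<close> and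
  \<open>T\<close> these correspond one to one to edges.\<close>

lemma disjoint_doubleton_inj:
  assumes "S \<inter> T = {}"
  shows "inj_on (\<lambda>(a, b). {a, b}) {(a, b). a \<in> S \<and> b \<in> T \<and> {a, b} \<in> M}"
proof (rule inj_onI)
  fix x y assume "x \<in> {(a, b). a \<in> S \<and> b \<in> T \<and> {a, b} \<in> M}" "y \<in> {(a, b). a \<in> S \<and> b \<in> T \<and> {a, b} \<in> M}"
    and eq: "(case x of (a, b) \<Rightarrow> {a, b}) = (case y of (a, b) \<Rightarrow> {a, b})"
  then obtain a b c d where xy: "x = (a, b)" "y = (c, d)" "a \<in> S" "b \<in> T" "c \<in> S" "d \<in> T"
    by (cases x, cases y) auto
  then have "a \<noteq> d" using assms by auto
  with eq xy show "x = y"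
    by (simp add: doubleton_eq_iff)
qed

section \<open>Independent edge weights\<close>

locale weights = prob_space F for F :: "real measure" +
  assumes sets_F: "sets F = sets borel"
begin

lemma space_F: "space F = UNIV"
  using sets_eq_imp_space_eq[OF sets_F] by simp

definition PY :: "(half_edge set \<Rightarrow> real) measure" where
  "PY = Pi\<^sub>M UNIV (\<lambda>_. F)"

sublocale PY: product_prob_space "\<lambda>_. F" "UNIV :: half_edge set set"
  by unfold_locales

sublocale PYp: prob_space PY
  unfolding PY_def by (rule PY.prob_space_axioms)

lemma space_PY: "space PY = UNIV"
  by (simp add: PY_def space_PiM space_F)

lemma measurable_weight [measurable]: "(\<lambda>Y. Y e) \<in> borel_measurable PY"
  unfolding PY_def using measurable_component_singleton[OF UNIV_I, of e "\<lambda>_. F"]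
  by (simp add: measurable_cong_sets[OF refl sets_F])

lemma sets_Collect_weight: "{Y. t < Y e} \<in> sets PY"
proof -
  have "Measurable.pred PY (\<lambda>Y. t < Y e)" by measurable
  then show ?thesis by (simp add: pred_def space_PY)
qed

lemma prob_weight: "PYp.prob {Y. t < Y e} = prob {t<..}"
proof -
  have "emeasure PY {Y \<in> space PY. Y e \<in> {t<..}} = emeasure F {t<..}"
    unfolding PY_def by (rule PY.emeasure_PiM_Collect_single) (auto simp: sets_F)
  then show ?thesis
    by (simp add: measure_def space_PY)
qed

text \<open>For a fixed pairing the edges between \<open>S\<close> and \<open>T\<close> are distinct
  coordinates of the product measure, hence independent. Averaging the resulting power over the
  pairings is the task of \<open>avg_power_edge_count\<close>.\<close>

lemma prob_all_heavy:
  assumes "finite S" "finite T" "S \<inter> T = {}"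
  shows "PYp.prob {Y. \<forall>a\<in>S. \<forall>b\<in>T. {a, b} \<in> M \<longrightarrow> t < Y {a, b}} = prob {t<..} ^ edge_count M S T"
proof -
  let ?E = "{(a, b). a \<in> S \<and> b \<in> T \<and> {a, b} \<in> M}"
  let ?J = "(\<lambda>(a, b). {a, b}) ` ?E"
  have fin: "finite ?E"
    by (rule finite_subset[of _ "S \<times> T"]) (use assms in auto)
  have "{Y. \<forall>a\<in>S. \<forall>b\<in>T. {a, b} \<in> M \<longrightarrow> t < Y {a, b}} = {Y \<in> space PY. \<forall>e\<in>?J. Y e \<in> {t<..}}"
    by (auto simp: space_PY)
  also have "PYp.prob \<dots> = (\<Prod>e\<in>?J. prob {t<..})"
  proof -
    have "emeasure PY {Y \<in> space PY. \<forall>e\<in>?J. Y e \<in> {t<..}} = (\<Prod>e\<in>?J. emeasure F {t<..})"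
      unfolding PY_def by (rule PY.emeasure_PiM_Collect) (use fin in \<open>auto simp: sets_F\<close>)
    also have "\<dots> = ennreal (\<Prod>e\<in>?J. prob {t<..})"
      by (simp add: emeasure_eq_measure ennreal_power)
    finally show ?thesis
      by (simp add: measure_def prod_nonneg)
  qed
  also have "\<dots> = prob {t<..} ^ edge_count M S T"
    using card_image[OF disjoint_doubleton_inj[OF assms(3)]] by (simp add: edge_count_def)
  finally show ?thesis .
qed

end

section \<open>Exploration through windows of increasing degree\<close>

text \<open>The windows are passed in increasing order of degree: at stage \<open>i\<close> the exploration sits at a
  vertex of window \<open>i\<close> with the unexplored half-edges \<open>S\<close> and looks for an edge of weight at most \<open>t\<close>
  into window \<open>i + 1\<close>, avoiding the set \<open>V\<close> of vertices that have been visited.\<close>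

fun climb_fails :: "(nat \<Rightarrow> nat set) \<Rightarrow> half_edge set \<Rightarrow> real \<Rightarrow> (half_edge set \<Rightarrow> real) \<Rightarrow>
    nat \<Rightarrow> nat \<Rightarrow> nat set \<Rightarrow> half_edge set \<Rightarrow> half_edge set set \<Rightarrow> bool" where
  "climb_fails W H t Y 0 i V S M = False"
| "climb_fails W H t Y (Suc j) i V S M =
    ((\<forall>a\<in>S. \<forall>b\<in>H. fst b \<in> W (Suc i) - V \<longrightarrow> {a, b} \<in> M \<longrightarrow> t < Y {a, b}) \<or>
     (\<exists>a\<in>S. \<exists>b\<in>H. fst b \<in> W (Suc i) - V \<and> {a, b} \<in> M \<and>
       climb_fails W H t Y j (Suc i) (insert (fst b) V) ({h \<in> H. fst h = fst b} - {b}) (M - {{a, b}})))"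

text \<open>The exploration of the start follows a single path, leaving each new vertex through its first
  half-edge other than the one through which it was entered.\<close>

definition next_half_edge :: "half_edge \<Rightarrow> half_edge" where
  "next_half_edge b = (fst b, if snd b = 0 then 1 else 0)"

text \<open>Running out of steps, an edge heavier than \<open>t'\<close> and a return to a visited
  vertex all count as failure, as does a failed climb from window 0. The threshold \<open>t'\<close>
  differs from \<open>t\<close>: the start has boundedly many edges, which may be expensive, so
  \<open>t'\<close> will be allowed to grow with \<open>n\<close>.\<close>

fun start_fails :: "(nat \<Rightarrow> nat set) \<Rightarrow> half_edge set \<Rightarrow> real \<Rightarrow> real \<Rightarrow> (half_edge set \<Rightarrow> real) \<Rightarrow>
    nat \<Rightarrow> nat \<Rightarrow> nat set \<Rightarrow> half_edge \<Rightarrow> half_edge set set \<Rightarrow> bool" where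
  "start_fails W H t t' Y k 0 V a M = True"
| "start_fails W H t t' Y k (Suc r) V a M =
    (\<exists>b\<in>H. {a, b} \<in> M \<and>
      (t' < Y {a, b} \<or> fst b \<in> V \<or>
       (if fst b \<in> W 0
        then climb_fails W H t Y k 0 (insert (fst b) V) ({h \<in> H. fst h = fst b} - {b}) (M - {{a, b}})
        else start_fails W H t t' Y k r (insert (fst b) V) (next_half_edge b) (M - {{a, b}}))))"

text \<open>Stage \<open>i\<close> fails outright with probability at most \<open>\<phi> i\<close>; otherwise a union bound is taken over
  the at most \<open>hi i\<close> edges by which it may be left.\<close>

fun climb_bound :: "(nat \<Rightarrow> real) \<Rightarrow> (nat \<Rightarrow> real) \<Rightarrow> nat \<Rightarrow> nat \<Rightarrow> real" where
  "climb_bound \<phi> hi 0 i = 0"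
| "climb_bound \<phi> hi (Suc j) i = \<phi> i + hi i * climb_bound \<phi> hi j (Suc i)"

lemma climb_bound_nonneg: "(\<And>i. 0 \<le> \<phi> i) \<Longrightarrow> (\<And>i. 0 \<le> hi i) \<Longrightarrow> 0 \<le> climb_bound \<phi> hi j i"
  by (induction j arbitrary: i) auto

context weights
begin

lemma measurable_climb_fails [measurable]:
  "finite H \<Longrightarrow> finite S \<Longrightarrow> Measurable.pred PY (\<lambda>Y. climb_fails W H t Y j i V S M)"
proof (induction j arbitrary: i V S M)
  case (Suc j)
  have [measurable]: "Measurable.pred PY (\<lambda>Y. climb_fails W H t Y j (Suc i) (insert (fst b) V)
      ({h \<in> H. fst h = fst b} - {b}) (M - {{a, b}}))" for a b
    using Suc by simp
  show ?case using Suc.prems by simp measurable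
qed simp

lemma measurable_start_fails [measurable]:
  "finite H \<Longrightarrow> Measurable.pred PY (\<lambda>Y. start_fails W H t t' Y k r V a M)"
proof (induction r arbitrary: V a M)
  case (Suc r)
  have [measurable]: "Measurable.pred PY (\<lambda>Y. start_fails W H t t' Y k r (insert (fst b) V)
      (next_half_edge b) (M - {{a, b}}))" for a b
    using Suc by simp
  have [measurable]: "Measurable.pred PY (\<lambda>Y. climb_fails W H t Y k 0 (insert (fst b) V)
      ({h \<in> H. fst h = fst b} - {b}) (M - {{a, b}}))" for a b
    using Suc.prems by simp
  show ?case using Suc.prems by simp measurable
qed simp

end

text \<open>\<open>R\<close> bounds the number of visited vertices. Window \<open>i + 1\<close> has
  to offer \<open>m i\<close> half-edges beyond the at most \<open>hi i\<close> half-edges of the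
  current vertex, as \<open>avg_power_edge_count\<close> requires. The \<open>+ 1\<close> in the
  lower bound on degrees pays for the half-edge by which a vertex is entered.\<close>

locale climb = weights +
  fixes W :: "nat \<Rightarrow> nat set" and H :: "half_edge set" and t p L :: real
    and k R :: nat and lo hi m :: "nat \<Rightarrow> real"
  assumes finite_H: "finite H"
    and p: "p = prob {..t}"
    and card_H: "card H \<le> L"
    and m_nonneg: "\<And>i. 0 \<le> m i" and hi_nonneg: "\<And>i. 0 \<le> hi i"
    and targets: "\<And>i V. i < k \<Longrightarrow> finite V \<Longrightarrow> card V \<le> R \<Longrightarrow>
        m i + hi i \<le> card {b \<in> H. fst b \<in> W (Suc i) - V}"
    and degrees: "\<And>i x. i \<le> k \<Longrightarrow> x \<in> W i \<Longrightarrow>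
        lo i + 1 \<le> card {b \<in> H. fst b = x} \<and> card {b \<in> H. fst b = x} \<le> hi i"
begin

text \<open>The bound of \<open>avg_power_edge_count\<close> with \<open>card S\<close> replaced by
  its lower bound \<open>lo i\<close>.\<close>

definition \<phi> :: "nat \<Rightarrow> real" where
  "\<phi> i = exp (- (p * m i / (2 * L)) * lo i)"

abbreviation hedges :: "nat \<Rightarrow> half_edge set" where
  "hedges x \<equiv> {h \<in> H. fst h = x}"

lemma p_bounds: "0 \<le> p" "p \<le> 1"
  unfolding p by auto

lemma prob_heavy: "prob {t<..} = 1 - p"
proof -
  have "{t<..} = space F - {..t}" by (auto simp: space_F)
  then show ?thesis unfolding p by (simp add: prob_compl sets_F)
qed

text \<open>\<open>H'\<close> is the set of half-edges that are not yet paired; it contains all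
  half-edges of unvisited vertices, so windows outside \<open>V\<close> are intact. By
  \<open>avg_edge\<close> each edge into the target set \<open>T\<close> has probability
  \<open>1 / (card H' - 1)\<close> and leaves a uniform pairing for the induction. Since
  \<open>card T \<le> card H' - 1\<close>, summing over \<open>T\<close> costs at most a factor 1,
  and summing over \<open>S\<close> costs \<open>hi i\<close>.\<close>

lemma avg_climb_fails:
  assumes "H' \<subseteq> H" "even (card H')" "S \<subseteq> H'" "fst ` S \<subseteq> V" "finite V" "card V + j \<le> R"
    and "\<And>x. x \<notin> V \<Longrightarrow> hedges x \<subseteq> H'"
    and "lo i \<le> card S" "card S \<le> hi i" "i + j \<le> k"
  shows "avg H' (\<lambda>M. PYp.prob {Y. climb_fails W H t Y j i V S M}) \<le> climb_bound \<phi> hi j i"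
  using assms
proof (induction j arbitrary: H' S V i)
  case 0
  then show ?case using avg_const_le[of 0 H'] by simp
next
  case (Suc j)
  note [simp] = finite_H
  define T where "T = {b \<in> H. fst b \<in> W (Suc i) - V}"
  have fH': "finite H'" using finite_subset[OF Suc.prems(1) finite_H] .
  have fS: "finite S" using Suc.prems(3) fH' finite_subset by auto
  have fT: "finite T" unfolding T_def by simp
  have TH': "T \<subseteq> H'" using Suc.prems(7) unfolding T_def by auto
  have ST: "S \<inter> T = {}" using Suc.prems(4) unfolding T_def by auto
  let ?B = "climb_bound \<phi> hi j (Suc i)"
  define g where "g b M = PYp.prob {Y. climb_fails W H t Y j (Suc i) (insert (fst b) V) (hedges (fst b) - {b}) M}" for b M
  have B0: "0 \<le> ?B" by (rule climb_bound_nonneg) (auto simp: \<phi>_def hi_nonneg)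
  \<comment> \<open>The second term charges the later failure to every edge into \<open>T\<close>,
    light or heavy. This avoids conditioning the later stages on the weights seen at this
    one.\<close>
  have "PYp.prob {Y. climb_fails W H t Y (Suc j) i V S M} \<le>
      (1 - p) ^ edge_count M S T + (\<Sum>a\<in>S. \<Sum>b\<in>T. if {a, b} \<in> M then g b (M - {{a, b}}) else 0)" for M
  proof -
    let ?A = "{Y. \<forall>a\<in>S. \<forall>b\<in>T. {a, b} \<in> M \<longrightarrow> t < Y {a, b}}"
    let ?C = "\<lambda>a b. {Y. {a, b} \<in> M \<and>
      climb_fails W H t Y j (Suc i) (insert (fst b) V) (hedges (fst b) - {b}) (M - {{a, b}})}"
    have mA: "?A \<in> sets PY"
    proof -
      have "Measurable.pred PY (\<lambda>Y. \<forall>a\<in>S. \<forall>b\<in>T. {a, b} \<in> M \<longrightarrow> t < Y {a, b})"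
        using fS fT by measurable
      then show ?thesis by (simp add: pred_def space_PY)
    qed
    have mC: "?C a b \<in> sets PY" for a b
    proof -
      have "Measurable.pred PY (\<lambda>Y. {a, b} \<in> M \<and>
          climb_fails W H t Y j (Suc i) (insert (fst b) V) (hedges (fst b) - {b}) (M - {{a, b}}))"
        by measurable
      then show ?thesis by (simp add: pred_def space_PY)
    qed
    have "{Y. climb_fails W H t Y (Suc j) i V S M} \<subseteq> ?A \<union> (\<Union>a\<in>S. \<Union>b\<in>T. ?C a b)"
      by (auto simp: T_def)
    then have "PYp.prob {Y. climb_fails W H t Y (Suc j) i V S M} \<le> PYp.prob (?A \<union> (\<Union>a\<in>S. \<Union>b\<in>T. ?C a b))"
      using mA mC fS fT by (intro PYp.finite_measure_mono sets.Un sets.finite_UN) auto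
    also have "\<dots> \<le> PYp.prob ?A + PYp.prob (\<Union>a\<in>S. \<Union>b\<in>T. ?C a b)"
      using mA mC fS fT by (intro measure_Un_le sets.finite_UN) auto
    also have "PYp.prob (\<Union>a\<in>S. \<Union>b\<in>T. ?C a b) \<le> (\<Sum>a\<in>S. PYp.prob (\<Union>b\<in>T. ?C a b))"
      using mC fS fT by (intro PYp.finite_measure_subadditive_finite) (auto intro!: sets.finite_UN)
    also have "\<dots> \<le> (\<Sum>a\<in>S. \<Sum>b\<in>T. PYp.prob (?C a b))"
      using mC fS fT by (intro sum_mono PYp.finite_measure_subadditive_finite) auto
    also have "\<dots> = (\<Sum>a\<in>S. \<Sum>b\<in>T. if {a, b} \<in> M then g b (M - {{a, b}}) else 0)"
      by (intro sum.cong refl) (simp add: g_def)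
    also have "PYp.prob ?A = (1 - p) ^ edge_count M S T"
      using prob_all_heavy[OF fS fT ST] prob_heavy by simp
    finally show ?thesis by simp
  qed
  then have "avg H' (\<lambda>M. PYp.prob {Y. climb_fails W H t Y (Suc j) i V S M}) \<le>
      avg H' (\<lambda>M. (1 - p) ^ edge_count M S T + (\<Sum>a\<in>S. \<Sum>b\<in>T. if {a, b} \<in> M then g b (M - {{a, b}}) else 0))"
    by (rule avg_mono)
  also have "\<dots> = avg H' (\<lambda>M. (1 - p) ^ edge_count M S T) +
      (\<Sum>a\<in>S. \<Sum>b\<in>T. avg H' (\<lambda>M. if {a, b} \<in> M then g b (M - {{a, b}}) else 0))"
    by (simp only: avg_add avg_sum)
  also have "avg H' (\<lambda>M. (1 - p) ^ edge_count M S T) \<le> \<phi> i"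
  proof -
    have H'L: "card H' \<le> L"
      using card_mono[OF finite_H Suc.prems(1)] card_H by linarith
    have "avg H' (\<lambda>M. (1 - p) ^ edge_count M S T) \<le> exp (- (p * m i / (2 * L)) * card S)"
    proof (rule avg_power_edge_count[OF fH' Suc.prems(2,3) TH' ST _ m_nonneg H'L p_bounds])
      show "m i + real (card S) \<le> real (card T)"
        using targets[of i V] Suc.prems unfolding T_def by force
    qed
    also have "\<dots> \<le> \<phi> i"
      unfolding \<phi>_def using Suc.prems(8) m_nonneg[of i] p_bounds H'L
      by (auto intro!: divide_right_mono mult_left_mono)
    finally show ?thesis .
  qed
  also have "(\<Sum>a\<in>S. \<Sum>b\<in>T. avg H' (\<lambda>M. if {a, b} \<in> M then g b (M - {{a, b}}) else 0)) \<le> (\<Sum>a\<in>S. ?B)"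
  proof (rule sum_mono)
    fix a assume a: "a \<in> S"
    have aH': "a \<in> H'" and aT: "a \<notin> T" using a Suc.prems(3) ST by auto
    have "card T \<le> card (H' - {a})"
      using aT TH' fH' by (intro card_mono) auto
    then have cT: "real (card T) \<le> real (card H') - 1"
      using aH' fH' card_gt_0_iff[of H'] by (auto simp: of_nat_diff)
    have "avg H' (\<lambda>M. if {a, b} \<in> M then g b (M - {{a, b}}) else 0) \<le> ?B / (real (card H') - 1)" if b: "b \<in> T" for b
    proof -
      have bH': "b \<in> H'" and ab: "a \<noteq> b" using b TH' aT by auto
      have fb: "fst b \<in> W (Suc i)" "fst b \<notin> V" using b by (auto simp: T_def)
      have fa: "fst a \<in> V" using a Suc.prems(4) by auto
      have "1 \<le> card T" using b fT card_gt_0_iff[of T] by (auto simp: Suc_le_eq)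
      then have pos: "0 \<le> real (card H') - 1" using cT by linarith
      have cb: "card (hedges (fst b) - {b}) = card (hedges (fst b)) - 1"
        using bH' Suc.prems(1) by (intro card_Diff_singleton) auto
      have "1 \<le> card (hedges (fst b))"
      proof -
        have "b \<in> hedges (fst b)" using bH' Suc.prems(1) by auto
        moreover have "finite (hedges (fst b))" by simp
        ultimately show ?thesis by (metis One_nat_def Suc_leI card_gt_0_iff empty_iff)
      qed
      then have cb': "real (card (hedges (fst b) - {b})) = real (card (hedges (fst b))) - 1"
        using cb by (simp add: of_nat_diff)
      have "avg (H' - {a, b}) (g b) \<le> ?B"
        unfolding g_def
      proof (rule Suc.IH)
        show "even (card (H' - {a, b}))"
          using card_Diff_pair[OF fH' aH' bH' ab] Suc.prems(2) by simp
        show "card (insert (fst b) V) + j \<le> R"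
          using Suc.prems(5,6) fb by simp
        show "hedges (fst b) - {b} \<subseteq> H' - {a, b}"
          using Suc.prems(7)[OF fb(2)] fa fb(2) by auto
        show "hedges x \<subseteq> H' - {a, b}" if "x \<notin> insert (fst b) V" for x
          using Suc.prems(7)[of x] that fa by auto
        show "lo (Suc i) \<le> real (card (hedges (fst b) - {b}))" "real (card (hedges (fst b) - {b})) \<le> hi (Suc i)"
          using degrees[OF _ fb(1)] Suc.prems(10) cb' by auto
      qed (use Suc.prems in auto)
      then show ?thesis
        unfolding avg_edge[OF fH' aH' bH' ab] by (rule divide_right_mono) (rule pos)
    qed
    then have "(\<Sum>b\<in>T. avg H' (\<lambda>M. if {a, b} \<in> M then g b (M - {{a, b}}) else 0)) \<le> (\<Sum>b\<in>T. ?B / (real (card H') - 1))"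
      by (rule sum_mono)
    also have "\<dots> = ?B * (real (card T) / (real (card H') - 1))" by simp
    also have "\<dots> \<le> ?B * 1"
      using cT by (intro mult_left_mono B0) (auto simp: divide_le_eq_1)
    finally show "(\<Sum>b\<in>T. avg H' (\<lambda>M. if {a, b} \<in> M then g b (M - {{a, b}}) else 0)) \<le> ?B" by simp
  qed
  also have "(\<Sum>a\<in>S. ?B) \<le> hi i * ?B"
    using Suc.prems(9) B0 by (simp add: mult_right_mono)
  finally show ?case by simp
qed

end

lemma fst_next_half_edge [simp]: "fst (next_half_edge b) = fst b"
  by (simp add: next_half_edge_def)

lemma next_half_edge_neq [simp]: "next_half_edge b \<noteq> b"
  by (simp add: next_half_edge_def prod_eq_iff)

locale explore = climb +
  fixes q \<rho> t' \<Delta> Lmin :: real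
  assumes two_half_edges: "\<And>b. b \<in> H \<Longrightarrow> (fst b, 0) \<in> H \<and> (fst b, 1) \<in> H"
    and q: "0 \<le> q" "q \<le> 1"
    and start_targets: "\<And>V. finite V \<Longrightarrow> card V \<le> R \<Longrightarrow> q * L \<le> card {b \<in> H. fst b \<in> W 0 - V}"
    and \<rho>: "\<rho> = prob {t'<..}"
    and max_degree: "\<And>x. card {h \<in> H. fst h = x} \<le> \<Delta>"
    and Lmin: "0 < Lmin"
begin

lemma \<rho>_nonneg: "0 \<le> \<rho>"
  unfolding \<rho> by simp

lemma next_half_edge_in: "b \<in> H \<Longrightarrow> next_half_edge b \<in> H"
  using two_half_edges[of b] by (simp add: next_half_edge_def)

text \<open>Each step reaches window 0 with probability at least \<open>q\<close>, so
  \<open>(1 - q) ^ r\<close> bounds the chance of missing it \<open>r\<close> times. The other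
  causes are added up per step: a heavy edge costs \<open>\<rho>\<close>; a visited vertex is hit
  with probability at most \<open>R * \<Delta> / Lmin\<close>, because at most \<open>R\<close>
  vertices carry at most \<open>R * \<Delta>\<close> of at least \<open>Lmin\<close> candidates; a
  failed climb costs \<open>climb_bound\<close>.\<close>

lemma avg_start_fails:
  assumes "H' \<subseteq> H" "even (card H')" "a \<in> H'" "fst a \<in> V" "finite V" "card V + r + k \<le> R"
    and "\<And>x. x \<notin> V \<Longrightarrow> hedges x \<subseteq> H'" and "Lmin + 2 * r + 1 \<le> card H'"
  shows "avg H' (\<lambda>M. PYp.prob {Y. start_fails W H t t' Y k r V a M})
    \<le> (1 - q) ^ r + r * (\<rho> + R * \<Delta> / Lmin + climb_bound \<phi> hi k 0)"
  using assms
proof (induction r arbitrary: H' V a)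
  case 0
  then show ?case using avg_const_le[of 1 H'] by (simp add: PYp.prob_space[unfolded space_PY])
next
  case (Suc r)
  define \<beta> where "\<beta> = climb_bound \<phi> hi k 0"
  define \<zeta> where "\<zeta> = R * \<Delta> / Lmin"
  define u where "u = r * (\<rho> + \<zeta> + \<beta>)"
  have \<beta>0: "0 \<le> \<beta>" unfolding \<beta>_def by (rule climb_bound_nonneg) (auto simp: \<phi>_def hi_nonneg)
  have \<Delta>0: "0 \<le> \<Delta>" using max_degree[of 0] by linarith
  have \<zeta>0: "0 \<le> \<zeta>" unfolding \<zeta>_def using \<Delta>0 Lmin by simp
  have u0: "0 \<le> u" unfolding u_def using \<beta>0 \<zeta>0 \<rho>_nonneg by simp
  have fH': "finite H'" using finite_subset[OF Suc.prems(1) finite_H] .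
  note aH' = \<open>a \<in> H'\<close>
  let ?N = "real (card H') - 1"
  have N: "Lmin \<le> ?N" "0 < ?N" using Suc.prems(8) Lmin by auto
  have cHa: "real (card (H' - {a})) = ?N"
    using aH' fH' card_gt_0_iff[of H'] by (auto simp: of_nat_diff)
  define T0 where "T0 = {b \<in> H. fst b \<in> W 0 - V}"
  have T0: "T0 \<subseteq> H' - {a}" using Suc.prems(4,7) unfolding T0_def by auto
  \<comment> \<open>The part of the bound that depends on the partner \<open>b\<close>: a visited
    vertex costs 1, and unless \<open>b\<close> lies in window 0 the remaining \<open>r\<close>
    steps may all miss it.\<close>
  define h where "h b = (if fst b \<in> V then 1 else 0) + (if b \<in> T0 then 0 else (1 - q) ^ r)" for b
  have each: "avg (H' - {a, b}) (\<lambda>M. PYp.prob {Y. start_fails W H t t' Y k (Suc r) V a (insert {a, b} M)})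
      \<le> \<rho> + \<beta> + u + h b" if b: "b \<in> H' - {a}" for b
  proof -
    have bH': "b \<in> H'" and ab: "a \<noteq> b" and bH: "b \<in> H" using b Suc.prems(1) by auto
    have pq: "0 \<le> (1 - q) ^ r" using q by simp
    have ev: "even (card (H' - {a, b}))"
      using card_Diff_pair[OF fH' aH' bH' ab] Suc.prems(2) by simp
    define F' where "F' M Y = (if fst b \<in> W 0
        then climb_fails W H t Y k 0 (insert (fst b) V) (hedges (fst b) - {b}) M
        else start_fails W H t t' Y k r (insert (fst b) V) (next_half_edge b) M)" for M Y
    have mF': "{Y. F' M Y} \<in> sets PY" for M
    proof -
      note finite_H [simp]
      have "Measurable.pred PY (\<lambda>Y. F' M Y)" unfolding F'_def by measurable
      then show ?thesis by (simp add: pred_def space_PY)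
    qed
    have main: "PYp.prob {Y. start_fails W H t t' Y k (Suc r) V a (insert {a, b} M)} \<le>
        \<rho> + (if fst b \<in> V then 1 else PYp.prob {Y. F' M Y})" if M: "M \<in> pairings (H' - {a, b})" for M
    proof (cases "fst b \<in> V")
      case True
      have "PYp.prob {Y. start_fails W H t t' Y k (Suc r) V a (insert {a, b} M)} \<le> 1"
        by (rule PYp.prob_le_1)
      then show ?thesis using True \<rho>_nonneg by (simp only: if_True)
    next
      case False
      have P: "insert {a, b} M \<in> pairings H'" "{a, b} \<notin> M"
        using pairings_insertI[OF aH' bH' ab M] by auto
      have eqM: "insert {a, b} M - {{a, b}} = M"
        using P(2) by (rule Diff_insert_absorb)
      have "{Y. start_fails W H t t' Y k (Suc r) V a (insert {a, b} M)} \<subseteq> {Y. t' < Y {a, b}} \<union> {Y. F' M Y}"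
      proof
        fix Y assume "Y \<in> {Y. start_fails W H t t' Y k (Suc r) V a (insert {a, b} M)}"
        then obtain c where c: "{a, c} \<in> insert {a, b} M" and Y: "t' < Y {a, c} \<or> fst c \<in> V \<or>
            (if fst c \<in> W 0
             then climb_fails W H t Y k 0 (insert (fst c) V) (hedges (fst c) - {c}) (insert {a, b} M - {{a, c}})
             else start_fails W H t t' Y k r (insert (fst c) V) (next_half_edge c) (insert {a, b} M - {{a, c}}))"
          unfolding mem_Collect_eq start_fails.simps by (elim bexE conjE)
        have "c = b"
          using pairings_partner_unique[OF P(1) c insertI1] .
        with Y False have "t' < Y {a, b} \<or> F' M Y"
          unfolding F'_def by (simp only: eqM simp_thms)
        then show "Y \<in> {Y. t' < Y {a, b}} \<union> {Y. F' M Y}" by simp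
      qed
      then have "PYp.prob {Y. start_fails W H t t' Y k (Suc r) V a (insert {a, b} M)} \<le>
          PYp.prob ({Y. t' < Y {a, b}} \<union> {Y. F' M Y})"
        by (intro PYp.finite_measure_mono sets.Un mF' sets_Collect_weight)
      also have "\<dots> \<le> PYp.prob {Y. t' < Y {a, b}} + PYp.prob {Y. F' M Y}"
        using mF' by (intro measure_Un_le sets_Collect_weight)
      also have "PYp.prob {Y. t' < Y {a, b}} = \<rho>"
        unfolding \<rho> by (rule prob_weight)
      finally show ?thesis using False by simp
    qed
    have "avg (H' - {a, b}) (\<lambda>M. PYp.prob {Y. start_fails W H t t' Y k (Suc r) V a (insert {a, b} M)})
      \<le> avg (H' - {a, b}) (\<lambda>M. \<rho> + (if fst b \<in> V then 1 else PYp.prob {Y. F' M Y}))"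
      by (rule avg_mono) (rule main)
    also have "\<dots> = avg (H' - {a, b}) (\<lambda>M. \<rho>) + avg (H' - {a, b}) (\<lambda>M. if fst b \<in> V then 1 else PYp.prob {Y. F' M Y})"
      by (rule avg_add)
    also have "\<dots> \<le> \<rho> + (\<beta> + u + h b)"
    proof (rule add_mono[OF avg_const_le[OF \<rho>_nonneg]])
      show "avg (H' - {a, b}) (\<lambda>M. if fst b \<in> V then 1 else PYp.prob {Y. F' M Y}) \<le> \<beta> + u + h b"
      proof (cases "fst b \<in> V")
        case True
        then show ?thesis
          using avg_const_le[of 1 "H' - {a, b}"] \<beta>0 u0 pq by (simp add: h_def)
      next
        case bV: False
        have hd: "hedges x \<subseteq> H' - {a, b}" if "x \<notin> insert (fst b) V" for x
          using Suc.prems(7)[of x] that Suc.prems(4) by auto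
        have hdb: "hedges (fst b) - {b} \<subseteq> H' - {a, b}"
          using Suc.prems(7)[of "fst b"] Suc.prems(4) bV by auto
        show ?thesis
        proof (cases "fst b \<in> W 0")
          case True
          have "1 \<le> card (hedges (fst b))"
          proof -
            have "b \<in> hedges (fst b)" "finite (hedges (fst b))" using bH finite_H by auto
            then show ?thesis by (metis One_nat_def Suc_leI card_gt_0_iff empty_iff)
          qed
          then have cb: "real (card (hedges (fst b) - {b})) = real (card (hedges (fst b))) - 1"
            using bH by (subst card_Diff_singleton) (auto simp: of_nat_diff)
          have "avg (H' - {a, b}) (\<lambda>M. PYp.prob {Y. climb_fails W H t Y k 0 (insert (fst b) V) (hedges (fst b) - {b}) M}) \<le> \<beta>"
            unfolding \<beta>_def
          proof (rule avg_climb_fails[OF _ ev hdb _ _ _ hd])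
            show "card (insert (fst b) V) + k \<le> R"
              using Suc.prems(5,6) bV by simp
          qed (use Suc.prems degrees[of 0 "fst b"] True cb in auto)
          moreover have "F' = (\<lambda>M Y. climb_fails W H t Y k 0 (insert (fst b) V) (hedges (fst b) - {b}) M)"
            using True by (intro ext) (simp add: F'_def)
          ultimately show ?thesis
            using bV u0 pq by (simp add: h_def)
        next
          case False
          have "next_half_edge b \<in> H' - {a, b}"
            by (rule subsetD[OF hdb]) (simp add: next_half_edge_in[OF bH])
          then have "avg (H' - {a, b}) (\<lambda>M. PYp.prob {Y. start_fails W H t t' Y k r (insert (fst b) V) (next_half_edge b) M})
              \<le> (1 - q) ^ r + r * (\<rho> + R * \<Delta> / Lmin + climb_bound \<phi> hi k 0)"
          proof (intro Suc.IH ev hd)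
            show "card (insert (fst b) V) + r + k \<le> R"
              using Suc.prems(5,6) bV by simp
            show "Lmin + 2 * real r + 1 \<le> real (card (H' - {a, b}))"
              using card_Diff_pair[OF fH' aH' bH' ab] Suc.prems(8) Lmin by (simp add: of_nat_diff)
          qed (use Suc.prems in auto)
          moreover have "F' = (\<lambda>M Y. start_fails W H t t' Y k r (insert (fst b) V) (next_half_edge b) M)"
            using False by (intro ext) (simp add: F'_def)
          ultimately show ?thesis
            using False bV \<beta>0 by (simp add: h_def u_def \<zeta>_def \<beta>_def T0_def)
        qed
      qed
    qed
    finally show ?thesis by simp
  qed
  have sumh: "(\<Sum>b\<in>H' - {a}. h b) \<le> ?N * (\<zeta> + (1 - q) ^ Suc r)"
  proof -
    have "(\<Sum>b\<in>H' - {a}. if fst b \<in> V then 1 else 0) = real (card {b \<in> H' - {a}. fst b \<in> V})"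
      using fH' by (simp add: sum.If_cases Int_def conj_commute)
    also have "\<dots> \<le> real (card (\<Union>x\<in>V. hedges x))"
      using Suc.prems(1,5) finite_H by (intro of_nat_mono card_mono) auto
    also have "\<dots> \<le> (\<Sum>x\<in>V. real (card (hedges x)))"
      using card_UN_le[OF Suc.prems(5), of "\<lambda>x. hedges x"] by (simp flip: of_nat_sum)
    also have "\<dots> \<le> (\<Sum>x\<in>V. \<Delta>)"
      by (rule sum_mono) (rule max_degree)
    also have "\<dots> \<le> R * \<Delta>"
      using Suc.prems(6) \<Delta>0 by (simp add: mult_right_mono)
    also have "\<dots> = Lmin * \<zeta>"
      using Lmin by (simp add: \<zeta>_def)
    also have "\<dots> \<le> ?N * \<zeta>"
      using N \<zeta>0 by (simp add: mult_right_mono)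
    finally have 1: "(\<Sum>b\<in>H' - {a}. if fst b \<in> V then 1 else 0) \<le> ?N * \<zeta>" .
    have "(\<Sum>b\<in>H' - {a}. if b \<in> T0 then 0 else (1 - q) ^ r) = (\<Sum>b\<in>(H' - {a}) - T0. (1 - q) ^ r)"
      using fH' by (intro sum.mono_neutral_cong_right) auto
    also have "\<dots> = (?N - card T0) * (1 - q) ^ r"
    proof -
      have "finite T0" using T0 fH' finite_subset by blast
      then have "card ((H' - {a}) - T0) = card (H' - {a}) - card T0"
        using T0 by (intro card_Diff_subset)
      moreover have "card T0 \<le> card (H' - {a})"
        using T0 fH' by (intro card_mono) auto
      ultimately show ?thesis using cHa by (simp add: of_nat_diff)
    qed
    also have "\<dots> \<le> (?N * (1 - q)) * (1 - q) ^ r"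
    proof (rule mult_right_mono)
      have "real (card H') \<le> real (card H)"
        using card_mono[OF finite_H Suc.prems(1)] by simp
      then have "?N \<le> L" using card_H by linarith
      then have "q * ?N \<le> q * L" using q by (simp add: mult_left_mono)
      also have "\<dots> \<le> card T0"
        unfolding T0_def using Suc.prems(5,6) by (intro start_targets) auto
      finally show "?N - card T0 \<le> ?N * (1 - q)" by (simp add: algebra_simps)
    qed (use q in simp)
    finally have 2: "(\<Sum>b\<in>H' - {a}. if b \<in> T0 then 0 else (1 - q) ^ r) \<le> ?N * (1 - q) ^ Suc r"
      by simp
    show ?thesis
      unfolding h_def sum.distrib using 1 2 by (simp add: distrib_left)
  qed
  have "avg H' (\<lambda>M. PYp.prob {Y. start_fails W H t t' Y k (Suc r) V a M})
      \<le> (\<Sum>b\<in>H' - {a}. \<rho> + \<beta> + u + h b) / ?N"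
    unfolding avg_rec[OF fH' aH'] using N each by (intro divide_right_mono sum_mono) auto
  also have "\<dots> = (?N * (\<rho> + \<beta> + u) + (\<Sum>b\<in>H' - {a}. h b)) / ?N"
    by (simp only: sum.distrib[of _ h] sum_constant cHa)
  also have "\<dots> \<le> (?N * (\<rho> + \<beta> + u) + ?N * (\<zeta> + (1 - q) ^ Suc r)) / ?N"
    using sumh N by (intro divide_right_mono) auto
  also have "\<dots> = \<rho> + \<beta> + u + (\<zeta> + (1 - q) ^ Suc r)"
    using N by (simp add: distrib_left[symmetric])
  also have "\<dots> = (1 - q) ^ Suc r + real (Suc r) * (\<rho> + R * \<Delta> / Lmin + climb_bound \<phi> hi k 0)"
    by (simp add: u_def \<beta>_def \<zeta>_def algebra_simps add_divide_distrib)
  finally show ?case .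
qed

end

text \<open>Walks of weight at most \<open>x\<close>. Walks rather than self-avoiding paths are used
  because they concatenate and reverse freely; \<open>apath_if_conn\<close> cuts out their
  cycles.\<close>

inductive conn :: "half_edge set set \<Rightarrow> (half_edge set \<Rightarrow> real) \<Rightarrow> real \<Rightarrow> nat \<Rightarrow> nat \<Rightarrow> bool" for M Y where
  conn_refl: "0 \<le> x \<Longrightarrow> conn M Y x u u"
| conn_step: "{a, b} \<in> M \<Longrightarrow> Y {a, b} \<le> y \<Longrightarrow> conn M Y x (fst b) w \<Longrightarrow> conn M Y (y + x) (fst a) w"

lemma conn_mono: "conn M Y x u w \<Longrightarrow> x \<le> x' \<Longrightarrow> conn M Y x' u w"
proof (induction arbitrary: x' rule: conn.induct)
  case (conn_refl x u)
  then show ?case by (auto intro: conn.conn_refl)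
next
  case (conn_step a b y x w)
  then have "conn M Y ((x' - x) + x) (fst a) w"
    by (intro conn.conn_step[of a b]) auto
  then show ?case by simp
qed

lemma conn_trans: "conn M Y x u v \<Longrightarrow> conn M Y y v w \<Longrightarrow> conn M Y (x + y) u w"
proof (induction rule: conn.induct)
  case (conn_refl x u)
  then show ?case by (auto intro: conn_mono)
next
  case (conn_step a b z x v)
  then have "conn M Y (z + (x + y)) (fst a) w"
    by (intro conn.conn_step[of a b])
  then show ?case by (simp add: add.assoc)
qed

lemma conn_edge: "{a, b} \<in> M \<Longrightarrow> Y {a, b} \<le> y \<Longrightarrow> conn M Y y (fst a) (fst b)"
  using conn_step[of a b M Y y 0 "fst b"] conn_refl[of 0] by simp

lemma conn_sym: "conn M Y x u w \<Longrightarrow> conn M Y x w u"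
proof (induction rule: conn.induct)
  case (conn_refl x u)
  then show ?case by (rule conn.conn_refl)
next
  case (conn_step a b y x w)
  have "conn M Y y (fst b) (fst a)"
    using conn_step(1,2) by (intro conn_edge) (simp_all add: insert_commute)
  from conn_trans[OF conn_step(4) this] show ?case by (simp add: add.commute)
qed

text \<open>The negated first alternative of \<open>climb_fails\<close> supplies a light edge into
  the next window; the negated second one says that the climb goes on from any such edge.\<close>

lemma conn_if_not_climb_fails:
  assumes "\<not> climb_fails W H t Y j i V S M'" "M' \<subseteq> M" "fst ` S \<subseteq> {x}" "x \<in> W i"
  shows "\<exists>w\<in>W (i + j). conn M Y (j * t) x w"
  using assms
proof (induction j arbitrary: i V S M' x)
  case 0
  then show ?case by (auto intro: conn_refl)
next
  case (Suc j)
  let ?next = "\<lambda>a b. climb_fails W H t Y j (Suc i) (insert (fst b) V) ({h \<in> H. fst h = fst b} - {b}) (M' - {{a, b}})"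
  note nf = Suc.prems(1)[unfolded climb_fails.simps de_Morgan_disj]
  obtain a b where ab: "a \<in> S" "b \<in> H" "fst b \<in> W (Suc i)" "fst b \<notin> V" "{a, b} \<in> M'" "Y {a, b} \<le> t"
    using conjunct1[OF nf] by (auto simp only: not_le ball_simps bex_simps Diff_iff not_all not_imp Bex_def not_less Ball_def)
  then have nf: "\<not> ?next a b"
    using conjunct2[OF nf] by auto
  have "\<exists>w\<in>W (Suc i + j). conn M Y (j * t) (fst b) w"
    by (rule Suc.IH[OF nf]) (use Suc.prems(2) ab in auto)
  then obtain w where w: "w \<in> W (Suc i + j)" "conn M Y (j * t) (fst b) w" by blast
  have "conn M Y (t + j * t) (fst a) w"
    using ab Suc.prems(2) w(2) by (intro conn_step[of a b]) auto
  moreover have "fst a = x" using ab(1) Suc.prems(3) by auto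
  ultimately show ?case using w(1) by (auto simp: algebra_simps)
qed

text \<open>\<open>M'\<close> has to pair all of \<open>H'\<close>, so that the half-edge chosen
  next has a partner to follow; it is still unpaired because its vertex was unvisited before.
  Arriving early at window 0 leaves part of the budget \<open>r * t'\<close> unspent, hence
  \<open>0 \<le> t'\<close>.\<close>

lemma (in explore) conn_if_not_start_fails:
  assumes "\<not> start_fails W H t t' Y k r V a M'" "M' \<subseteq> M" "M' \<in> pairings H'" "H' \<subseteq> H" "a \<in> H'"
    and "\<And>x. x \<notin> V \<Longrightarrow> hedges x \<subseteq> H'" "fst a \<in> V" "0 \<le> t'"
  shows "\<exists>w\<in>W k. conn M Y (r * t' + k * t) (fst a) w"
  using assms
proof (induction r arbitrary: V a M' H')
  case (Suc r)
  obtain b where b: "{a, b} \<in> M'"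
    using pairings_partner_exists[OF Suc.prems(3,5)] .
  note R = pairings_removeI[OF Suc.prems(3) b]
  have bH: "b \<in> H" using R Suc.prems(4) by auto
  have Y: "Y {a, b} \<le> t'" and bV: "fst b \<notin> V"
    using Suc.prems(1) b bH by auto
  have hdb: "hedges (fst b) - {b} \<subseteq> H' - {a, b}"
    using Suc.prems(6)[of "fst b"] Suc.prems(7) bV by auto
  have "\<exists>w\<in>W k. conn M Y (r * t' + k * t) (fst b) w"
  proof (cases "fst b \<in> W 0")
    case True
    then have "\<not> climb_fails W H t Y k 0 (insert (fst b) V) (hedges (fst b) - {b}) (M' - {{a, b}})"
      using Suc.prems(1) b bH by auto
    from conn_if_not_climb_fails[OF this, of M "fst b"] True Suc.prems(2)
    obtain w where "w \<in> W k" "conn M Y (k * t) (fst b) w" by auto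
    then show ?thesis using Suc.prems(8) by (intro bexI[of _ w]) (auto elim: conn_mono)
  next
    case False
    have nf: "\<not> start_fails W H t t' Y k r (insert (fst b) V) (next_half_edge b) (M' - {{a, b}})"
      using Suc.prems(1) b bH False by auto
    have nb: "next_half_edge b \<in> H' - {a, b}"
      by (rule subsetD[OF hdb]) (simp add: next_half_edge_in[OF bH])
    have hd: "hedges x \<subseteq> H' - {a, b}" if "x \<notin> insert (fst b) V" for x
      using Suc.prems(6)[of x] that Suc.prems(7) by auto
    have "\<exists>w\<in>W k. conn M Y (r * t' + k * t) (fst (next_half_edge b)) w"
      by (rule Suc.IH[OF nf _ R(1) _ nb hd]) (use Suc.prems in auto)
    then show ?thesis by simp
  qed
  then obtain w where "w \<in> W k" "conn M Y (r * t' + k * t) (fst b) w" by blast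
  then have "w \<in> W k" "conn M Y (t' + (r * t' + k * t)) (fst a) w"
    using b Y Suc.prems(2) by (auto intro!: conn_step[of a b])
  then show ?case by (auto simp: algebra_simps)
qed simp

context explore
begin

definition all_heavy :: "(half_edge set \<Rightarrow> real) \<Rightarrow> half_edge set set \<Rightarrow> nat \<Rightarrow> nat \<Rightarrow> bool" where
  "all_heavy Y M x y \<longleftrightarrow> (\<forall>a\<in>hedges x. \<forall>b\<in>hedges y. {a, b} \<in> M \<longrightarrow> t < Y {a, b})"

text \<open>All pairs of the last window and the full pairing are considered, so the vertices
  reached by the two explorations may be arbitrary and no conditioning on the explorations is
  needed.\<close>

definition top_fails :: "(half_edge set \<Rightarrow> real) \<Rightarrow> half_edge set set \<Rightarrow> bool" where
  "top_fails Y M \<longleftrightarrow> (\<exists>x\<in>W k. \<exists>y\<in>W k. x \<noteq> y \<and> all_heavy Y M x y)"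

lemma measurable_all_heavy [measurable]: "Measurable.pred PY (\<lambda>Y. all_heavy Y M x y)"
proof -
  note finite_H [simp]
  show ?thesis unfolding all_heavy_def by measurable
qed

lemma measurable_top_fails:
  assumes "finite (W k)"
  shows "{Y. top_fails Y M} \<in> sets PY"
proof -
  note assms [simp]
  have "Measurable.pred PY (\<lambda>Y. top_fails Y M)"
    unfolding top_fails_def by measurable
  then show ?thesis by (simp add: pred_def space_PY)
qed

lemma avg_top_fails:
  assumes "finite (W k)" "card (W k) \<le> N" "even (card H)" "4 \<le> lo k"
  shows "avg H (\<lambda>M. PYp.prob {Y. top_fails Y M}) \<le> (real N)\<^sup>2 * exp (- (p * (lo k)\<^sup>2 / (16 * L)))"
proof -
  let ?E = "exp (- (p * (lo k)\<^sup>2 / (16 * L)))"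
  let ?P = "{(x, y). x \<in> W k \<and> y \<in> W k \<and> x \<noteq> y}"
  define A where "A M xy = {Y. all_heavy Y M (fst xy) (snd xy)}" for M and xy :: "nat \<times> nat"
  have L0: "0 \<le> L" using card_H by linarith
  have finP: "finite ?P" by (rule finite_subset[of _ "W k \<times> W k"]) (use assms(1) in auto)
  have mA: "A M xy \<in> sets PY" for M xy
    using measurable_all_heavy by (simp add: pred_def space_PY A_def)
  have "avg H (\<lambda>M. PYp.prob {Y. top_fails Y M}) \<le> avg H (\<lambda>M. \<Sum>xy\<in>?P. PYp.prob (A M xy))"
  proof (rule avg_mono)
    fix M
    have "{Y. top_fails Y M} = (\<Union>xy\<in>?P. A M xy)"
      unfolding top_fails_def A_def by (simp add: set_eq_iff) blast
    also have "PYp.prob \<dots> \<le> (\<Sum>xy\<in>?P. PYp.prob (A M xy))"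
      using mA finP by (intro PYp.finite_measure_subadditive_finite) auto
    finally show "PYp.prob {Y. top_fails Y M} \<le> (\<Sum>xy\<in>?P. PYp.prob (A M xy))" .
  qed
  also have "\<dots> = (\<Sum>xy\<in>?P. avg H (\<lambda>M. PYp.prob (A M xy)))"
    by (rule avg_sum)
  also have "\<dots> \<le> (\<Sum>xy\<in>?P. ?E)"
  proof (rule sum_mono)
    fix xy assume "xy \<in> ?P"
    then obtain x y where xy: "xy = (x, y)" "x \<in> W k" "y \<in> W k" "x \<noteq> y" by auto
    \<comment> \<open>Only about half of the \<open>lo k\<close> half-edges of \<open>x\<close> are
      used, so that those of \<open>y\<close> exceed them by the reserve \<open>lo k / 2\<close>
      that \<open>avg_power_edge_count\<close> needs. Rounding still leaves \<open>lo k / 4\<close>;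
      the constant 16 is \<open>2 * 2 * 4\<close>.\<close>
    define s where "s = nat \<lfloor>lo k / 2\<rfloor>"
    have s: "real s \<le> lo k / 2" "lo k / 4 \<le> real s"
      using assms(4) unfolding s_def by linarith+
    have "real s \<le> real (card (hedges x))"
      using s(1) degrees[OF order.refl xy(2)] assms(4) by linarith
    then have "s \<le> card (hedges x)" by simp
    from obtain_subset_with_card_n[OF this] obtain S where S: "S \<subseteq> hedges x" "card S = s"
      by blast
    have fin: "finite S" "finite (hedges y)"
      using finite_subset[OF S(1)] finite_H by auto
    have ST: "S \<inter> hedges y = {}" using S(1) xy(4) by auto
    have "avg H (\<lambda>M. PYp.prob (A M xy)) \<le> avg H (\<lambda>M. (1 - p) ^ edge_count M S (hedges y))"
    proof (rule avg_mono)
      fix M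
      have "PYp.prob (A M xy) \<le> PYp.prob {Y. \<forall>a\<in>S. \<forall>b\<in>hedges y. {a, b} \<in> M \<longrightarrow> t < Y {a, b}}"
      proof (rule PYp.finite_measure_mono)
        show "A M xy \<subseteq> {Y. \<forall>a\<in>S. \<forall>b\<in>hedges y. {a, b} \<in> M \<longrightarrow> t < Y {a, b}}"
          using S(1) xy(1) by (auto simp: A_def all_heavy_def)
        have "Measurable.pred PY (\<lambda>Y. \<forall>a\<in>S. \<forall>b\<in>hedges y. {a, b} \<in> M \<longrightarrow> t < Y {a, b})"
          using fin by measurable
        then show "{Y. \<forall>a\<in>S. \<forall>b\<in>hedges y. {a, b} \<in> M \<longrightarrow> t < Y {a, b}} \<in> PYp.events"
          by (simp add: pred_def space_PY)
      qed
      also have "\<dots> = (1 - p) ^ edge_count M S (hedges y)"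
        using prob_all_heavy[OF fin ST] prob_heavy by simp
      finally show "PYp.prob (A M xy) \<le> (1 - p) ^ edge_count M S (hedges y)" .
    qed
    also have "\<dots> \<le> exp (- (p * (lo k / 2) / (2 * L)) * card S)"
    proof (rule avg_power_edge_count[OF finite_H assms(3) _ _ ST _ _ card_H p_bounds])
      show "lo k / 2 + real (card S) \<le> real (card (hedges y))"
        using s(1) S(2) degrees[OF order.refl xy(3)] by linarith
    qed (use S(1) assms(4) in auto)
    also have "\<dots> \<le> ?E"
    proof -
      have "p * (lo k)\<^sup>2 / (16 * L) = (p * (lo k / 2) / (2 * L)) * (lo k / 4)"
        by (simp add: power2_eq_square)
      also have "\<dots> \<le> (p * (lo k / 2) / (2 * L)) * real (card S)"
        using s S(2) p_bounds L0 assms(4) by (intro mult_left_mono) auto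
      finally show ?thesis by simp
    qed
    finally show "avg H (\<lambda>M. PYp.prob (A M xy)) \<le> ?E" .
  qed
  also have "\<dots> = card ?P * ?E" by simp
  also have "\<dots> \<le> (real N)\<^sup>2 * ?E"
  proof (rule mult_right_mono)
    have "card ?P \<le> card (W k \<times> W k)"
      by (rule card_mono) (use assms(1) in auto)
    also have "\<dots> \<le> N * N"
      using assms(2) by (simp add: card_cartesian_product mult_mono)
    finally have "real (card ?P) \<le> real (N * N)"
      by (rule of_nat_mono)
    then show "real (card ?P) \<le> (real N)\<^sup>2"
      by (simp add: power2_eq_square)
  qed simp
  finally show ?thesis by simp
qed

text \<open>Both explorations run in the full pairing and may meet; their failures are combined by a
  union bound only.\<close>

definition bad_weights :: "nat \<Rightarrow> nat \<Rightarrow> nat \<Rightarrow> half_edge set set \<Rightarrow> (half_edge set \<Rightarrow> real) set" where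
  "bad_weights r u v M = {Y. start_fails W H t t' Y k r {u} (u, 0) M} \<union>
     {Y. start_fails W H t t' Y k r {v} (v, 0) M} \<union> {Y. top_fails Y M}"

lemma sets_start_fails: "{Y. start_fails W H t t' Y k r V a M} \<in> sets PY"
  using measurable_start_fails[OF finite_H] by (simp add: pred_def space_PY)

lemma sets_bad_weights:
  "finite (W k) \<Longrightarrow> bad_weights r u v M \<in> sets PY"
  unfolding bad_weights_def by (intro sets.Un sets_start_fails measurable_top_fails)

lemma conn_if_not_bad:
  assumes "M \<in> pairings H" "(u, 0) \<in> H" "(v, 0) \<in> H" "0 \<le> t" "0 \<le> t'" "Y \<notin> bad_weights r u v M"
  shows "conn M Y (2 * (r * t' + k * t) + t) u v"
proof -
  let ?x = "r * t' + k * t"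
  have ex: "\<exists>w\<in>W k. conn M Y ?x z w" if "z \<in> {u, v}" for z
    using conn_if_not_start_fails[of Y r "{z}" "(z, 0)" M M H] assms that
    unfolding bad_weights_def by auto
  obtain w w' where w: "w \<in> W k" "conn M Y ?x u w" "w' \<in> W k" "conn M Y ?x v w'"
    using ex[of u] ex[of v] by auto
  have "conn M Y t w w'"
  proof (cases "w = w'")
    case True
    then show ?thesis using conn_refl assms(4) by simp
  next
    case False
    have "\<not> top_fails Y M" using assms(6) unfolding bad_weights_def by simp
    then have "\<not> all_heavy Y M w w'" using False w unfolding top_fails_def by blast
    then obtain a b where "a \<in> hedges w" "b \<in> hedges w'" "{a, b} \<in> M" "Y {a, b} \<le> t"
      unfolding all_heavy_def by (auto simp only: not_less not_all not_imp Ball_def)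
    then show ?thesis using conn_edge[of a b M Y t] by simp
  qed
  then have "conn M Y (?x + (t + ?x)) u v"
    by (rule conn_trans[OF w(2) conn_trans[OF _ conn_sym[OF w(4)]]])
  then show ?thesis by (rule conn_mono) simp
qed

lemma avg_bad_weights:
  assumes "even (card H)" "(u, 0) \<in> H" "(v, 0) \<in> H" "Lmin + 2 * r + 1 \<le> card H" "1 + r + k \<le> R"
    and "finite (W k)" "card (W k) \<le> N" "4 \<le> lo k"
  shows "avg H (\<lambda>M. PYp.prob (bad_weights r u v M)) \<le>
    2 * ((1 - q) ^ r + r * (\<rho> + R * \<Delta> / Lmin + climb_bound \<phi> hi k 0)) +
    (real N)\<^sup>2 * exp (- (p * (lo k)\<^sup>2 / (16 * L)))"
proof -
  let ?s = "\<lambda>z M. PYp.prob {Y. start_fails W H t t' Y k r {z} (z, 0) M}"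
  have "avg H (\<lambda>M. PYp.prob (bad_weights r u v M)) \<le>
      avg H (\<lambda>M. (?s u M + ?s v M) + PYp.prob {Y. top_fails Y M})"
  proof (rule avg_mono)
    fix M
    show "PYp.prob (bad_weights r u v M) \<le> (?s u M + ?s v M) + PYp.prob {Y. top_fails Y M}"
      unfolding bad_weights_def
      using measure_Un_le[OF sets_start_fails sets_start_fails, of r "{u}" "(u, 0)" M r "{v}" "(v, 0)" M]
        measure_Un_le[OF sets.Un[OF sets_start_fails sets_start_fails] measurable_top_fails[OF assms(6)],
          of r "{u}" "(u, 0)" M r "{v}" "(v, 0)" M M]
      by linarith
  qed
  also have "\<dots> = (avg H (?s u) + avg H (?s v)) + avg H (\<lambda>M. PYp.prob {Y. top_fails Y M})"
    by (simp only: avg_add)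
  also have "avg H (\<lambda>M. PYp.prob {Y. top_fails Y M}) \<le> (real N)\<^sup>2 * exp (- (p * (lo k)\<^sup>2 / (16 * L)))"
    using assms by (intro avg_top_fails)
  also have "avg H (?s u) \<le> (1 - q) ^ r + r * (\<rho> + R * \<Delta> / Lmin + climb_bound \<phi> hi k 0)"
    using assms by (intro avg_start_fails) auto
  also have "avg H (?s v) \<le> (1 - q) ^ r + r * (\<rho> + R * \<Delta> / Lmin + climb_bound \<phi> hi k 0)"
    using assms by (intro avg_start_fails) auto
  finally show ?thesis by simp
qed

end

section \<open>Degrees of the configuration model\<close>

definition corrected_degree :: "nat \<Rightarrow> (nat \<Rightarrow> nat) \<Rightarrow> nat \<Rightarrow> nat" where
  "corrected_degree n d = (if even (\<Sum>i\<in>{1..n}. d i) then d else d(n := d n + 1))"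

lemma half_edges_eq: "half_edges n d = (SIGMA i:{1..n}. {..<corrected_degree n d i})"
  by (simp add: half_edges_def corrected_degree_def Let_def)

lemma corrected_degree_bounds:
  "d i \<le> corrected_degree n d i" "corrected_degree n d i \<le> d i + 1"
  by (auto simp: corrected_degree_def)

lemma corrected_degree_eq: "i \<noteq> n \<Longrightarrow> corrected_degree n d i = d i"
  by (simp add: corrected_degree_def)

lemma finite_half_edges: "finite (half_edges n d)"
  by (simp add: half_edges_eq)

lemma card_half_edges: "card (half_edges n d) = (\<Sum>i\<in>{1..n}. corrected_degree n d i)"
  by (simp add: half_edges_eq)

lemma even_card_half_edges:
  assumes "1 \<le> n"
  shows "even (card (half_edges n d))"
proof (cases "even (\<Sum>i\<in>{1..n}. d i)")
  case False
  have "(\<Sum>i\<in>{1..n}. (d(n := d n + 1)) i) = (\<Sum>i\<in>{1..n}. d i + (if i = n then 1 else 0))"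
    by (intro sum.cong) auto
  also have "\<dots> = (\<Sum>i\<in>{1..n}. d i) + 1"
    using assms by (simp add: sum.distrib)
  finally show ?thesis using False by (simp add: card_half_edges corrected_degree_def)
qed (simp add: card_half_edges corrected_degree_def)

lemma half_edges_at:
  "{h \<in> half_edges n d. fst h = x} = (if x \<in> {1..n} then {x} \<times> {..<corrected_degree n d x} else {})"
  by (auto simp: half_edges_eq)

lemma card_half_edges_at:
  "card {h \<in> half_edges n d. fst h = x} = (if x \<in> {1..n} then corrected_degree n d x else 0)"
  by (simp add: half_edges_at card_cartesian_product)

lemma card_half_edges_le: "real (card (half_edges n d)) \<le> (\<Sum>i\<in>{1..n}. real (d i)) + 1"
proof -
  have "(\<Sum>i\<in>{1..n}. corrected_degree n d i) \<le> (\<Sum>i\<in>{1..n}. d i + (if i = n then 1 else 0))"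
    by (intro sum_mono) (auto simp: corrected_degree_def)
  also have "\<dots> \<le> (\<Sum>i\<in>{1..n}. d i) + 1"
    by (simp add: sum.distrib)
  finally have "real (card (half_edges n d)) \<le> real ((\<Sum>i\<in>{1..n}. d i) + 1)"
    unfolding card_half_edges by (rule of_nat_mono)
  then show ?thesis by simp
qed

lemma card_half_edges_ge:
  assumes "\<And>i. i \<in> {1..n} \<Longrightarrow> 2 \<le> d i"
  shows "2 * n \<le> card (half_edges n d)"
proof -
  have "(\<Sum>i\<in>{1..n}. 2) \<le> (\<Sum>i\<in>{1..n}. corrected_degree n d i)"
    using assms corrected_degree_bounds(1) by (intro sum_mono) (metis order.trans)
  then show ?thesis by (simp add: card_half_edges)
qed

definition sample_pmf :: "nat pmf \<Rightarrow> nat \<Rightarrow> (half_edge set set \<times> nat \<times> nat) pmf" where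
  "sample_pmf D n = pair_pmf (configuration_model D n)
     (pair_pmf (pmf_of_set {1..n}) (pmf_of_set {1..n}))"

text \<open>Given the degrees the pairing is uniform and independent of the end points, so all
  estimates reduce to \<open>avg\<close> for fixed degrees. The parity correction at vertex
  \<open>n \<ge> 1\<close> ensures that a pairing exists.\<close>

lemma nn_integral_sample_pmf:
  fixes f :: "half_edge set set \<Rightarrow> nat \<Rightarrow> nat \<Rightarrow> real"
  assumes "1 \<le> n" and f: "\<And>M u v. 0 \<le> f M u v"
  shows "(\<integral>\<^sup>+(M, u, v). ennreal (f M u v) \<partial>sample_pmf D n) =
    (\<integral>\<^sup>+d. ennreal ((\<Sum>u\<in>{1..n}. \<Sum>v\<in>{1..n}. avg (half_edges n d) (\<lambda>M. f M u v)) / n\<^sup>2)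
      \<partial>Pi_pmf {1..n} 0 (\<lambda>_. D))"
proof -
  have n: "real n > 0" "{1..n} \<noteq> {}" using assms by auto
  have inner: "(\<integral>\<^sup>+uv. ennreal (f M (fst uv) (snd uv)) \<partial>pair_pmf (pmf_of_set {1..n}) (pmf_of_set {1..n})) =
      ennreal ((\<Sum>u\<in>{1..n}. \<Sum>v\<in>{1..n}. f M u v) / n\<^sup>2)" for M
  proof -
    have "(\<integral>\<^sup>+uv. ennreal (f M (fst uv) (snd uv)) \<partial>pair_pmf (pmf_of_set {1..n}) (pmf_of_set {1..n})) =
      (\<Sum>u\<in>{1..n}. (\<Sum>v\<in>{1..n}. ennreal (f M u v)) / ennreal n) / ennreal n"
      using n by (simp add: nn_integral_pair_pmf' nn_integral_pmf_of_set ennreal_of_nat_eq_real_of_nat)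
    also have "\<dots> = (\<Sum>u\<in>{1..n}. ennreal ((\<Sum>v\<in>{1..n}. f M u v) / n)) / ennreal n"
      using n f by (simp add: sum_ennreal divide_ennreal sum_nonneg)
    also have "\<dots> = ennreal ((\<Sum>u\<in>{1..n}. (\<Sum>v\<in>{1..n}. f M u v) / n) / n)"
      using n f by (subst sum_ennreal) (auto simp: divide_ennreal sum_nonneg)
    finally show ?thesis
      by (simp add: sum_divide_distrib power2_eq_square)
  qed
  have cm: "(\<integral>\<^sup>+M. ennreal (g M) \<partial>pmf_of_set (pairings (half_edges n d))) = ennreal (avg (half_edges n d) g)"
    if g: "\<And>M. 0 \<le> g M" for g :: "half_edge set set \<Rightarrow> real" and d
  proof -
    let ?P = "pairings (half_edges n d)"
    have P: "?P \<noteq> {}" "finite ?P"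
      using pairings_ne[OF finite_half_edges even_card_half_edges[OF assms(1)]]
        finite_pairings[OF finite_half_edges] by auto
    then have "0 < real (card ?P)" by (simp add: card_gt_0_iff)
    then show ?thesis
      using P g by (simp add: nn_integral_pmf_of_set avg_def sum_ennreal ennreal_of_nat_eq_real_of_nat
          divide_ennreal sum_nonneg)
  qed
  have "(\<integral>\<^sup>+(M, u, v). ennreal (f M u v) \<partial>sample_pmf D n) =
      (\<integral>\<^sup>+M. ennreal ((\<Sum>u\<in>{1..n}. \<Sum>v\<in>{1..n}. f M u v) / n\<^sup>2) \<partial>configuration_model D n)"
    unfolding sample_pmf_def by (subst nn_integral_pair_pmf') (simp only: case_prod_unfold fst_conv snd_conv inner)
  also have "\<dots> = (\<integral>\<^sup>+d. ennreal (avg (half_edges n d) (\<lambda>M. (\<Sum>u\<in>{1..n}. \<Sum>v\<in>{1..n}. f M u v) / n\<^sup>2))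
      \<partial>Pi_pmf {1..n} 0 (\<lambda>_. D))"
    unfolding configuration_model_def using f
    by (subst nn_integral_bind_pmf) (simp add: cm sum_nonneg)
  also have "(\<lambda>d. avg (half_edges n d) (\<lambda>M. (\<Sum>u\<in>{1..n}. \<Sum>v\<in>{1..n}. f M u v) / n\<^sup>2)) =
      (\<lambda>d. (\<Sum>u\<in>{1..n}. \<Sum>v\<in>{1..n}. avg (half_edges n d) (\<lambda>M. f M u v)) / n\<^sup>2)"
    by (simp only: avg_divide avg_sum)
  finally show ?thesis .
qed

section \<open>Lower bound on the graph distance\<close>

text \<open>Each edge is removed once it is used, so a chain has distinct edges and
  \<open>avg_edge\<close> can be applied along it.\<close>

fun chain :: "nat list \<Rightarrow> half_edge set set \<Rightarrow> bool" where
  "chain (x # y # zs) M = (\<exists>a b. fst a = x \<and> fst b = y \<and> {a, b} \<in> M \<and> chain (y # zs) (M - {{a, b}}))"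
| "chain _ M = True"

fun chain_weight :: "(nat \<Rightarrow> real) \<Rightarrow> nat list \<Rightarrow> real" where
  "chain_weight e (x # y # zs) = e x * e y * chain_weight e (y # zs)"
| "chain_weight e _ = 1"

lemma chain_weight_nonneg: "(\<And>x. 0 \<le> e x) \<Longrightarrow> 0 \<le> chain_weight e xs"
  by (induction e xs rule: chain_weight.induct) auto

text \<open>A union bound over the half-edges used at each vertex: a prescribed edge has probability
  at most \<open>1 / N\<close>, and an inner vertex offers its half-edges twice. As every edge
  removes two half-edges, the surplus \<open>2 * length xs\<close> keeps at least \<open>N\<close>
  candidates to the end.\<close>

lemma avg_chain:
  fixes e :: "nat \<Rightarrow> real" and N :: real
  assumes "finite H" "\<And>x. card {h \<in> H. fst h = x} \<le> e x" "0 < N" "N + 2 * length xs \<le> card H"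
  shows "avg H (\<lambda>M. of_bool (chain xs M)) \<le> chain_weight e xs / N ^ (length xs - 1)"
  using assms
proof (induction xs arbitrary: H rule: induct_list012)
  case 1
  then show ?case using avg_const_le[of 1 H] by simp
next
  case (2 x)
  then show ?case using avg_const_le[of 1 H] by simp
next
  case (3 x y zs)
  note fH = \<open>finite H\<close> and N = \<open>0 < N\<close>
  let ?A = "{h \<in> H. fst h = x}" and ?B = "{h \<in> H. fst h = y}"
  let ?w = "chain_weight e (y # zs) / N ^ (length (y # zs) - 1)"
  have e0: "0 \<le> e x" for x using 3(4)[of x] by linarith
  have w0: "0 \<le> ?w" using chain_weight_nonneg[of e "y # zs"] e0 N by simp
  have HN: "N \<le> real (card H) - 1" using 3(6) by simp
  define F where "F a b M = (if {a, b} \<in> M then of_bool (chain (y # zs) (M - {{a, b}})) else (0 :: real))" for a b M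
  have "avg H (\<lambda>M. of_bool (chain (x # y # zs) M)) \<le> avg H (\<lambda>M. \<Sum>a\<in>?A. \<Sum>b\<in>?B - {a}. F a b M)"
  proof (rule avg_mono)
    fix M assume M: "M \<in> pairings H"
    have F0: "0 \<le> F a b M" for a b by (simp add: F_def)
    show "of_bool (chain (x # y # zs) M) \<le> (\<Sum>a\<in>?A. \<Sum>b\<in>?B - {a}. F a b M)"
    proof (cases "chain (x # y # zs) M")
      case True
      then obtain a b where ab: "fst a = x" "fst b = y" "{a, b} \<in> M" "chain (y # zs) (M - {{a, b}})"
        by auto
      note R = pairings_removeI[OF M ab(3)]
      have "1 = F a b M" using ab by (simp add: F_def)
      also have "\<dots> \<le> (\<Sum>b\<in>?B - {a}. F a b M)"
        using R ab fH by (intro member_le_sum F0) auto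
      also have "\<dots> \<le> (\<Sum>a\<in>?A. \<Sum>b\<in>?B - {a}. F a b M)"
        using R ab fH F0 by (intro member_le_sum[of a ?A "\<lambda>a. \<Sum>b\<in>?B - {a}. F a b M"] sum_nonneg) auto
      finally show ?thesis using True by simp
    next
      case False
      then show ?thesis using F0 by (simp del: chain.simps add: sum_nonneg)
    qed
  qed
  also have "\<dots> = (\<Sum>a\<in>?A. \<Sum>b\<in>?B - {a}. avg H (F a b))"
    by (simp only: avg_sum)
  also have "\<dots> \<le> (\<Sum>a\<in>?A. \<Sum>b\<in>?B - {a}. ?w / N)"
  proof (intro sum_mono)
    fix a b assume "a \<in> ?A" "b \<in> ?B - {a}"
    then have ab: "a \<in> H" "b \<in> H" "a \<noteq> b" by auto
    have "avg (H - {a, b}) (\<lambda>M. of_bool (chain (y # zs) M)) \<le> ?w"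
    proof (rule 3(2))
      show "real (card {h \<in> H - {a, b}. fst h = z}) \<le> e z" for z
      proof -
        have "card {h \<in> H - {a, b}. fst h = z} \<le> card {h \<in> H. fst h = z}"
          using fH by (intro card_mono) auto
        then show ?thesis using 3(4)[of z] by linarith
      qed
      show "N + real (2 * length (y # zs)) \<le> real (card (H - {a, b}))"
        using card_Diff_pair[OF fH ab] 3(6) N by (simp add: of_nat_diff)
    qed (use fH N in auto)
    then have "avg (H - {a, b}) (\<lambda>M. of_bool (chain (y # zs) M)) / (real (card H) - 1) \<le> ?w / N"
      using HN N w0 by (intro frac_le)
    then show "avg H (F a b) \<le> ?w / N"
      using avg_edge[OF fH ab, of "\<lambda>M. of_bool (chain (y # zs) M)"] unfolding F_def by linarith
  qed
  also have "\<dots> \<le> (\<Sum>a\<in>?A. e y * (?w / N))"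
  proof (rule sum_mono)
    fix a
    have "card (?B - {a}) \<le> card ?B" using fH by (intro card_mono) auto
    then have "real (card (?B - {a})) \<le> e y" using 3(4)[of y] by linarith
    then show "(\<Sum>b\<in>?B - {a}. ?w / N) \<le> e y * (?w / N)"
      unfolding sum_constant by (intro mult_right_mono divide_nonneg_pos[OF w0 N])
  qed
  also have "\<dots> \<le> e x * (e y * (?w / N))"
    unfolding sum_constant
    by (intro mult_right_mono mult_nonneg_nonneg e0 divide_nonneg_pos[OF w0 N] 3(4))
  also have "\<dots> = chain_weight e (x # y # zs) / N ^ (length (x # y # zs) - 1)"
    by (simp add: mult_ac)
  finally show ?case .
qed

lemma chain_take: "chain xs M \<Longrightarrow> chain (take i xs) M"
proof (induction xs M arbitrary: i rule: chain.induct)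
  case (1 x y zs M)
  then obtain a b where ab: "fst a = x" "fst b = y" "{a, b} \<in> M" "chain (y # zs) (M - {{a, b}})"
    by auto
  show ?case
  proof (cases i)
    case (Suc j)
    show ?thesis
    proof (cases j)
      case (Suc l)
      have "chain (take j (y # zs)) (M - {{a, b}})"
        using 1(1)[OF ab(4)] .
      then have "\<exists>a b. fst a = x \<and> fst b = y \<and> {a, b} \<in> M \<and> chain (y # take l zs) (M - {{a, b}})"
        using ab(1-3) Suc by (intro exI[of _ a] exI[of _ b] conjI) simp_all
      then show ?thesis using Suc \<open>i = Suc j\<close> by simp
    qed (use Suc in simp)
  qed simp
qed (auto simp: take_Cons split: nat.splits)

section \<open>Self-avoiding paths of the multigraph as chains\<close>

lemma pairing_graph_simps [simp]:
  "verts (pairing_graph n M) = {1..n}"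
  "tail (pairing_graph n M) h = fst (fst h)"
  "head (pairing_graph n M) h = fst (snd h)"
  by (auto simp: pairing_graph_def case_prod_unfold)

lemma arcs_pairing_graph: "h \<in> arcs (pairing_graph n M) \<longleftrightarrow> {fst h, snd h} \<in> M"
  by (cases h) (simp add: pairing_graph_def)

lemma awalk_verts_pairing_graph:
  assumes "pre_digraph.cas (pairing_graph n M) u p v"
  shows "pre_digraph.awalk_verts (pairing_graph n M) u p = u # map (\<lambda>h. fst (snd h)) p"
    and "pre_digraph.awalk_verts (pairing_graph n M) u p = map (\<lambda>h. fst (fst h)) p @ [v]"
proof -
  interpret pre_digraph "pairing_graph n M" .
  show "awalk_verts u p = u # map (\<lambda>h. fst (snd h)) p" "awalk_verts u p = map (\<lambda>h. fst (fst h)) p @ [v]"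
    using assms by (induction p arbitrary: u) auto
qed

text \<open>Needed because a path is also explored from its other end; swapping the half-edges of an
  arc gives the opposite arc of the same edge.\<close>

lemma cas_reverse:
  assumes "pre_digraph.cas (pairing_graph n M) u p v"
  shows "pre_digraph.cas (pairing_graph n M) v (rev (map prod.swap p)) u"
proof -
  interpret pre_digraph "pairing_graph n M" .
  have snoc: "cas x (q @ [h]) y \<longleftrightarrow> cas x q (fst (fst h)) \<and> fst (snd h) = y" for x q h y
    by (induction q arbitrary: x) (auto simp del: cas_append_iff)
  show ?thesis
    using assms by (induction p arbitrary: u) (auto simp: snoc simp del: cas_append_iff)
qed

text \<open>A self-avoiding path never returns to \<open>u\<close>, so its later arcs avoid the
  half-edge \<open>a\<close> of the removed edge and survive the removal.\<close>

lemma chain_if_path: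
  assumes "pre_digraph.cas (pairing_graph n M0) u p v" "\<And>h. h \<in> set p \<Longrightarrow> {fst h, snd h} \<in> M"
    and "distinct (u # map (\<lambda>h. fst (snd h)) p)"
  shows "chain (u # map (\<lambda>h. fst (snd h)) p) M"
  using assms
proof (induction p arbitrary: u M)
  case (Cons h p)
  interpret pre_digraph "pairing_graph n M0" .
  obtain a b where h: "h = (a, b)" by (cases h)
  have cas: "cas (fst b) p v" and u: "u = fst a" using Cons.prems(1) h by auto
  have "chain (fst b # map (\<lambda>h. fst (snd h)) p) (M - {{a, b}})"
  proof (rule Cons.IH[OF cas])
    show "{fst h', snd h'} \<in> M - {{a, b}}" if "h' \<in> set p" for h'
    proof -
      have "fst (fst h') \<in> set (awalk_verts (fst b) p)"
        unfolding awalk_verts_pairing_graph(2)[OF cas] using that by auto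
      moreover have "fst (snd h') \<in> set (awalk_verts (fst b) p)"
        unfolding awalk_verts_pairing_graph(1)[OF cas] using that by auto
      ultimately have "fst (fst h') \<in> set (awalk_verts (fst b) p)" "fst (snd h') \<in> set (awalk_verts (fst b) p)"
        by auto
      then have "a \<noteq> fst h'" "a \<noteq> snd h'"
        using Cons.prems(3) h u unfolding awalk_verts_pairing_graph(1)[OF cas] by auto
      then have "a \<notin> {fst h', snd h'}" by simp
      then have "{fst h', snd h'} \<noteq> {a, b}" by (metis insertI1)
      then show ?thesis using Cons.prems(2)[of h'] that by simp
    qed
  qed (use Cons.prems(3) h in auto)
  moreover have "{a, b} \<in> M" using Cons.prems(2)[of h] h by simp
  ultimately have "\<exists>a' b'. fst a' = u \<and> fst b' = fst b \<and> {a', b'} \<in> M \<and>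
      chain (fst b # map (\<lambda>h. fst (snd h)) p) (M - {{a', b'}})"
    using u by (intro exI[of _ a] exI[of _ b]) simp
  then show ?case by (simp add: h)
qed simp

definition vertex_paths :: "nat \<Rightarrow> nat \<Rightarrow> nat list set" where
  "vertex_paths n i = {xs. length xs = Suc i \<and> distinct xs \<and> set xs \<subseteq> {1..n}}"

lemma finite_vertex_paths: "finite (vertex_paths n i)"
  by (rule finite_subset[OF _ finite_lists_length_eq[of "{1..n}" "Suc i"]]) (auto simp: vertex_paths_def)

lemma card_vertex_paths: "card (vertex_paths n i) \<le> n ^ Suc i"
proof -
  have "card (vertex_paths n i) \<le> card {xs. set xs \<subseteq> {1..n} \<and> length xs = Suc i}"
    by (intro card_mono finite_lists_length_eq) (auto simp: vertex_paths_def)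
  then show ?thesis by (simp add: card_lists_length_eq)
qed

definition escapes :: "(nat \<Rightarrow> real) \<Rightarrow> (nat \<Rightarrow> real) \<Rightarrow> nat \<Rightarrow> nat list \<Rightarrow> bool" where
  "escapes g e i xs \<longleftrightarrow> (\<forall>j<i. e (xs ! j) \<le> g j) \<and> g i < e (xs ! i)"

lemma escape_or_bounded:
  assumes "xs \<in> vertex_paths n l" "chain xs M" "l \<le> 2 * m" "mono g"
  shows "(\<exists>i\<le>m. \<exists>ys\<in>vertex_paths n i. hd ys = hd xs \<and> chain ys M \<and> escapes g e i ys) \<or>
    (\<forall>j\<le>l. j \<le> m \<longrightarrow> e (xs ! j) \<le> g m)"
proof (cases "\<forall>j\<le>l. j \<le> m \<longrightarrow> e (xs ! j) \<le> g j")
  case True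
  then show ?thesis using assms(4) by (meson monoD order.trans)
next
  case False
  define i where "i = (LEAST j. j \<le> l \<and> j \<le> m \<and> g j < e (xs ! j))"
  have ex: "\<exists>j. j \<le> l \<and> j \<le> m \<and> g j < e (xs ! j)" using False by (auto simp: not_le)
  have i: "i \<le> l" "i \<le> m" "g i < e (xs ! i)"
    using LeastI_ex[OF ex] unfolding i_def by auto
  have min: "e (xs ! j) \<le> g j" if "j < i" for j
    using not_less_Least[of j "\<lambda>j. j \<le> l \<and> j \<le> m \<and> g j < e (xs ! j)"] that i unfolding i_def[symmetric] by auto
  let ?ys = "take (Suc i) xs"
  have "?ys \<in> vertex_paths n i"
    using assms(1) i set_take_subset[of "Suc i" xs] by (auto simp: vertex_paths_def)
  moreover have "hd ?ys = hd xs" by simp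
  moreover have "escapes g e i ?ys" using i min by (auto simp: escapes_def)
  ultimately show ?thesis using chain_take[OF assms(2)] i(2) by blast
qed

text \<open>Every vertex of a path with at most \<open>2 * m\<close> edges is within
  \<open>m\<close> steps of one of the ends. If the degrees do not exceed the barrier
  \<open>g\<close> within \<open>m\<close> steps of either end, they are all at most
  \<open>g m\<close>, because \<open>g\<close> is monotone.\<close>

lemma short_path_cases:
  assumes M: "M \<in> pairings (half_edges n d)"
    and p: "pre_digraph.apath (pairing_graph n M) u p v" and len: "length p \<le> 2 * m" and g: "mono g"
  shows "(\<exists>i\<le>m. \<exists>xs\<in>vertex_paths n i. hd xs = u \<and> chain xs M \<and> escapes g e i xs) \<or>
    (\<exists>i\<le>m. \<exists>xs\<in>vertex_paths n i. hd xs = v \<and> chain xs M \<and> escapes g e i xs) \<or>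
    (\<exists>i\<le>2 * m. \<exists>xs\<in>vertex_paths n i. hd xs = u \<and> last xs = v \<and> chain xs M \<and> (\<forall>j\<le>i. e (xs ! j) \<le> g m))"
proof -
  interpret pre_digraph "pairing_graph n M" .
  have cas: "cas u p v" and arcs: "\<And>h. h \<in> set p \<Longrightarrow> {fst h, snd h} \<in> M" and u: "u \<in> {1..n}"
    and dist: "distinct (awalk_verts u p)"
    using p by (auto simp: apath_def awalk_def arcs_pairing_graph subset_iff)
  let ?xs = "u # map (\<lambda>h. fst (snd h)) p" and ?q = "rev (map prod.swap p)"
  let ?l = "length p"
  have vs: "awalk_verts u p = ?xs" "?xs = map (\<lambda>h. fst (fst h)) p @ [v]"
    using awalk_verts_pairing_graph[OF cas] by auto
  have casq: "cas v ?q u" by (rule cas_reverse[OF cas])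
  have rev: "v # map (\<lambda>h. fst (snd h)) ?q = rev ?xs"
    unfolding vs(2) by (simp add: rev_map comp_def)
  have "snd h \<in> half_edges n d" if "h \<in> set p" for h
    using arcs[OF that] pairings_Union[OF M] by auto
  then have "set ?xs \<subseteq> {1..n}"
    using u by (auto simp: half_edges_eq)
  then have P: "?xs \<in> vertex_paths n ?l" "rev ?xs \<in> vertex_paths n ?l"
    using dist vs(1) by (auto simp: vertex_paths_def)
  have ch: "chain ?xs M"
    using chain_if_path[OF cas arcs] dist vs(1) by simp
  have chq: "chain (rev ?xs) M"
    unfolding rev[symmetric]
  proof (rule chain_if_path[OF casq])
    show "{fst h, snd h} \<in> M" if "h \<in> set ?q" for h
      using that arcs by (auto simp: insert_commute)
    show "distinct (v # map (\<lambda>h. fst (snd h)) ?q)"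
      unfolding rev using dist vs(1) by simp
  qed
  have hd: "hd ?xs = u" "hd (rev ?xs) = v" "last ?xs = v"
    unfolding rev[symmetric] by (simp, simp) (simp only: vs(2) last_snoc)
  show ?thesis
    using escape_or_bounded[OF P(1) ch len g, of e] escape_or_bounded[OF P(2) chq len g, of e]
  proof (elim disjE)
    assume 1: "\<forall>j\<le>?l. j \<le> m \<longrightarrow> e (?xs ! j) \<le> g m" and 2: "\<forall>j\<le>?l. j \<le> m \<longrightarrow> e (rev ?xs ! j) \<le> g m"
    have "e (?xs ! j) \<le> g m" if j: "j \<le> ?l" for j
    proof (cases "j \<le> m")
      case False
      have "rev ?xs ! (?l - j) = ?xs ! j"
        using j by (subst rev_nth) auto
      then show ?thesis using 2[rule_format, of "?l - j"] False len by auto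
    qed (use 1 j in auto)
    then show ?thesis using P(1) hd ch len by blast
  qed (use hd in auto)
qed

lemma chain_weight_eq_prod:
  "chain_weight e xs = (\<Prod>j<length xs. e (xs ! j) ^ ((if j = 0 then 0 else 1) + (if Suc j = length xs then 0 else 1)))"
proof (induction e xs rule: chain_weight.induct)
  case (1 e x y zs)
  show ?case
    unfolding chain_weight.simps 1
    by (simp add: prod.lessThan_Suc_shift mult_ac del: prod.lessThan_Suc)
qed auto

text \<open>The vertices of the path are distinct, so their degrees are independent. The product
  over positions is rewritten as one over all vertices, with factor 1 off the path, to fit the
  product formula for \<open>Pi_pmf\<close>.\<close>

lemma nn_integral_path_product:
  fixes F :: "nat \<Rightarrow> nat \<Rightarrow> ennreal"
  assumes "xs \<in> vertex_paths n i"
  shows "(\<integral>\<^sup>+d. (\<Prod>j\<le>i. F j (d (xs ! j))) \<partial>Pi_pmf {1..n} 0 (\<lambda>_. D)) = (\<Prod>j\<le>i. \<integral>\<^sup>+t. F j t \<partial>D)"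
proof -
  have len: "length xs = Suc i" and dist: "distinct xs" and sub: "set xs \<subseteq> {1..n}"
    using assms by (auto simp: vertex_paths_def)
  define idx where "idx = inv_into {..i} ((!) xs)"
  have bij: "bij_betw ((!) xs) {..i} (set xs)"
    using bij_betw_nth[OF dist, of "{..<Suc i}" "set xs"] len by (simp add: lessThan_Suc_atMost)
  have idx: "idx (xs ! j) = j" if "j \<le> i" for j
    unfolding idx_def using bij that by (auto simp: bij_betw_def intro: inv_into_f_f)
  define h where "h x t = (if x \<in> set xs then F (idx x) t else 1)" for x t
  have "(\<Prod>j\<le>i. F j (d (xs ! j))) = (\<Prod>x\<in>{1..n}. h x (d x))" for d
  proof -
    have "(\<Prod>j\<le>i. F j (d (xs ! j))) = (\<Prod>j\<le>i. F (idx (xs ! j)) (d (xs ! j)))"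
      by (intro prod.cong) (auto simp: idx)
    also have "\<dots> = (\<Prod>x\<in>set xs. F (idx x) (d x))"
      by (rule prod.reindex_bij_betw[OF bij])
    also have "\<dots> = (\<Prod>x\<in>{1..n}. h x (d x))"
      using sub by (intro prod.mono_neutral_cong_left) (auto simp: h_def)
    finally show ?thesis .
  qed
  then have "(\<integral>\<^sup>+d. (\<Prod>j\<le>i. F j (d (xs ! j))) \<partial>Pi_pmf {1..n} 0 (\<lambda>_. D)) =
      (\<Prod>x\<in>{1..n}. \<integral>\<^sup>+t. h x t \<partial>D)"
    by (simp add: nn_integral_prod_Pi_pmf)
  also have "\<dots> = (\<Prod>x\<in>set xs. \<integral>\<^sup>+t. F (idx x) t \<partial>D)"
    using sub by (intro prod.mono_neutral_cong_right) (auto simp: h_def)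
  also have "\<dots> = (\<Prod>j\<le>i. \<integral>\<^sup>+t. F (idx (xs ! j)) t \<partial>D)"
    by (rule prod.reindex_bij_betw[OF bij, symmetric])
  also have "\<dots> = (\<Prod>j\<le>i. \<integral>\<^sup>+t. F j t \<partial>D)"
    by (intro prod.cong) (auto simp: idx)
  finally show ?thesis .
qed

lemma prod_mono_ennreal:
  fixes f g :: "'a \<Rightarrow> ennreal"
  assumes "\<And>x. x \<in> A \<Longrightarrow> f x \<le> g x"
  shows "prod f A \<le> prod g A"
  using assms by (induction A rule: infinite_finite_induct) (auto intro!: mult_mono)

text \<open>The normalisation \<open>n ^ Suc i\<close> matches the number of paths. In the
  application \<open>i\<close> of the factors \<open>1 / n\<close> come from the edge probabilities
  and one from a uniform end point.\<close>

lemma nn_integral_paths: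
  fixes F :: "nat \<Rightarrow> nat \<Rightarrow> real" and D :: "nat pmf"
  assumes F: "\<And>j t. 0 \<le> F j t" and c: "\<And>j. j \<le> i \<Longrightarrow> (\<integral>\<^sup>+t. ennreal (F j t) \<partial>D) \<le> ennreal (c j)"
    and c0: "\<And>j. 0 \<le> c j" and n: "1 \<le> n"
  shows "(\<integral>\<^sup>+d. ennreal ((\<Sum>xs\<in>vertex_paths n i. \<Prod>j\<le>i. F j (d (xs ! j))) / real n ^ Suc i) \<partial>Pi_pmf {1..n} 0 (\<lambda>_. D))
    \<le> ennreal (\<Prod>j\<le>i. c j)"
proof -
  let ?N = "real n ^ Suc i"
  have N: "0 < ?N" using n by simp
  have "(\<integral>\<^sup>+d. ennreal ((\<Sum>xs\<in>vertex_paths n i. \<Prod>j\<le>i. F j (d (xs ! j))) / ?N) \<partial>Pi_pmf {1..n} 0 (\<lambda>_. D)) =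
      (\<integral>\<^sup>+d. (\<Sum>xs\<in>vertex_paths n i. \<Prod>j\<le>i. ennreal (F j (d (xs ! j)))) / ennreal ?N \<partial>Pi_pmf {1..n} 0 (\<lambda>_. D))"
    using N F by (intro nn_integral_cong) (simp add: prod_ennreal sum_ennreal prod_nonneg sum_nonneg divide_ennreal)
  also have "\<dots> = (\<Sum>xs\<in>vertex_paths n i. \<integral>\<^sup>+d. (\<Prod>j\<le>i. ennreal (F j (d (xs ! j)))) \<partial>Pi_pmf {1..n} 0 (\<lambda>_. D)) / ennreal ?N"
    by (simp add: nn_integral_divide nn_integral_sum)
  also have "\<dots> = (\<Sum>xs\<in>vertex_paths n i. \<Prod>j\<le>i. \<integral>\<^sup>+t. ennreal (F j t) \<partial>D) / ennreal ?N"
    by (intro arg_cong2[where f = "(/)"] sum.cong refl nn_integral_path_product)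
  also have "\<dots> \<le> (\<Sum>xs\<in>vertex_paths n i. \<Prod>j\<le>i. ennreal (c j)) / ennreal ?N"
    by (intro divide_right_mono_ennreal sum_mono prod_mono_ennreal) (use c in auto)
  also have "\<dots> = ennreal (card (vertex_paths n i) * (\<Prod>j\<le>i. c j) / ?N)"
  proof -
    have "(\<Sum>xs\<in>vertex_paths n i. \<Prod>j\<le>i. ennreal (c j)) = (\<Sum>xs\<in>vertex_paths n i. ennreal (\<Prod>j\<le>i. c j))"
      by (simp only: prod_ennreal[OF c0])
    also have "\<dots> = ennreal (\<Sum>xs\<in>vertex_paths n i. \<Prod>j\<le>i. c j)"
      using c0 by (intro sum_ennreal prod_nonneg) auto
    finally show ?thesis
      using N c0 by (simp only: sum_constant) (intro divide_ennreal mult_nonneg_nonneg prod_nonneg; simp)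
  qed
  also have "\<dots> \<le> ennreal (\<Prod>j\<le>i. c j)"
  proof (rule ennreal_leI)
    have "real (card (vertex_paths n i)) \<le> ?N"
      using card_vertex_paths[of n i] by (metis of_nat_le_iff of_nat_power)
    then show "card (vertex_paths n i) * (\<Prod>j\<le>i. c j) / ?N \<le> (\<Prod>j\<le>i. c j)"
      using N c0 mult_right_mono[of "real (card (vertex_paths n i))" ?N "\<Prod>j\<le>i. c j"]
      by (simp only: divide_le_eq mult.commute[of "\<Prod>j\<le>i. c j"] if_True prod_nonneg)
  qed
  finally show ?thesis .
qed

text \<open>The degree of an inner vertex enters the probability of a path twice, that of an end vertex
  once. A path with a single vertex has no edge.\<close>

definition path_power :: "nat \<Rightarrow> nat \<Rightarrow> nat" where
  "path_power i j = (if j = 0 then 0 else 1) + (if j = i then 0 else 1)"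

lemma path_power_le: "path_power i j \<le> 2"
  by (simp add: path_power_def)

lemma prod_of_bool: "finite A \<Longrightarrow> (\<Prod>j\<in>A. of_bool (P j)) = (of_bool (\<forall>j\<in>A. P j) :: real)"
  by (induction A rule: finite_induct) auto

lemma ennreal_linear_combination:
  assumes "0 \<le> a" "0 \<le> b" "0 < (c :: real)"
  shows "ennreal (2 * a + b / c) = ennreal 2 * ennreal a + ennreal b * ennreal (1 / c)"
proof -
  have "ennreal (2 * a + b * (1 / c)) = ennreal (2 * a) + ennreal (b * (1 / c))"
    using assms by (intro ennreal_plus) auto
  moreover have "ennreal (2 * a) = ennreal 2 * ennreal a"
    using assms by (intro ennreal_mult) auto
  moreover have "ennreal (b * (1 / c)) = ennreal b * ennreal (1 / c)"
    using assms by (intro ennreal_mult) auto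
  ultimately show ?thesis by simp
qed

text \<open>A union bound over the three cases of \<open>short_path_cases\<close>. The two escape
  cases are alike, whence the factor 2; in the last case both ends of the path are prescribed, which
  gains a further \<open>1 / n\<close>.\<close>

lemma prob_short_path:
  fixes D :: "nat pmf" and g :: "nat \<Rightarrow> real"
  assumes n: "1 \<le> n" "2 * (2 * m + 1) \<le> n" and D: "set_pmf D \<subseteq> {2..}"
    and s: "1 < s" "s < 2" and m0: "(\<integral>\<^sup>+t. ennreal ((real t + 1) powr s) \<partial>D) \<le> ennreal m0" "0 \<le> m0"
    and g: "mono g" "\<And>j. 1 \<le> g j"
  shows "measure_pmf.prob (sample_pmf D n)
      {(M, u, v). \<exists>p. pre_digraph.apath (pairing_graph n M) u p v \<and> length p \<le> 2 * m}
    \<le> 2 * (\<Sum>i\<le>m. \<Prod>j\<le>i. m0 * (if j = i then g i powr (1 - s) else if j = 0 then 1 else g j powr (2 - s)))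
      + (\<Sum>i\<le>2 * m. \<Prod>j\<le>i. (g m)\<^sup>2) / n"
proof -
  let ?S = "{(M, u, v). \<exists>p. pre_digraph.apath (pairing_graph n M) u p v \<and> length p \<le> 2 * m}"
  define short where "short M u v \<longleftrightarrow> (\<exists>p. pre_digraph.apath (pairing_graph n M) u p v \<and> length p \<le> 2 * m)" for M u v
  \<comment> \<open>Truncated moments by comparison with the moment of order \<open>s\<close>: an
    inner degree is squared but at most \<open>g j\<close>, giving \<open>g j powr (2 - s)\<close>;
    the last one exceeds \<open>g i\<close> and enters at most once, giving
    \<open>g i powr (1 - s)\<close>; the first one enters once and is bounded by the moment
    itself.\<close>
  define c where "c i j = m0 * (if j = i then g i powr (1 - s) else if j = 0 then 1 else g j powr (2 - s))" for i j
  define F where "F i j t = (real t + 1) ^ path_power i j * of_bool (if j < i then real t + 1 \<le> g j else g i < real t + 1)" for i j t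
  define G where "G i j t = (real t + 1) ^ path_power i j * of_bool (real t + 1 \<le> g m)" for i j t
  have n0: "0 < real n" using n by simp
  have F0: "0 \<le> F i j t" and G0: "0 \<le> G i j t" for i j t by (simp_all add: F_def G_def)
  have c0: "0 \<le> c i j" for i j using m0 by (simp add: c_def)
  have intF: "(\<integral>\<^sup>+t. ennreal (F i j t) \<partial>D) \<le> ennreal (c i j)" if "j \<le> i" for i j
  proof -
    define k where "k = (if j = i then g i powr (1 - s) else if j = 0 then 1 else g j powr (2 - s))"
    have k0: "0 \<le> k" by (simp add: k_def)
    have "F i j t \<le> (real t + 1) powr s * k" for t
    proof -
      define x where "x = real t + 1"
      have x: "1 \<le> x" by (simp add: x_def)
      consider (last) "j = i" | (first) "j < i" "j = 0" | (mid) "j < i" "j \<noteq> 0" using \<open>j \<le> i\<close> by linarith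
      then show ?thesis
      proof cases
        case last
        show ?thesis
        proof (cases "g i < x")
          case True
          have "x ^ path_power i j \<le> x ^ 1"
            using x last by (intro power_increasing) (auto simp: path_power_def)
          also have "\<dots> = x powr s * x powr (1 - s)"
            using x by (simp flip: powr_add)
          also have "\<dots> \<le> x powr s * g i powr (1 - s)"
            using True s g(2)[of i] by (intro mult_left_mono powr_mono2') auto
          finally show ?thesis using True last by (simp add: F_def k_def x_def)
        qed (use last in \<open>simp add: F_def k_def x_def\<close>)
      next
        case first
        have "x ^ path_power i j = x powr 1" using first x by (simp add: path_power_def)
        also have "\<dots> \<le> x powr s" using x s by (intro powr_mono) auto
        finally show ?thesis using first by (simp add: F_def k_def x_def)
      next
        case mid
        show ?thesis
        proof (cases "x \<le> g j")
          case True
          have "x ^ path_power i j = x powr 2" using mid x by (simp add: path_power_def power2_eq_square)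
          also have "\<dots> = x powr s * x powr (2 - s)" by (simp flip: powr_add)
          also have "\<dots> \<le> x powr s * g j powr (2 - s)"
            using True s x by (intro mult_left_mono powr_mono2) auto
          finally show ?thesis using True mid by (simp add: F_def k_def x_def)
        qed (use mid in \<open>simp add: F_def k_def x_def\<close>)
      qed
    qed
    then have "(\<integral>\<^sup>+t. ennreal (F i j t) \<partial>D) \<le> (\<integral>\<^sup>+t. ennreal ((real t + 1) powr s * k) \<partial>D)"
      by (intro nn_integral_mono ennreal_leI)
    also have "\<dots> = (\<integral>\<^sup>+t. ennreal ((real t + 1) powr s) \<partial>D) * ennreal k"
      using k0 by (simp add: ennreal_mult nn_integral_multc)
    also have "\<dots> \<le> ennreal m0 * ennreal k"
      by (intro mult_right_mono m0) simp
    also have "\<dots> = ennreal (c i j)"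
      using m0 k0 by (simp add: c_def k_def ennreal_mult)
    finally show ?thesis .
  qed
  have intG: "(\<integral>\<^sup>+t. ennreal (G i j t) \<partial>D) \<le> ennreal ((g m)\<^sup>2)" for i j
  proof -
    have "G i j t \<le> (g m)\<^sup>2" for t
    proof (cases "real t + 1 \<le> g m")
      case True
      have "(real t + 1) ^ path_power i j \<le> (real t + 1)\<^sup>2"
        using path_power_le by (intro power_increasing) auto
      also have "\<dots> \<le> (g m)\<^sup>2" using True by (intro power_mono) auto
      finally show ?thesis using True by (simp add: G_def)
    qed (simp add: G_def)
    then have "(\<integral>\<^sup>+t. ennreal (G i j t) \<partial>D) \<le> (\<integral>\<^sup>+t. ennreal ((g m)\<^sup>2) \<partial>D)"
      by (intro nn_integral_mono ennreal_leI)
    then show ?thesis by simp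
  qed
  define \<Phi> where "\<Phi> d i xs = (\<Prod>j\<le>i. F i j (d (xs ! j)))" for d :: "nat \<Rightarrow> nat" and i xs
  define \<Psi> where "\<Psi> d i xs = (\<Prod>j\<le>i. G i j (d (xs ! j)))" for d :: "nat \<Rightarrow> nat" and i xs
  define bnd where "bnd d = 2 * (\<Sum>i\<le>m. (\<Sum>xs\<in>vertex_paths n i. \<Phi> d i xs) / real n ^ Suc i) +
      (\<Sum>i\<le>2 * m. (\<Sum>xs\<in>vertex_paths n i. \<Psi> d i xs) / real n ^ Suc i) / n" for d
  have main: "(\<Sum>u\<in>{1..n}. \<Sum>v\<in>{1..n}. avg (half_edges n d) (\<lambda>M. of_bool (short M u v))) / n\<^sup>2 \<le> bnd d"
    if d: "\<And>i. i \<in> {1..n} \<Longrightarrow> 2 \<le> d i" for d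
  proof -
    let ?H = "half_edges n d"
    \<comment> \<open>The parity correction may raise a degree by one.\<close>
    define e where "e x = real (d x) + 1" for x
    have card_ch: "avg ?H (\<lambda>M. of_bool (chain xs M)) \<le> chain_weight e xs / real n ^ i"
      if "xs \<in> vertex_paths n i" "i \<le> 2 * m" for xs i
    proof -
      have len: "length xs = Suc i" using that by (simp add: vertex_paths_def)
      have "avg ?H (\<lambda>M. of_bool (chain xs M)) \<le> chain_weight e xs / real n ^ (length xs - 1)"
      proof (rule avg_chain[OF finite_half_edges _ n0])
        show "real (card {h \<in> ?H. fst h = x}) \<le> e x" for x
          using corrected_degree_bounds(2)[of n d x] by (auto simp: card_half_edges_at e_def)
        have "real (2 * n) \<le> real (card ?H)"
          using card_half_edges_ge[OF d] by (rule of_nat_mono)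
        then show "real n + real (2 * length xs) \<le> real (card ?H)"
          using n(2) that(2) len by simp
      qed
      then show ?thesis using len by simp
    qed
    \<comment> \<open>Sums over paths with prescribed ends dominate the indicator. Summing over
      \<open>u\<close> and \<open>v\<close> releases the constraints; \<open>B\<close>, where only
      one end is prescribed, gains a factor \<open>n\<close> in this way and \<open>C\<close> does
      not.\<close>
    define B where "B u M = (\<Sum>i\<le>m. \<Sum>xs\<in>{xs \<in> vertex_paths n i. hd xs = u}.
        of_bool (escapes g e i xs) * of_bool (chain xs M) :: real)" for u M
    define C where "C u v M = (\<Sum>i\<le>2 * m. \<Sum>xs\<in>{xs \<in> vertex_paths n i. (hd xs, last xs) = (u, v)}.
        of_bool (\<forall>j\<le>i. e (xs ! j) \<le> g m) * of_bool (chain xs M) :: real)" for u v M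
    note fin = finite_vertex_paths
    have B0: "0 \<le> B u M" and C0: "0 \<le> C u v M" for u v M
      by (auto simp: B_def C_def intro!: sum_nonneg)
    have "of_bool (short M u v) \<le> (B u M + B v M) + C u v M" if M: "M \<in> pairings ?H" for M u v
    proof (cases "short M u v")
      case True
      have Bge: "1 \<le> B u M" if "i \<le> m" "xs \<in> vertex_paths n i" "hd xs = u" "chain xs M" "escapes g e i xs" for i xs u
      proof -
        have "1 = of_bool (escapes g e i xs) * (of_bool (chain xs M) :: real)" using that by simp
        also have "\<dots> \<le> (\<Sum>xs\<in>{xs \<in> vertex_paths n i. hd xs = u}. of_bool (escapes g e i xs) * of_bool (chain xs M))"
          by (rule member_le_sum) (use that fin in auto)
        also have "\<dots> \<le> B u M"
          unfolding B_def by (rule member_le_sum) (use that in \<open>auto intro!: sum_nonneg\<close>)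
        finally show ?thesis .
      qed
      have Cge: "1 \<le> C u v M" if "i \<le> 2 * m" "xs \<in> vertex_paths n i" "hd xs = u" "last xs = v" "chain xs M" "\<forall>j\<le>i. e (xs ! j) \<le> g m" for i xs
      proof -
        have "1 = of_bool (\<forall>j\<le>i. e (xs ! j) \<le> g m) * (of_bool (chain xs M) :: real)" using that by simp
        also have "\<dots> \<le> (\<Sum>xs\<in>{xs \<in> vertex_paths n i. (hd xs, last xs) = (u, v)}. of_bool (\<forall>j\<le>i. e (xs ! j) \<le> g m) * of_bool (chain xs M))"
          by (rule member_le_sum) (use that fin in auto)
        also have "\<dots> \<le> C u v M"
          unfolding C_def by (rule member_le_sum) (use that in \<open>auto intro!: sum_nonneg\<close>)
        finally show ?thesis .
      qed
      obtain p where p: "pre_digraph.apath (pairing_graph n M) u p v" "length p \<le> 2 * m"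
        using True unfolding short_def by blast
      have "1 \<le> (B u M + B v M) + C u v M"
        using short_path_cases[OF M p g(1), of e]
      proof (elim disjE exE conjE bexE)
        fix i xs assume "i \<le> m" "xs \<in> vertex_paths n i" "hd xs = u" "chain xs M" "escapes g e i xs"
        from Bge[OF this] show ?thesis using B0[of v M] C0[of u v M] by linarith
      next
        fix i xs assume "i \<le> m" "xs \<in> vertex_paths n i" "hd xs = v" "chain xs M" "escapes g e i xs"
        from Bge[OF this] show ?thesis using B0[of u M] C0[of u v M] by linarith
      next
        fix i xs assume "i \<le> 2 * m" "xs \<in> vertex_paths n i" "hd xs = u" "last xs = v" "chain xs M" "\<forall>j\<le>i. e (xs ! j) \<le> g m"
        from Cge[OF this] show ?thesis using B0[of u M] B0[of v M] by linarith
      qed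
      then show ?thesis using True by simp
    next
      case False
      then show ?thesis using B0[of u M] B0[of v M] C0[of u v M] by simp
    qed
    then have 1: "avg ?H (\<lambda>M. of_bool (short M u v)) \<le> (avg ?H (B u) + avg ?H (B v)) + avg ?H (C u v)" for u v
      unfolding avg_add[symmetric] by (intro avg_mono)
    have \<Phi>: "chain_weight e xs * of_bool (escapes g e i xs) = \<Phi> d i xs"
      "chain_weight e xs * of_bool (\<forall>j\<le>i. e (xs ! j) \<le> g m) = \<Psi> d i xs" if "xs \<in> vertex_paths n i" for i xs
    proof -
      have len: "length xs = Suc i" using that by (simp add: vertex_paths_def)
      have cw: "chain_weight e xs = (\<Prod>j\<le>i. e (xs ! j) ^ path_power i j)"
        unfolding chain_weight_eq_prod len lessThan_Suc_atMost by (intro prod.cong) (auto simp: path_power_def)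
      have "escapes g e i xs \<longleftrightarrow> (\<forall>j\<in>{..i}. if j < i then e (xs ! j) \<le> g j else g i < e (xs ! j))"
        by (auto simp: escapes_def order.strict_iff_order)
      then show "chain_weight e xs * of_bool (escapes g e i xs) = \<Phi> d i xs"
        unfolding cw \<Phi>_def F_def prod.distrib by (simp add: prod_of_bool e_def)
      show "chain_weight e xs * of_bool (\<forall>j\<le>i. e (xs ! j) \<le> g m) = \<Psi> d i xs"
        unfolding cw \<Psi>_def G_def prod.distrib by (simp add: prod_of_bool e_def Ball_def)
    qed
    have avgB: "avg ?H (B u) \<le> (\<Sum>i\<le>m. \<Sum>xs\<in>{xs \<in> vertex_paths n i. hd xs = u}. \<Phi> d i xs / real n ^ i)" for u
      unfolding B_def avg_sum avg_cmult
    proof (intro sum_mono)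
      fix i xs assume i: "i \<in> {..m}" and xs: "xs \<in> {xs \<in> vertex_paths n i. hd xs = u}"
      have "of_bool (escapes g e i xs) * avg ?H (\<lambda>M. of_bool (chain xs M))
          \<le> of_bool (escapes g e i xs) * (chain_weight e xs / real n ^ i)"
        using i xs by (intro mult_left_mono card_ch) auto
      then show "of_bool (escapes g e i xs) * avg ?H (\<lambda>M. of_bool (chain xs M)) \<le> \<Phi> d i xs / real n ^ i"
        using \<Phi>(1)[of xs i] xs by (simp add: mult.commute)
    qed
    have avgC: "avg ?H (C u v) \<le> (\<Sum>i\<le>2 * m. \<Sum>xs\<in>{xs \<in> vertex_paths n i. (hd xs, last xs) = (u, v)}. \<Psi> d i xs / real n ^ i)" for u v
      unfolding C_def avg_sum avg_cmult
    proof (intro sum_mono)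
      fix i xs assume i: "i \<in> {..2 * m}" and xs: "xs \<in> {xs \<in> vertex_paths n i. (hd xs, last xs) = (u, v)}"
      have "of_bool (\<forall>j\<le>i. e (xs ! j) \<le> g m) * avg ?H (\<lambda>M. of_bool (chain xs M))
          \<le> of_bool (\<forall>j\<le>i. e (xs ! j) \<le> g m) * (chain_weight e xs / real n ^ i)"
        using i xs by (intro mult_left_mono card_ch) auto
      then show "of_bool (\<forall>j\<le>i. e (xs ! j) \<le> g m) * avg ?H (\<lambda>M. of_bool (chain xs M)) \<le> \<Psi> d i xs / real n ^ i"
        using \<Phi>(2)[of xs i] xs by (simp add: mult.commute)
    qed
    have in_range: "hd xs \<in> {1..n}" "last xs \<in> {1..n}" if "xs \<in> vertex_paths n i" for xs i
    proof -
      have "xs \<noteq> []" "set xs \<subseteq> {1..n}" using that by (auto simp: vertex_paths_def)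
      then show "hd xs \<in> {1..n}" "last xs \<in> {1..n}" using hd_in_set last_in_set by blast+
    qed
    have sumB: "(\<Sum>u\<in>{1..n}. avg ?H (B u)) \<le> (\<Sum>i\<le>m. (\<Sum>xs\<in>vertex_paths n i. \<Phi> d i xs) / real n ^ i)"
    proof -
      have "(\<Sum>u\<in>{1..n}. avg ?H (B u)) \<le>
          (\<Sum>u\<in>{1..n}. \<Sum>i\<le>m. \<Sum>xs\<in>{xs \<in> vertex_paths n i. hd xs = u}. \<Phi> d i xs / real n ^ i)"
        by (intro sum_mono avgB)
      also have "\<dots> = (\<Sum>i\<le>m. \<Sum>u\<in>{1..n}. \<Sum>xs\<in>{xs \<in> vertex_paths n i. hd xs = u}. \<Phi> d i xs / real n ^ i)"
        by (rule sum.swap)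
      also have "\<dots> = (\<Sum>i\<le>m. \<Sum>xs\<in>vertex_paths n i. \<Phi> d i xs / real n ^ i)"
        using in_range fin by (intro sum.cong refl sum.group) auto
      finally show ?thesis by (simp add: sum_divide_distrib)
    qed
    have sumC: "(\<Sum>u\<in>{1..n}. \<Sum>v\<in>{1..n}. avg ?H (C u v)) \<le> (\<Sum>i\<le>2 * m. (\<Sum>xs\<in>vertex_paths n i. \<Psi> d i xs) / real n ^ i)"
    proof -
      have "(\<Sum>u\<in>{1..n}. \<Sum>v\<in>{1..n}. avg ?H (C u v)) = (\<Sum>uv\<in>{1..n} \<times> {1..n}. avg ?H (C (fst uv) (snd uv)))"
        by (simp add: sum.cartesian_product case_prod_unfold)
      also have "\<dots> \<le>
          (\<Sum>uv\<in>{1..n} \<times> {1..n}. \<Sum>i\<le>2 * m. \<Sum>xs\<in>{xs \<in> vertex_paths n i. (hd xs, last xs) = uv}. \<Psi> d i xs / real n ^ i)"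
        using avgC by (intro sum_mono) (simp add: prod_eq_iff)
      also have "\<dots> = (\<Sum>i\<le>2 * m. \<Sum>uv\<in>{1..n} \<times> {1..n}. \<Sum>xs\<in>{xs \<in> vertex_paths n i. (hd xs, last xs) = uv}. \<Psi> d i xs / real n ^ i)"
        by (rule sum.swap)
      also have "\<dots> = (\<Sum>i\<le>2 * m. \<Sum>xs\<in>vertex_paths n i. \<Psi> d i xs / real n ^ i)"
        using in_range fin by (intro sum.cong refl sum.group) auto
      finally show ?thesis by (simp add: sum_divide_distrib)
    qed
    have "(\<Sum>u\<in>{1..n}. \<Sum>v\<in>{1..n}. avg ?H (\<lambda>M. of_bool (short M u v))) \<le>
        (\<Sum>u\<in>{1..n}. \<Sum>v\<in>{1..n}. (avg ?H (B u) + avg ?H (B v)) + avg ?H (C u v))"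
      by (intro sum_mono 1)
    also have "\<dots> = n * (\<Sum>u\<in>{1..n}. avg ?H (B u)) + n * (\<Sum>u\<in>{1..n}. avg ?H (B u)) + (\<Sum>u\<in>{1..n}. \<Sum>v\<in>{1..n}. avg ?H (C u v))"
      by (simp add: sum.distrib sum_distrib_left)
    also have "\<dots> \<le> n * (\<Sum>i\<le>m. (\<Sum>xs\<in>vertex_paths n i. \<Phi> d i xs) / real n ^ i) +
        n * (\<Sum>i\<le>m. (\<Sum>xs\<in>vertex_paths n i. \<Phi> d i xs) / real n ^ i) +
        (\<Sum>i\<le>2 * m. (\<Sum>xs\<in>vertex_paths n i. \<Psi> d i xs) / real n ^ i)"
      using sumB sumC by (intro add_mono mult_left_mono) auto
    also have "\<dots> = bnd d * n\<^sup>2"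
      using n0 by (simp add: bnd_def sum_divide_distrib sum_distrib_left field_simps power2_eq_square)
    finally show ?thesis
      using n0 by (simp add: divide_le_eq)
  qed
  have "emeasure (sample_pmf D n) ?S = (\<integral>\<^sup>+(M, u, v). ennreal (of_bool (short M u v)) \<partial>sample_pmf D n)"
  proof -
    have "emeasure (sample_pmf D n) ?S = (\<integral>\<^sup>+x. indicator ?S x \<partial>sample_pmf D n)"
      by (subst nn_integral_indicator) simp_all
    also have "\<dots> = (\<integral>\<^sup>+(M, u, v). ennreal (of_bool (short M u v)) \<partial>sample_pmf D n)"
      by (intro nn_integral_cong) (auto simp: short_def indicator_def split: prod.splits)
    finally show ?thesis .
  qed
  also have "\<dots> = (\<integral>\<^sup>+d. ennreal ((\<Sum>u\<in>{1..n}. \<Sum>v\<in>{1..n}. avg (half_edges n d) (\<lambda>M. of_bool (short M u v))) / n\<^sup>2)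
      \<partial>Pi_pmf {1..n} 0 (\<lambda>_. D))"
    by (rule nn_integral_sample_pmf[OF n(1)]) simp
  also have "\<dots> \<le> (\<integral>\<^sup>+d. ennreal (bnd d) \<partial>Pi_pmf {1..n} 0 (\<lambda>_. D))"
  proof (rule nn_integral_mono_AE)
    show "AE d in Pi_pmf {1..n} 0 (\<lambda>_. D). ennreal ((\<Sum>u\<in>{1..n}. \<Sum>v\<in>{1..n}.
        avg (half_edges n d) (\<lambda>M. of_bool (short M u v))) / n\<^sup>2) \<le> ennreal (bnd d)"
    proof (rule AE_pmfI)
      fix d assume "d \<in> set_pmf (Pi_pmf {1..n} 0 (\<lambda>_. D))"
      then have "2 \<le> d i" if "i \<in> {1..n}" for i
        using that D by (auto simp: set_Pi_pmf PiE_dflt_def)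
      then show "ennreal ((\<Sum>u\<in>{1..n}. \<Sum>v\<in>{1..n}. avg (half_edges n d) (\<lambda>M. of_bool (short M u v))) / n\<^sup>2) \<le> ennreal (bnd d)"
        by (intro ennreal_leI main)
    qed
  qed
  also have "\<dots> \<le> ennreal (2 * (\<Sum>i\<le>m. \<Prod>j\<le>i. c i j) + (\<Sum>i\<le>2 * m. \<Prod>j\<le>i. (g m)\<^sup>2) / n)"
  proof -
    define a where "a i d = (\<Sum>xs\<in>vertex_paths n i. \<Phi> d i xs) / real n ^ Suc i" for i d
    define b where "b i d = (\<Sum>xs\<in>vertex_paths n i. \<Psi> d i xs) / real n ^ Suc i" for i d
    have a0: "0 \<le> a i d" and b0: "0 \<le> b i d" for i d
      unfolding a_def b_def \<Phi>_def \<Psi>_def by (auto intro!: divide_nonneg_nonneg sum_nonneg prod_nonneg F0 G0)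
    have "(\<integral>\<^sup>+d. ennreal (bnd d) \<partial>Pi_pmf {1..n} 0 (\<lambda>_. D)) =
        (\<integral>\<^sup>+d. ennreal 2 * (\<Sum>i\<le>m. ennreal (a i d)) + (\<Sum>i\<le>2 * m. ennreal (b i d)) * ennreal (1 / real n) \<partial>Pi_pmf {1..n} 0 (\<lambda>_. D))"
      unfolding bnd_def a_def[symmetric] b_def[symmetric] using a0 b0 n0
      by (intro nn_integral_cong) (simp only: ennreal_linear_combination sum_nonneg sum_ennreal)
    also have "\<dots> = ennreal 2 * (\<Sum>i\<le>m. \<integral>\<^sup>+d. ennreal (a i d) \<partial>Pi_pmf {1..n} 0 (\<lambda>_. D)) +
        (\<Sum>i\<le>2 * m. \<integral>\<^sup>+d. ennreal (b i d) \<partial>Pi_pmf {1..n} 0 (\<lambda>_. D)) * ennreal (1 / real n)"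
      by (simp add: nn_integral_add nn_integral_cmult nn_integral_multc nn_integral_sum)
    also have "\<dots> \<le> ennreal 2 * (\<Sum>i\<le>m. ennreal (\<Prod>j\<le>i. c i j)) +
        (\<Sum>i\<le>2 * m. ennreal (\<Prod>j\<le>i. (g m)\<^sup>2)) * ennreal (1 / real n)"
      unfolding a_def b_def \<Phi>_def \<Psi>_def
      by (intro add_mono mult_left_mono mult_right_mono sum_mono nn_integral_paths F0 G0 c0 intF intG n) auto
    also have "\<dots> = ennreal (2 * (\<Sum>i\<le>m. \<Prod>j\<le>i. c i j) + (\<Sum>i\<le>2 * m. \<Prod>j\<le>i. (g m)\<^sup>2) / n)"
    proof -
      have "0 \<le> (\<Prod>j\<le>i. c i j)" "0 \<le> (\<Prod>j\<le>i. (g m)\<^sup>2)" for i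
        using c0 by (auto intro!: prod_nonneg)
      then show ?thesis
        using n0 by (simp only: ennreal_linear_combination sum_nonneg sum_ennreal)
    qed
    finally show ?thesis .
  qed
  finally show ?thesis
    unfolding c_def measure_pmf.emeasure_eq_measure
    using m0 by (subst (asm) ennreal_le_iff) (auto intro!: add_nonneg_nonneg sum_nonneg prod_nonneg divide_nonneg_nonneg mult_nonneg_nonneg)
qed

section \<open>Moments of a power law and the choice of the barrier\<close>

locale power_law =
  fixes D :: "nat pmf" and \<tau> c\<^sub>1 C\<^sub>1 :: real
  assumes c\<^sub>1: "0 < c\<^sub>1" and \<tau>: "2 < \<tau>" "\<tau> < 3"
    and tail: "\<And>x::real. x \<ge> 1 \<Longrightarrow>
           c\<^sub>1 * x powr (-(\<tau> - 1)) \<le> measure_pmf.prob D {k. real k > x} \<and>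
           measure_pmf.prob D {k. real k > x} \<le> C\<^sub>1 * x powr (-(\<tau> - 1))"
    and min_degree: "measure_pmf.prob D {k. k \<ge> 2} = 1"
begin

lemma set_pmf_D: "set_pmf D \<subseteq> {2..}"
proof -
  have "AE k in D. k \<in> {k. k \<ge> 2}"
    by (rule measure_pmf.prob_eq_1[THEN iffD1]) (simp_all add: min_degree)
  then show ?thesis by (auto simp: AE_measure_pmf_iff)
qed

lemma C1_ge_1: "1 \<le> C\<^sub>1"
proof -
  have "1 = measure_pmf.prob D {k. k \<ge> 2}" using min_degree by simp
  also have "{k. k \<ge> 2} = {k. real k > 1}" by auto
  finally show ?thesis using tail[of 1] by simp
qed

text \<open>Summation of tails: the probability that \<open>(D + 1) powr s\<close> exceeds
  \<open>k\<close> is at most of order \<open>k powr (- ((\<tau> - 1) / s))\<close>, which is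
  summable because \<open>s < \<tau> - 1\<close>.\<close>

lemma finite_moment:
  assumes s: "1 < s" "s < \<tau> - 1"
  obtains m0 where "1 \<le> m0" "(\<integral>\<^sup>+t. ennreal ((real t + 1) powr s) \<partial>D) \<le> ennreal m0"
proof -
  \<comment> \<open>The term \<open>of_bool (k < 4)\<close> covers the values for which the tail
    bound may be out of reach: it needs \<open>y \<ge> 1\<close>, that is
    \<open>k \<ge> 2 powr s\<close>, and \<open>s < 2\<close>.\<close>
  define a where "a k = C\<^sub>1 * 2 powr (\<tau> - 1) * real k powr (- ((\<tau> - 1) / s)) + of_bool (k < 4)" for k :: nat
  have a0: "0 \<le> a k" for k using C1_ge_1 by (simp add: a_def)
  have "summable (\<lambda>k. real k powr (- ((\<tau> - 1) / s)))"
    using s by (subst summable_real_powr_iff) (simp add: field_simps)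
  moreover have "summable (\<lambda>k. of_bool (k < (4::nat)) :: real)"
    by (rule summable_finite[of "{..<4}"]) auto
  ultimately have "summable a"
    unfolding a_def by (intro summable_add summable_mult)
  have pk: "measure_pmf.prob D {t. k < nat \<lceil>(real t + 1) powr s\<rceil>} \<le> a k" for k
  proof (cases "k < 4")
    case True
    have "measure_pmf.prob D {t. k < nat \<lceil>(real t + 1) powr s\<rceil>} \<le> 1" by simp
    then show ?thesis using True C1_ge_1 by (simp add: a_def add_increasing)
  next
    case False
    \<comment> \<open>As \<open>D \<ge> 2\<close> gives \<open>D + 1 < 2 * D\<close>, the event
      \<open>(D + 1) powr s > k\<close> forces \<open>D > y\<close>.\<close>
    define y where "y = real k powr (1 / s) / 2"
    have "2 \<le> real k powr (1 / s)"
    proof -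
      have "2 = (2 powr s) powr (1 / s)" using s by (simp add: powr_powr)
      also have "\<dots> \<le> real k powr (1 / s)"
      proof (intro powr_mono2)
        have "(2::real) powr s \<le> 2 powr 2" using s \<tau> by (intro powr_mono) auto
        then show "2 powr s \<le> real k" using False by simp
      qed (use s in auto)
      finally show ?thesis .
    qed
    then have y: "1 \<le> y" by (simp add: y_def)
    have "measure_pmf.prob D {t. k < nat \<lceil>(real t + 1) powr s\<rceil>} \<le> measure_pmf.prob D {t. real t > y}"
    proof (rule measure_pmf.finite_measure_mono_AE)
      show "AE t in D. t \<in> {t. k < nat \<lceil>(real t + 1) powr s\<rceil>} \<longrightarrow> t \<in> {t. real t > y}"
      proof (rule AE_pmfI)
        fix t assume "t \<in> set_pmf D"
        then have t: "2 \<le> t" using set_pmf_D by auto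
        show "t \<in> {t. k < nat \<lceil>(real t + 1) powr s\<rceil>} \<longrightarrow> t \<in> {t. real t > y}"
        proof
          assume "t \<in> {t. k < nat \<lceil>(real t + 1) powr s\<rceil>}"
          then have "real k < (real t + 1) powr s" by (simp, linarith)
          also have "\<dots> < (2 * real t) powr s"
            using t s by (intro powr_less_mono2) auto
          finally have "real k powr (1 / s) < ((2 * real t) powr s) powr (1 / s)"
            using s by (intro powr_less_mono2) auto
          then show "t \<in> {t. real t > y}"
            using s by (simp add: y_def powr_powr)
        qed
      qed
    qed simp
    also have "\<dots> \<le> C\<^sub>1 * y powr (-(\<tau> - 1))" using tail[OF y] by simp
    also have "y powr (-(\<tau> - 1)) = 2 powr (\<tau> - 1) * real k powr (- ((\<tau> - 1) / s))"
    proof -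
      have "(x powr (1 / s) / 2) powr (- \<beta>) = 2 powr \<beta> * x powr (- (\<beta> / s))" for x \<beta> :: real
        by (simp add: powr_divide powr_powr powr_minus divide_simps)
      then show ?thesis unfolding y_def .
    qed
    finally show ?thesis using False by (simp add: a_def mult.assoc)
  qed
  have "(\<integral>\<^sup>+t. ennreal ((real t + 1) powr s) \<partial>D) \<le> (\<integral>\<^sup>+t. of_nat (nat \<lceil>(real t + 1) powr s\<rceil>) \<partial>D)"
    by (intro nn_integral_mono) (simp add: ennreal_of_nat_eq_real_of_nat, intro ennreal_leI, linarith)
  also have "\<dots> = (\<Sum>k. emeasure D {t \<in> space D. k < nat \<lceil>(real t + 1) powr s\<rceil>})"
    by (rule nn_integral_nat_function) simp
  also have "\<dots> \<le> (\<Sum>k. ennreal (a k))"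
    using pk by (intro suminf_le summableI) (simp add: measure_pmf.emeasure_eq_measure ennreal_leI)
  also have "\<dots> = ennreal (\<Sum>k. a k)"
    using a0 \<open>summable a\<close> by (rule suminf_ennreal2)
  also have "\<dots> \<le> ennreal (max 1 (\<Sum>k. a k))" by (intro ennreal_leI) simp
  finally show ?thesis by (rule that[rotated]) simp
qed

text \<open>With the barrier \<open>exp (A * B ^ j)\<close> the inner degrees contribute at most
  \<open>A * (2 - s) * (B ^ i / (B - 1))\<close> to the exponent, and the last one contributes
  \<open>A * (1 - s) * B ^ i\<close>. The sum is \<open>- A * \<theta> * B ^ i\<close>, and
  \<open>\<theta> > 0\<close> is exactly the condition \<open>B > 1 / (s - 1)\<close>.\<close>

lemma prob_short_path_le:
  assumes s: "1 < s" "s < \<tau> - 1" and B: "1 / (s - 1) < B" and A: "0 \<le> A"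
    and m0: "1 \<le> m0" "(\<integral>\<^sup>+t. ennreal ((real t + 1) powr s) \<partial>D) \<le> ennreal m0"
    and \<theta>: "\<theta> = (s - 1) - (2 - s) / (B - 1)"
    and A2: "m0 * exp (- A * \<theta> * (B - 1)) \<le> 1 / 2"
    and n: "1 \<le> n" "2 * (2 * m + 1) \<le> n"
  shows "measure_pmf.prob (sample_pmf D n)
      {(M, u, v). \<exists>p. pre_digraph.apath (pairing_graph n M) u p v \<and> length p \<le> 2 * m}
    \<le> 4 * (m0 * exp (- A * \<theta>)) + (2 * real m + 1) * exp (2 * (2 * real m + 1) * A * B ^ m) / n"
proof -
  define g where "g j = exp (A * B ^ j)" for j :: nat
  have s2: "s < 2" using s \<tau> by simp
  have "1 < 1 / (s - 1)" using s s2 by (simp add: field_simps)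
  then have B1: "1 < B" using B by linarith
  have "1 < B * (s - 1)" using B s by (simp add: field_simps)
  then have "(2 - s) / (B - 1) < s - 1" using B1 by (simp add: field_simps)
  then have \<theta>0: "0 < \<theta>" using \<theta> by simp
  have g: "mono g" "\<And>j. 1 \<le> g j"
    using B1 A by (auto simp: g_def mono_def intro!: mult_left_mono power_increasing)
  let ?k = "\<lambda>i j. m0 * (if j = i then g i powr (1 - s) else if j = 0 then 1 else g j powr (2 - s))"
  have "(\<Prod>j\<le>i. ?k i j) \<le> m0 * exp (- A * \<theta>) * (1 / 2) ^ i" for i
  proof -
    have "(\<Prod>j<i. if j = 0 then 1 else g j powr (2 - s)) \<le> (\<Prod>j<i. g j powr (2 - s))"
      using g(2) s2 by (intro prod_mono) (auto intro!: ge_one_powr_ge_zero)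
    also have "\<dots> = exp (A * (2 - s) * (\<Sum>j<i. B ^ j))"
      by (simp add: g_def powr_def exp_sum[symmetric] sum_distrib_left mult_ac)
    also have "\<dots> \<le> exp (A * (2 - s) * (B ^ i / (B - 1)))"
    proof -
      have "(\<Sum>j<i. B ^ j) = (B ^ i - 1) / (B - 1)"
        using B1 by (simp add: geometric_sum)
      also have "\<dots> \<le> B ^ i / (B - 1)" using B1 by (intro divide_right_mono) auto
      finally have "A * (2 - s) * (\<Sum>j<i. B ^ j) \<le> A * (2 - s) * (B ^ i / (B - 1))"
        by (rule mult_left_mono) (use A s2 in simp)
      then show ?thesis by (simp only: exp_le_cancel_iff)
    qed
    finally have le: "(\<Prod>j<i. if j = 0 then 1 else g j powr (2 - s)) \<le> exp (A * (2 - s) * (B ^ i / (B - 1)))" .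
    have "(\<Prod>j\<le>i. ?k i j) = m0 ^ Suc i * (\<Prod>j\<le>i. if j = i then g i powr (1 - s) else if j = 0 then 1 else g j powr (2 - s))"
      by (simp add: prod.distrib)
    also have "(\<Prod>j\<le>i. if j = i then g i powr (1 - s) else if j = 0 then 1 else g j powr (2 - s)) =
        (\<Prod>j<i. if j = 0 then 1 else g j powr (2 - s)) * exp (A * (1 - s) * B ^ i)"
      unfolding lessThan_Suc_atMost[symmetric] prod.lessThan_Suc by (simp add: g_def powr_def mult_ac)
    also have "m0 ^ Suc i * \<dots> \<le> m0 ^ Suc i * (exp (A * (2 - s) * (B ^ i / (B - 1))) * exp (A * (1 - s) * B ^ i))"
      using m0 le by (intro mult_left_mono mult_right_mono) auto
    also have "\<dots> = m0 ^ Suc i * exp (- A * \<theta> * B ^ i)"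
    proof -
      have "A * (2 - s) * (B ^ i / (B - 1)) + A * (1 - s) * B ^ i = - A * \<theta> * B ^ i"
        using B1 by (simp add: \<theta> field_simps)
      then show ?thesis by (simp only: exp_add[symmetric])
    qed
    \<comment> \<open>Bernoulli's inequality makes the exponent linear in \<open>i\<close>, so that
      by \<open>A2\<close> the powers of \<open>m0\<close> are absorbed into a geometric series of
      ratio 1/2.\<close>
    also have "\<dots> \<le> m0 ^ Suc i * exp (- A * \<theta> * (1 + real i * (B - 1)))"
    proof -
      have "1 + real i * (B - 1) \<le> B ^ i"
        using Bernoulli_inequality[of "B - 1" i] B1 by simp
      then have "A * \<theta> * (1 + real i * (B - 1)) \<le> A * \<theta> * B ^ i"
        using A \<theta>0 by (intro mult_left_mono) auto
      then show ?thesis using m0 by (intro mult_left_mono) auto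
    qed
    also have "\<dots> = m0 * exp (- A * \<theta>) * (m0 * exp (- A * \<theta> * (B - 1))) ^ i"
      by (simp add: power_mult_distrib exp_of_nat_mult[symmetric] exp_add[symmetric] algebra_simps)
    also have "\<dots> \<le> m0 * exp (- A * \<theta>) * (1 / 2) ^ i"
      using A2 m0 by (intro mult_left_mono power_mono) auto
    finally show ?thesis .
  qed
  then have "(\<Sum>i\<le>m. \<Prod>j\<le>i. ?k i j) \<le> (\<Sum>i\<le>m. m0 * exp (- A * \<theta>) * (1 / 2) ^ i)"
    by (intro sum_mono)
  also have "\<dots> \<le> m0 * exp (- A * \<theta>) * 2"
  proof -
    have "(\<Sum>i<Suc m. (1 / 2 :: real) ^ i) \<le> 2"
      by (subst geometric_sum) (auto simp: field_simps)
    then show ?thesis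
      unfolding sum_distrib_left[symmetric] lessThan_Suc_atMost[symmetric] using m0 by (intro mult_left_mono) auto
  qed
  finally have 1: "2 * (\<Sum>i\<le>m. \<Prod>j\<le>i. ?k i j) \<le> 4 * (m0 * exp (- A * \<theta>))" by simp
  have "(\<Sum>i\<le>2 * m. \<Prod>j\<le>i. (g m)\<^sup>2) \<le> (\<Sum>i\<le>2 * m. ((g m)\<^sup>2) ^ Suc (2 * m))"
  proof (intro sum_mono)
    fix i assume "i \<in> {..2 * m}"
    have "1 \<le> (g m)\<^sup>2" using g(2)[of m] by simp
    then have "((g m)\<^sup>2) ^ Suc i \<le> ((g m)\<^sup>2) ^ Suc (2 * m)"
      using \<open>i \<in> {..2 * m}\<close> by (intro power_increasing) auto
    then show "(\<Prod>j\<le>i. (g m)\<^sup>2) \<le> ((g m)\<^sup>2) ^ Suc (2 * m)" by simp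
  qed
  also have "\<dots> = (2 * real m + 1) * exp (2 * (2 * real m + 1) * A * B ^ m)"
  proof -
    have "((g m)\<^sup>2) ^ Suc (2 * m) = exp (real (2 * Suc (2 * m)) * (A * B ^ m))"
      unfolding g_def exp_of_nat_mult power_mult ..
    then show ?thesis by (simp add: algebra_simps)
  qed
  finally have 2: "(\<Sum>i\<le>2 * m. \<Prod>j\<le>i. (g m)\<^sup>2) / n \<le> (2 * real m + 1) * exp (2 * (2 * real m + 1) * A * B ^ m) / n"
    using n by (intro divide_right_mono) auto
  show ?thesis
    using prob_short_path[OF n set_pmf_D s(1) s2 m0(2) _ g] m0(1) 1 2 by linarith
qed

lemma no_short_path:
  assumes l: "0 < l" "l < 2 / \<bar>ln (\<tau> - 2)\<bar>"
  shows "(\<lambda>n. measure_pmf.prob (sample_pmf D n)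
    {(M, u, v). \<exists>p. pre_digraph.apath (pairing_graph n M) u p v \<and> length p \<le> l * ln (ln n)}) \<longlonglongrightarrow> 0"
proof -
  have t2: "0 < \<tau> - 2" "\<tau> - 2 < 1" using \<tau> by auto
  define lk where "lk = \<bar>ln (\<tau> - 2)\<bar>"
  have lk: "lk = - ln (\<tau> - 2)" "0 < lk" using t2 by (auto simp: lk_def ln_less_zero_iff)
  \<comment> \<open>The logarithm of \<open>B\<close>, strictly between its two constraints: above
    \<open>lk\<close>, so that \<open>B > 1 / (\<tau> - 2)\<close>, and below \<open>2 / l\<close>,
    so that \<open>B ^ m\<close> with \<open>m\<close> about \<open>l / 2 * ln (ln n)\<close> is of
    order \<open>ln n powr \<eta>\<close> with \<open>\<eta> < 1\<close>.\<close>
  define lB where "lB = (lk + 2 / l) / 2"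
  have "lk < 2 / l" using l lk by (simp add: lk_def[symmetric] field_simps)
  then have lB: "lk < lB" "lB < 2 / l" by (auto simp: lB_def)
  define B where "B = exp lB"
  \<comment> \<open>\<open>s - 1\<close> is the midpoint of \<open>exp (- lB)\<close> and
    \<open>\<tau> - 2\<close>: the moment of order \<open>s\<close> is finite and
    \<open>1 / (s - 1) < B\<close>.\<close>
  define s where "s = 1 + (exp (- lB) + (\<tau> - 2)) / 2"
  have "exp (- lB) < exp (- lk)" using lB by simp
  also have "exp (- lk) = \<tau> - 2" using lk t2 by simp
  finally have eB: "exp (- lB) < \<tau> - 2" .
  have "0 < exp (- lB)" by simp
  then have s: "1 < s" "s < \<tau> - 1" "exp (- lB) < s - 1"
    using eB t2 unfolding s_def by (simp_all only: field_simps)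
  have B: "1 / (s - 1) < B"
    unfolding B_def using s by (simp add: exp_minus field_simps)
  have B1: "1 < B" unfolding B_def using lB lk by simp
  define \<theta> where "\<theta> = (s - 1) - (2 - s) / (B - 1)"
  have "1 < B * (s - 1)" using B s by (simp add: field_simps)
  then have "(2 - s) / (B - 1) < s - 1" using B1 by (simp add: field_simps)
  then have \<theta>0: "0 < \<theta>" by (simp add: \<theta>_def)
  obtain m0 where m0: "1 \<le> m0" "(\<integral>\<^sup>+t. ennreal ((real t + 1) powr s) \<partial>D) \<le> ennreal m0"
    using finite_moment[OF s(1,2)] .
  define \<eta> where "\<eta> = l / 2 * lB"
  have \<eta>: "0 < \<eta>" "\<eta> < 1" using lB lk l by (auto simp: \<eta>_def field_simps)
  show ?thesis
  proof (rule LIMSEQ_I)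
    fix r :: real assume r: "0 < r"
    have lim0: "((\<lambda>A. 4 * (m0 * exp (- A * \<theta>))) \<longlongrightarrow> 0) at_top" "((\<lambda>A. m0 * exp (- A * \<theta> * (B - 1))) \<longlongrightarrow> 0) at_top"
      using \<theta>0 B1 by real_asymp+
    have "\<forall>\<^sub>F A in at_top. 4 * (m0 * exp (- A * \<theta>)) < r / 2 \<and> m0 * exp (- A * \<theta> * (B - 1)) < 1 / 2 \<and> 0 \<le> A"
      using order_tendstoD(2)[OF lim0(1), of "r / 2"] order_tendstoD(2)[OF lim0(2), of "1 / 2"] r
      by (intro eventually_conj) (auto simp: eventually_ge_at_top)
    \<comment> \<open>\<open>A\<close> depends on the tolerance only and is fixed before
      \<open>n\<close>: it makes the escapes rare, while the term \<open>f n\<close> of the paths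
      with bounded degrees vanishes for any such \<open>A\<close>.\<close>
    then obtain A where A: "4 * (m0 * exp (- A * \<theta>)) < r / 2" "m0 * exp (- A * \<theta> * (B - 1)) < 1 / 2" "0 \<le> A"
      by (auto simp: eventually_at_top_linorder)
    define f where "f n = (l * ln (ln n) + 3) * exp (2 * (l * ln (ln n) + 3) * A * (B * (ln n) powr \<eta>)) / n" for n :: real
    have limf: "(\<lambda>n. f (real n)) \<longlonglongrightarrow> 0"
    proof (cases "A = 0")
      case True
      have "(\<lambda>n. (l * ln (ln (real n)) + 3) / real n) \<longlonglongrightarrow> 0" by real_asymp
      then show ?thesis using True by (simp add: f_def)
    next
      case False
      then have "0 < A" using A by simp
      have "(\<lambda>n. (l * ln (ln (real n)) + 3) * exp (2 * (l * ln (ln (real n)) + 3) * A * (B * (ln (real n)) powr \<eta>)) / real n) \<longlonglongrightarrow> 0"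
        using \<open>0 < A\<close> B1 l \<eta> by real_asymp
      then show ?thesis unfolding f_def .
    qed
    have ev1: "\<forall>\<^sub>F n in sequentially. f (real n) < r / 2"
      using order_tendstoD(2)[OF limf, of "r / 2"] r by simp
    have ev2: "\<forall>\<^sub>F n in sequentially. 2 * (l * ln (ln (real n)) + 3) \<le> real n" using l by real_asymp
    have ev3: "\<forall>\<^sub>F n in sequentially. 1 \<le> ln (ln (real n))" by real_asymp
    have "\<forall>\<^sub>F n in sequentially. norm (measure_pmf.prob (sample_pmf D n)
      {(M, u, v). \<exists>p. pre_digraph.apath (pairing_graph n M) u p v \<and> length p \<le> l * ln (ln n)} - 0) < r"
      using ev1 ev2 ev3 eventually_ge_at_top[of 2]
    proof eventually_elim
      case (elim n)
      define m where "m = nat \<lceil>l / 2 * ln (ln n)\<rceil>"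
      have m: "l / 2 * ln (ln n) \<le> m" "m \<le> l / 2 * ln (ln n) + 1"
        using l elim(3) unfolding m_def by (auto simp: mult_nonneg_nonneg less_imp_le)
      have lnn: "0 < ln (real n)"
        using elim(4) by simp
      have "real (2 * (2 * m + 1)) \<le> real n" using m elim(2) by simp
      then have n2: "2 * (2 * m + 1) \<le> n" by linarith
      have "B ^ m = exp (lB * m)" by (simp add: B_def exp_of_nat2_mult)
      also have "\<dots> \<le> exp (lB * (l / 2 * ln (ln n) + 1))"
        using m lB lk by simp
      also have "\<dots> = B * ln n powr \<eta>"
        using lnn by (simp add: B_def \<eta>_def powr_def exp_add[symmetric] algebra_simps)
      finally have Bm: "B ^ m \<le> B * ln n powr \<eta>" .
      have "measure_pmf.prob (sample_pmf D n)
        {(M, u, v). \<exists>p. pre_digraph.apath (pairing_graph n M) u p v \<and> length p \<le> l * ln (ln n)}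
        \<le> measure_pmf.prob (sample_pmf D n)
        {(M, u, v). \<exists>p. pre_digraph.apath (pairing_graph n M) u p v \<and> length p \<le> 2 * m}"
      proof (rule measure_pmf.finite_measure_mono)
        have "k \<le> 2 * m" if "real k \<le> l * ln (ln n)" for k
        proof -
          have "real k \<le> real (2 * m)" using that m by simp
          then show ?thesis by linarith
        qed
        then show "{(M, u, v). \<exists>p. pre_digraph.apath (pairing_graph n M) u p v \<and> length p \<le> l * ln (ln n)}
          \<subseteq> {(M, u, v). \<exists>p. pre_digraph.apath (pairing_graph n M) u p v \<and> length p \<le> 2 * m}" by blast
      qed simp
      also have "\<dots> \<le> 4 * (m0 * exp (- A * \<theta>)) + (2 * real m + 1) * exp (2 * (2 * real m + 1) * A * B ^ m) / n"
        using A elim(4) by (intro prob_short_path_le[OF s(1,2) B A(3) m0 \<theta>_def _ _ n2]) auto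
      also have "(2 * real m + 1) * exp (2 * (2 * real m + 1) * A * B ^ m) / n \<le> f n"
        unfolding f_def
      proof (intro divide_right_mono mult_mono)
        show "2 * real m + 1 \<le> l * ln (ln n) + 3" using m by simp
        have "2 * (2 * real m + 1) * A * B ^ m \<le> 2 * (l * ln (ln n) + 3) * A * (B * ln n powr \<eta>)"
          using Bm A(3) B1 m by (intro mult_mono) auto
        then show "exp (2 * (2 * real m + 1) * A * B ^ m) \<le> exp (2 * (l * ln (ln n) + 3) * A * (B * ln n powr \<eta>))"
          by simp
        show "0 \<le> l * ln (ln n) + 3" using l elim(3) by simp
      qed auto
      finally show ?case using A(1) elim(1) by simp
    qed
    then show "\<exists>N. \<forall>n\<ge>N. norm (measure_pmf.prob (sample_pmf D n)
      {(M, u, v). \<exists>p. pre_digraph.apath (pairing_graph n M) u p v \<and> length p \<le> l * ln (ln n)} - 0) < r"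
      by (simp add: eventually_sequentially)
  qed
qed

end

section \<open>Upper bound on the passage time\<close>

text \<open>Vertex \<open>n\<close> is left out, so that the parity correction changes no degree in
  a window.\<close>

definition window :: "nat \<Rightarrow> (nat \<Rightarrow> nat) \<Rightarrow> real \<Rightarrow> real \<Rightarrow> nat set" where
  "window n d Q z = {x \<in> {1..<n}. z < real (d x) \<and> real (d x) \<le> Q * z}"

lemma finite_window: "finite (window n d Q z)"
  by (simp add: window_def)

lemma card_window_targets:
  assumes "finite V" "0 \<le> z"
  shows "(real (card (window n d Q z)) - card V) * z \<le> card {b \<in> half_edges n d. fst b \<in> window n d Q z - V}"
proof -
  let ?W = "window n d Q z - V"
  have fin: "finite ?W" by (simp add: finite_window)
  have eq: "{b \<in> half_edges n d. fst b \<in> ?W} = (SIGMA x:?W. {..<d x})"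
    by (auto simp: half_edges_eq window_def corrected_degree_eq)
  have "real (card (window n d Q z)) - card V \<le> card ?W"
    using diff_card_le_card_Diff[OF assms(1), of "window n d Q z"] by linarith
  then have "(real (card (window n d Q z)) - card V) * z \<le> card ?W * z"
    using assms(2) by (rule mult_right_mono)
  also have "\<dots> = (\<Sum>x\<in>?W. z)" by simp
  also have "\<dots> \<le> (\<Sum>x\<in>?W. real (d x))"
    by (intro sum_mono) (auto simp: window_def)
  also have "\<dots> = card {b \<in> half_edges n d. fst b \<in> ?W}"
    unfolding eq using fin by simp
  finally show ?thesis .
qed

text \<open>Comparison with a supersolution \<open>U\<close> of the recursion; it is applied with
  \<open>U i = z i powr (- s)\<close>.\<close>

lemma climb_bound_le:
  assumes "\<And>i. i < l \<Longrightarrow> \<phi> i + hi i * U (Suc i) \<le> U i" "\<And>i. 0 \<le> hi i" "\<And>i. 0 \<le> U i" "i + j \<le> l"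
  shows "climb_bound \<phi> hi j i \<le> U i"
  using assms(4)
proof (induction j arbitrary: i)
  case 0
  then show ?case using assms(3) by simp
next
  case (Suc j)
  have "climb_bound \<phi> hi (Suc j) i \<le> \<phi> i + hi i * U (Suc i)"
    using Suc assms(2) by (simp add: mult_left_mono)
  also have "\<dots> \<le> U i" using Suc.prems by (intro assms(1)) simp
  finally show ?case .
qed

context weights
begin

text \<open>A window with of order \<open>n * z i powr (- (\<tau> - 1))\<close> vertices has of
  order \<open>n * z i powr (- (\<tau> - 2))\<close> half-edges. This turns the bound
  \<open>\<phi> i\<close> into an exponential of \<open>z i powr (1 - B * (\<tau> - 2))\<close>, and
  \<open>big\<close> asks that it be small enough for the union bounds over all later
  stages.\<close>

lemma avg_bad_windows:
  fixes d :: "nat \<Rightarrow> nat" and z :: "nat \<Rightarrow> real" and \<tau> B Q a c s \<Delta> q t t' :: real and n k r R u v :: nat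
  defines "p \<equiv> prob {..t}"
  assumes n: "1 \<le> n" "2 * r + 1 \<le> n" and d2: "\<And>i. i \<in> {1..n} \<Longrightarrow> 2 \<le> d i"
    and sumd: "(\<Sum>i\<in>{1..n}. real (d i)) + 1 \<le> a * n" and maxd: "\<And>i. i \<in> {1..n} \<Longrightarrow> real (d i) + 1 \<le> \<Delta>"
    and z: "\<And>i. z (Suc i) = z i powr B" "2 \<le> z 0" "2 * Q \<le> z 0" "5 \<le> z k"
    and B: "1 < B" and Q: "1 \<le> Q" and \<tau>: "2 < \<tau>" and c: "0 < c" and s: "2 \<le> s * (B - 1)"
    and win: "\<And>i. i \<le> k \<Longrightarrow> c * n * z i powr (- (\<tau> - 1)) \<le> card (window n d Q (z i))"
    and R: "1 + r + k \<le> R" "R \<le> c / 2 * n * z k powr (- (\<tau> - 1))"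
    and Qk: "Q * z k \<le> c / 4 * n * z k powr (- (\<tau> - 2))"
    and t: "0 \<le> t" "0 \<le> t'"
    and big: "\<And>i. i \<le> k \<Longrightarrow> exp (- (p * c / (16 * a)) * z i powr (1 - B * (\<tau> - 2))) \<le> z i powr (- s) / 2"
    and q: "0 \<le> q" "q \<le> 1" "q \<le> c / (2 * a) * z 0 powr (- (\<tau> - 2))"
    and uv: "u \<in> {1..n}" "v \<in> {1..n}"
  obtains E where "\<And>M. E M \<in> sets PY"
    and "\<And>M Y. M \<in> pairings (half_edges n d) \<Longrightarrow> Y \<notin> E M \<Longrightarrow> conn M Y (2 * (r * t' + k * t) + t) u v"
    and "avg (half_edges n d) (\<lambda>M. PYp.prob (E M)) \<le>
      2 * ((1 - q) ^ r + r * (prob {t'<..} + R * \<Delta> / n + z 0 powr (- s))) +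
      (real n)\<^sup>2 * exp (- (p * (z k - 1)\<^sup>2 / (16 * (a * n))))"
proof -
  define W where "W i = window n d Q (z i)" for i
  define H where "H = half_edges n d"
  define lo where "lo i = z i - 1" for i
  define hi where "hi i = Q * z i" for i
  define m where "m i = c / 4 * n * z (Suc i) powr (- (\<tau> - 2))" for i
  have n0: "0 < real n" using n by simp
  have z_step: "z i \<le> z (Suc i)" if "1 \<le> z i" for i
    using that B powr_mono[of 1 B "z i"] unfolding z(1) by simp
  have z0: "z 0 \<le> z i" for i
  proof (induction i)
    case (Suc i)
    then show ?case using z_step[of i] z(2) by linarith
  qed simp
  have z_mono: "z i \<le> z j" if "i \<le> j" for i j
    using that
  proof (induction rule: dec_induct)
    case (step l)
    then show ?case using z_step[of l] z0[of l] z(2) by linarith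
  qed simp
  have z2: "2 \<le> z i" for i using z0[of i] z(2) by linarith
  have a0: "0 < a"
  proof -
    have "0 < a * n" using sumd sum_nonneg[of "{1..n}" "\<lambda>i. real (d i)"] by linarith
    then show ?thesis using n0 by (simp add: zero_less_mult_iff)
  qed
  have p01: "0 \<le> p" "p \<le> 1" unfolding p_def by auto
  have cardH: "real (card H) \<le> a * n" unfolding H_def using card_half_edges_le[of n d] sumd by linarith
  have cardH2: "2 * n \<le> card H" unfolding H_def using d2 by (rule card_half_edges_ge)
  \<comment> \<open>Discarding at most \<open>R\<close> visited vertices costs at most half of the
    window, whence \<open>c / 2\<close>. Half of what is left becomes \<open>m i\<close> below, and
    by \<open>Qk\<close> the other half covers \<open>hi i\<close>.\<close>
  have targets: "c / 2 * n * z i powr (- (\<tau> - 2)) \<le> card {b \<in> H. fst b \<in> W i - V}"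
    if "i \<le> k" "finite V" "card V \<le> R" for i V
  proof -
    have "z k powr (- (\<tau> - 1)) \<le> z i powr (- (\<tau> - 1))"
      using z_mono[OF that(1)] z2[of i] \<tau> by (intro powr_mono2') auto
    then have "c / 2 * n * z k powr (- (\<tau> - 1)) \<le> c / 2 * n * z i powr (- (\<tau> - 1))"
      using c by (intro mult_left_mono) auto
    then have "c / 2 * n * z i powr (- (\<tau> - 1)) \<le> real (card (W i)) - card V"
      using win[OF that(1)] R(2) that(3) unfolding W_def by simp
    then have "c / 2 * n * z i powr (- (\<tau> - 1)) * z i \<le> (real (card (W i)) - card V) * z i"
      using z2[of i] by (intro mult_right_mono) auto
    also have "\<dots> \<le> card {b \<in> H. fst b \<in> W i - V}"
      unfolding W_def H_def using that(2) z2[of i] by (intro card_window_targets) auto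
    also have "z i powr (- (\<tau> - 1)) * z i = z i powr (- (\<tau> - 2))"
      using z2[of i] powr_add[of "z i" "- (\<tau> - 1)" 1] by simp
    then have "c / 2 * n * z i powr (- (\<tau> - 1)) * z i = c / 2 * n * z i powr (- (\<tau> - 2))"
      by (simp only: mult.assoc)
    finally show ?thesis .
  qed
  interpret explore F W H t p "a * n" k R lo hi m q "prob {t'<..}" t' \<Delta> "real n"
  proof
    show "finite H" unfolding H_def by (rule finite_half_edges)
    show "p = prob {..t}" by (simp add: p_def)
    show "real (card H) \<le> a * n" by (rule cardH)
    show "0 \<le> m i" for i using c by (simp add: m_def)
    show "0 \<le> hi i" for i using Q z2[of i] by (simp add: hi_def)
    show "m i + hi i \<le> card {b \<in> H. fst b \<in> W (Suc i) - V}" if "i < k" "finite V" "card V \<le> R" for i V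
    proof -
      have "hi i \<le> Q * z k" unfolding hi_def using z_mono[of i k] that Q by simp
      also have "\<dots> \<le> c / 4 * n * z k powr (- (\<tau> - 2))" by (rule Qk)
      also have "\<dots> \<le> m i"
        unfolding m_def using z_mono[of "Suc i" k] z2[of "Suc i"] that c \<tau>
        by (intro mult_left_mono powr_mono2') auto
      finally have "m i + hi i \<le> c / 2 * n * z (Suc i) powr (- (\<tau> - 2))"
        by (simp add: m_def)
      then show ?thesis using targets[of "Suc i" V] that by linarith
    qed
    show "lo i + 1 \<le> card {b \<in> H. fst b = x} \<and> card {b \<in> H. fst b = x} \<le> hi i" if "i \<le> k" "x \<in> W i" for i x
      using that(2) unfolding W_def window_def H_def card_half_edges_at
      by (auto simp: corrected_degree_eq lo_def hi_def)
    show "(fst b, 0) \<in> H \<and> (fst b, 1) \<in> H" if "b \<in> H" for b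
    proof -
      have "fst b \<in> {1..n}" using that by (auto simp: H_def half_edges_eq)
      then have "fst b \<in> {1..n}" "2 \<le> corrected_degree n d (fst b)"
        using d2[of "fst b"] corrected_degree_bounds(1)[of d "fst b" n] by auto
      then show ?thesis by (auto simp: H_def half_edges_eq)
    qed
    show "0 \<le> q" "q \<le> 1" by fact+
    show "q * (a * n) \<le> card {b \<in> H. fst b \<in> W 0 - V}" if "finite V" "card V \<le> R" for V
    proof -
      have "q * (a * n) \<le> c / (2 * a) * z 0 powr (- (\<tau> - 2)) * (a * n)"
        using q(3) a0 by (intro mult_right_mono) auto
      also have "\<dots> = c / 2 * n * z 0 powr (- (\<tau> - 2))" using a0 by simp
      also have "\<dots> \<le> card {b \<in> H. fst b \<in> W 0 - V}" using that by (intro targets) auto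
      finally show ?thesis .
    qed
    show "card {h \<in> H. fst h = x} \<le> \<Delta>" for x
      using maxd[of x] maxd[of n] n corrected_degree_bounds(2)[of n d x] unfolding H_def card_half_edges_at
      by (auto split: if_splits)
    show "0 < real n" by (rule n0)
  qed auto
  have phi: "\<phi> i \<le> z i powr (- s) / 2" if "i \<le> k" for i
  proof -
    have "p * c / (16 * a) * z i powr (1 - B * (\<tau> - 2)) =
        (p * m i / (2 * (a * n))) * (z i / 2)"
    proof -
      have "z i powr (1 - B * (\<tau> - 2)) = z i powr (- (B * (\<tau> - 2))) * z i"
        using z2[of i] powr_add[of "z i" "- (B * (\<tau> - 2))" 1] by (simp add: add.commute)
      also have "z i powr (- (B * (\<tau> - 2))) = z (Suc i) powr (- (\<tau> - 2))"
        unfolding z(1) powr_powr by (simp add: algebra_simps)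
      finally have e: "z i powr (1 - B * (\<tau> - 2)) = z (Suc i) powr (- (\<tau> - 2)) * z i" .
      show ?thesis unfolding e m_def using n0 a0 by (simp add: field_simps)
    qed
    also have "\<dots> \<le> (p * m i / (2 * (a * n))) * lo i"
      using z2[of i] p01 m_nonneg[of i] a0 n0 by (intro mult_left_mono) (auto simp: lo_def)
    finally have "\<phi> i \<le> exp (- (p * c / (16 * a)) * z i powr (1 - B * (\<tau> - 2)))"
      unfolding \<phi>_def by simp
    also have "\<dots> \<le> z i powr (- s) / 2" by (rule big[OF that])
    finally show ?thesis .
  qed
  \<comment> \<open>\<open>z i powr (- s)\<close> is a supersolution:
    \<open>s * (B - 1) \<ge> 2\<close> makes the next value smaller by a factor
    \<open>z i powr (-2)\<close>, which beats \<open>hi i = Q * z i\<close> and leaves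
    \<open>Q / z i \<le> 1 / 2\<close>. The other half is taken by \<open>\<phi> i\<close>.\<close>
  have climb: "climb_bound \<phi> hi k 0 \<le> z 0 powr (- s)"
  proof (rule climb_bound_le[where l = k and U = "\<lambda>i. z i powr (- s)"])
    show "\<phi> i + hi i * z (Suc i) powr (- s) \<le> z i powr (- s)" if "i < k" for i
    proof -
      have "z (Suc i) powr (- s) = z i powr (- s) * z i powr (- (s * (B - 1)))"
        unfolding z(1) powr_powr powr_add[symmetric] by (simp add: algebra_simps)
      also have "\<dots> \<le> z i powr (- s) * z i powr (-2)"
        using s z2[of i] by (intro mult_left_mono powr_mono) auto
      finally have "hi i * z (Suc i) powr (- s) \<le> hi i * (z i powr (- s) * z i powr (-2))"
        using hi_nonneg[of i] by (rule mult_left_mono)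
      also have "\<dots> = z i powr (- s) * (Q / z i)"
        using z2[of i] by (simp add: hi_def powr_minus_divide power2_eq_square field_simps)
      also have "\<dots> \<le> z i powr (- s) * (1 / 2)"
        using z0[of i] z(3) z2[of i] Q by (intro mult_left_mono) (auto simp: field_simps)
      finally show ?thesis using phi[of i] that by simp
    qed
  qed (auto simp: hi_nonneg)
  have cardW: "card (W k) \<le> n"
  proof -
    have "card (W k) \<le> card {1..<n}" unfolding W_def window_def by (intro card_mono) auto
    then show ?thesis by simp
  qed
  have in_H: "(x, 0) \<in> H" if "x \<in> {1..n}" for x
    using d2[OF that] corrected_degree_bounds(1)[of d x n] that by (auto simp: H_def half_edges_eq)
  have ev: "even (card H)" unfolding H_def by (rule even_card_half_edges[OF n(1)])
  have finW: "finite (W k)" by (simp add: W_def finite_window)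
  show thesis
  proof (rule that[of "bad_weights r u v"])
    show "bad_weights r u v M \<in> sets PY" for M by (rule sets_bad_weights[OF finW])
    show "conn M Y (2 * (r * t' + k * t) + t) u v" if "M \<in> pairings (half_edges n d)" "Y \<notin> bad_weights r u v M" for M Y
      using that in_H uv t unfolding H_def[symmetric] by (intro conn_if_not_bad)
    have "avg H (\<lambda>M. PYp.prob (bad_weights r u v M)) \<le>
        2 * ((1 - q) ^ r + r * (prob {t'<..} + R * \<Delta> / n + climb_bound \<phi> hi k 0)) +
        (real n)\<^sup>2 * exp (- (p * (lo k)\<^sup>2 / (16 * (a * n))))"
    proof (rule avg_bad_weights[OF ev in_H[OF uv(1)] in_H[OF uv(2)] _ R(1) finW cardW])
      show "real n + 2 * real r + 1 \<le> real (card H)" using cardH2 n(2) by linarith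
      show "4 \<le> lo k" using z(4) by (simp add: lo_def)
    qed
    also have "\<dots> \<le> 2 * ((1 - q) ^ r + r * (prob {t'<..} + R * \<Delta> / n + z 0 powr (- s))) +
        (real n)\<^sup>2 * exp (- (p * (z k - 1)\<^sup>2 / (16 * (a * n))))"
    proof -
      have lok: "lo k = z k - 1" by (simp add: lo_def)
      show ?thesis
        unfolding lok using climb by (intro add_mono mult_left_mono order.refl) auto
    qed
    finally show "avg (half_edges n d) (\<lambda>M. PYp.prob (bad_weights r u v M)) \<le>
        2 * ((1 - q) ^ r + r * (prob {t'<..} + R * \<Delta> / n + z 0 powr (- s))) +
        (real n)\<^sup>2 * exp (- (p * (z k - 1)\<^sup>2 / (16 * (a * n))))"
      unfolding H_def .
  qed
qed

end

section \<open>Typical degree sequences\<close>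

lemma prob_Pi_pmf_component:
  assumes "finite A" "x \<in> A"
  shows "measure_pmf.prob (Pi_pmf A dflt (\<lambda>_. D)) {d. d x \<in> S} = measure_pmf.prob D S"
proof -
  have "measure_pmf.prob D S = measure_pmf.prob (map_pmf (\<lambda>d. d x) (Pi_pmf A dflt (\<lambda>_. D))) S"
    using assms by (simp add: Pi_pmf_component)
  also have "\<dots> = measure_pmf.prob (Pi_pmf A dflt (\<lambda>_. D)) {d. d x \<in> S}"
    by (simp add: vimage_def)
  finally show ?thesis ..
qed

lemma nn_integral_Pi_pmf_component:
  assumes "finite A" "x \<in> A"
  shows "(\<integral>\<^sup>+d. f (d x) \<partial>Pi_pmf A dflt (\<lambda>_. D)) = (\<integral>\<^sup>+t. f t \<partial>D)"
proof -
  have "(\<integral>\<^sup>+t. f t \<partial>D) = (\<integral>\<^sup>+t. f t \<partial>map_pmf (\<lambda>d. d x) (Pi_pmf A dflt (\<lambda>_. D)))"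
    using assms by (simp add: Pi_pmf_component)
  then show ?thesis by simp
qed

context power_law
begin

text \<open>Markov's inequality; the \<open>+ 1\<close> inside the event allows for the parity
  correction.\<close>

lemma prob_degree_sum:
  fixes a \<mu> :: real and n :: nat
  assumes \<mu>: "(\<integral>\<^sup>+t. ennreal (real t) \<partial>D) \<le> ennreal \<mu>" "0 \<le> \<mu>" and a: "0 < a" and n: "1 \<le> n"
  shows "measure_pmf.prob (Pi_pmf {1..n} 0 (\<lambda>_. D)) {d. a * n < (\<Sum>i\<in>{1..n}. real (d i)) + 1} \<le> (\<mu> + 1) / a"
proof -
  let ?P = "Pi_pmf {1..n} 0 (\<lambda>_. D)" and ?A = "{d. a * n < (\<Sum>i\<in>{1..n}. real (d i)) + 1}"
  have an: "0 < a * real n" using a n by simp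
  have "ennreal (a * n) * emeasure ?P ?A = (\<integral>\<^sup>+d. ennreal (a * n) * indicator ?A d \<partial>?P)"
    by (subst nn_integral_cmult_indicator) simp_all
  also have "\<dots> \<le> (\<integral>\<^sup>+d. (\<Sum>i\<in>{1..n}. ennreal (real (d i))) + 1 \<partial>?P)"
  proof (intro nn_integral_mono)
    fix d
    have "(\<Sum>i\<in>{1..n}. ennreal (real (d i))) + 1 = ennreal ((\<Sum>i\<in>{1..n}. real (d i)) + 1)"
      by (subst sum_ennreal) (auto simp: sum_nonneg)
    then show "ennreal (a * n) * indicator ?A d \<le> (\<Sum>i\<in>{1..n}. ennreal (real (d i))) + 1"
      by (auto simp: indicator_def intro!: ennreal_leI)
  qed
  also have "\<dots> = (\<Sum>i\<in>{1..n}. \<integral>\<^sup>+d. ennreal (real (d i)) \<partial>?P) + 1"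
    by (subst nn_integral_add) (simp_all add: nn_integral_sum del: sum_ennreal)
  also have "\<dots> = (\<Sum>i\<in>{1..n}. \<integral>\<^sup>+t. ennreal (real t) \<partial>D) + 1"
    by (intro arg_cong2[where f = "(+)"] sum.cong refl
        nn_integral_Pi_pmf_component[where f = "\<lambda>t. ennreal (real t)"]) auto
  also have "\<dots> \<le> (\<Sum>i\<in>{1..n}. ennreal \<mu>) + 1"
    by (intro add_mono sum_mono \<mu> order.refl)
  also have "\<dots> = ennreal (n * \<mu> + 1)"
    using \<mu>(2) by (simp add: ennreal_of_nat_eq_real_of_nat ennreal_mult)
  also have "\<dots> \<le> ennreal (n * (\<mu> + 1))"
    using n by (intro ennreal_leI) (simp add: distrib_left)
  finally have "ennreal (a * n * measure_pmf.prob ?P ?A) \<le> ennreal (n * (\<mu> + 1))"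
    using an by (simp add: measure_pmf.emeasure_eq_measure ennreal_mult)
  then have "a * n * measure_pmf.prob ?P ?A \<le> n * (\<mu> + 1)"
    using \<mu>(2) by (subst (asm) ennreal_le_iff) auto
  then have "real n * (a * measure_pmf.prob ?P ?A) \<le> real n * (\<mu> + 1)"
    by (simp only: mult_ac)
  then have "a * measure_pmf.prob ?P ?A \<le> \<mu> + 1"
    using n by (subst (asm) mult_le_cancel_left_pos) auto
  then show ?thesis using a by (simp add: pos_le_divide_eq mult.commute)
qed

lemma prob_max_degree:
  fixes \<Delta> :: real and n :: nat
  assumes "2 \<le> \<Delta>"
  shows "measure_pmf.prob (Pi_pmf {1..n} 0 (\<lambda>_. D)) {d. \<exists>i\<in>{1..n}. \<Delta> < real (d i) + 1}
    \<le> n * (C\<^sub>1 * (\<Delta> - 1) powr (- (\<tau> - 1)))"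
proof -
  let ?P = "Pi_pmf {1..n} 0 (\<lambda>_. D)"
  have "measure_pmf.prob ?P {d. \<exists>i\<in>{1..n}. \<Delta> < real (d i) + 1} \<le>
      measure_pmf.prob ?P (\<Union>i\<in>{1..n}. {d. d i \<in> {t. real t > \<Delta> - 1}})"
    by (intro measure_pmf.finite_measure_mono) (auto simp: algebra_simps)
  also have "\<dots> \<le> (\<Sum>i\<in>{1..n}. measure_pmf.prob ?P {d. d i \<in> {t. real t > \<Delta> - 1}})"
    by (intro measure_pmf.finite_measure_subadditive_finite) auto
  also have "\<dots> = (\<Sum>i\<in>{1..n}. measure_pmf.prob D {t. real t > \<Delta> - 1})"
    by (intro sum.cong refl prob_Pi_pmf_component) auto
  also have "\<dots> \<le> (\<Sum>i\<in>{1..n}. C\<^sub>1 * (\<Delta> - 1) powr (- (\<tau> - 1)))"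
    using tail[of "\<Delta> - 1"] assms by (intro sum_mono) auto
  finally show ?thesis by simp
qed

text \<open>As \<open>c\<^sub>1\<close> and \<open>C\<^sub>1\<close> may differ, a window of fixed
  ratio such as 2 may carry no mass. \<open>Q\<close> is so large that the upper tail bound at
  \<open>Q * z\<close> is at most half of the lower tail bound at \<open>z\<close>.\<close>

lemma prob_window:
  assumes Q: "1 \<le> Q" "C\<^sub>1 * Q powr (- (\<tau> - 1)) \<le> c\<^sub>1 / 2" and z: "1 \<le> z"
  shows "c\<^sub>1 / 2 * z powr (- (\<tau> - 1)) \<le> measure_pmf.prob D {t. z < real t \<and> real t \<le> Q * z}"
proof -
  have Qz: "1 \<le> Q * z" using Q z mult_mono[of 1 Q 1 z] by simp
  have sub: "{t. real t > Q * z} \<subseteq> {t. real t > z}"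
    using Q z by (auto intro: order.strict_trans1[of z "Q * z"])
  have "{t. z < real t \<and> real t \<le> Q * z} = {t. real t > z} - {t. real t > Q * z}" by auto
  also have "measure_pmf.prob D \<dots> = measure_pmf.prob D {t. real t > z} - measure_pmf.prob D {t. real t > Q * z}"
    using sub by (intro measure_pmf.finite_measure_Diff) auto
  also have "\<dots> \<ge> c\<^sub>1 * z powr (- (\<tau> - 1)) - C\<^sub>1 * (Q * z) powr (- (\<tau> - 1))"
    using tail[OF z] tail[OF Qz] by simp
  finally have "c\<^sub>1 * z powr (- (\<tau> - 1)) - C\<^sub>1 * (Q * z) powr (- (\<tau> - 1)) \<le>
      measure_pmf.prob D {t. z < real t \<and> real t \<le> Q * z}" .
  moreover have "C\<^sub>1 * (Q * z) powr (- (\<tau> - 1)) \<le> c\<^sub>1 / 2 * z powr (- (\<tau> - 1))"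
  proof -
    have "C\<^sub>1 * (Q * z) powr (- (\<tau> - 1)) = (C\<^sub>1 * Q powr (- (\<tau> - 1))) * z powr (- (\<tau> - 1))"
      using Q z by (simp add: powr_mult)
    also have "\<dots> \<le> c\<^sub>1 / 2 * z powr (- (\<tau> - 1))"
      using Q(2) by (intro mult_right_mono) auto
    finally show ?thesis .
  qed
  ultimately show ?thesis by simp
qed

text \<open>Chernoff's method with the generating function of the window size \<open>N\<close> at
  1/2: for the threshold \<open>\<theta>\<close> the event has indicator at most
  \<open>exp \<theta> * (1 / 2) ^ N\<close>, because \<open>2 \<le> exp 1\<close>.\<close>

lemma prob_few_in_window:
  assumes Q: "1 \<le> Q" "C\<^sub>1 * Q powr (- (\<tau> - 1)) \<le> c\<^sub>1 / 2" and z: "1 \<le> z" and n: "2 \<le> n"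
  shows "measure_pmf.prob (Pi_pmf {1..n} 0 (\<lambda>_. D))
      {d. card (window n d Q z) < c\<^sub>1 / 32 * n * z powr (- (\<tau> - 1))}
    \<le> exp (- (c\<^sub>1 / 16 * n * z powr (- (\<tau> - 1))))"
proof -
  let ?P = "Pi_pmf {1..n} 0 (\<lambda>_. D)" and ?\<theta> = "c\<^sub>1 / 32 * n * z powr (- (\<tau> - 1))"
  let ?A = "{d. card (window n d Q z) < ?\<theta>}"
  define S where "S = {t. z < real t \<and> real t \<le> Q * z}"
  define ps where "ps = measure_pmf.prob D S"
  define f where "f x t = (if x < n \<and> t \<in> S then 1 / 2 else 1 :: real)" for x t :: nat
  have f0: "0 \<le> f x t" for x t by (simp add: f_def)
  have prod: "(\<Prod>x\<in>{1..n}. f x (d x)) = (1 / 2) ^ card (window n d Q z)" for d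
  proof -
    have "(\<Prod>x\<in>{1..n}. f x (d x)) = (\<Prod>x\<in>window n d Q z. 1 / 2)"
      by (intro prod.mono_neutral_cong_right) (auto simp: f_def window_def S_def)
    then show ?thesis by simp
  qed
  have each: "(\<integral>\<^sup>+t. ennreal (f x t) \<partial>D) \<le> ennreal (if x < n then exp (- (ps / 2)) else 1)" for x
  proof (cases "x < n")
    case True
    have "(\<integral>\<^sup>+t. ennreal (f x t) \<partial>D) = ennreal (measure_pmf.expectation D (f x))"
      using f0 by (intro nn_integral_eq_integral measure_pmf.integrable_const_bound[where B = 1]) (auto simp: f_def)
    also have "measure_pmf.expectation D (f x) = measure_pmf.expectation D (\<lambda>t. 1 - indicator S t / 2)"
      using True by (intro Bochner_Integration.integral_cong) (auto simp: f_def)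
    also have "\<dots> = 1 - ps / 2"
      by (subst Bochner_Integration.integral_diff) (simp_all add: ps_def measure_pmf.integrable_const_bound[where B = 1] measure_pmf.prob_space)
    also have "1 - ps / 2 \<le> exp (- (ps / 2))" using exp_ge_add_one_self[of "- (ps / 2)"] by simp
    finally show ?thesis using True by (simp add: ennreal_leI)
  qed (simp add: f_def)
  have "(\<integral>\<^sup>+d. ennreal ((1 / 2) ^ card (window n d Q z)) \<partial>?P) = (\<Prod>x\<in>{1..n}. \<integral>\<^sup>+t. ennreal (f x t) \<partial>D)"
    unfolding prod[symmetric] prod_ennreal[OF f0, symmetric] by (rule nn_integral_prod_Pi_pmf) simp
  also have "\<dots> \<le> (\<Prod>x\<in>{1..n}. ennreal (if x < n then exp (- (ps / 2)) else 1))"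
    by (intro prod_mono_ennreal each)
  also have "\<dots> = ennreal (\<Prod>x\<in>{1..n}. if x < n then exp (- (ps / 2)) else 1)"
    by (intro prod_ennreal) simp
  also have "(\<Prod>x\<in>{1..n}. if x < n then exp (- (ps / 2)) else 1) = (\<Prod>x\<in>{1..<n}. exp (- (ps / 2)))"
    by (intro prod.mono_neutral_cong_right) auto
  also have "\<dots> = exp (- (real (n - 1) * ps / 2))"
    by (simp add: exp_of_nat_mult[symmetric])
  finally have E: "(\<integral>\<^sup>+d. ennreal ((1 / 2) ^ card (window n d Q z)) \<partial>?P) \<le> ennreal (exp (- (real (n - 1) * ps / 2)))" .
  have "emeasure ?P ?A = (\<integral>\<^sup>+d. indicator ?A d \<partial>?P)" by simp
  also have "\<dots> \<le> (\<integral>\<^sup>+d. ennreal (exp ?\<theta>) * ennreal ((1 / 2) ^ card (window n d Q z)) \<partial>?P)"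
  proof (intro nn_integral_mono)
    fix d
    show "indicator ?A d \<le> ennreal (exp ?\<theta>) * ennreal ((1 / 2) ^ card (window n d Q z))"
    proof (cases "d \<in> ?A")
      case True
      let ?N = "card (window n d Q z)"
      have "(2::real) ^ ?N \<le> exp 1 ^ ?N"
        using exp_ge_add_one_self[of 1] by (intro power_mono) auto
      also have "\<dots> = exp ?N" by (simp add: exp_of_nat_mult[symmetric])
      also have "\<dots> \<le> exp ?\<theta>" using True by simp
      finally have "1 \<le> exp ?\<theta> * (1 / 2) ^ ?N" by (simp add: power_divide field_simps)
      then have "ennreal 1 \<le> ennreal (exp ?\<theta> * (1 / 2) ^ ?N)" by (rule ennreal_leI)
      then show ?thesis using True by (simp add: ennreal_mult)
    qed simp
  qed
  also have "\<dots> = ennreal (exp ?\<theta>) * (\<integral>\<^sup>+d. ennreal ((1 / 2) ^ card (window n d Q z)) \<partial>?P)"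
    by (rule nn_integral_cmult) simp
  also have "\<dots> \<le> ennreal (exp ?\<theta>) * ennreal (exp (- (real (n - 1) * ps / 2)))"
    by (intro mult_left_mono E) simp
  also have "\<dots> = ennreal (exp (?\<theta> - real (n - 1) * ps / 2))"
    by (simp add: ennreal_mult[symmetric] exp_add[symmetric])
  finally have "measure_pmf.prob ?P ?A \<le> exp (?\<theta> - real (n - 1) * ps / 2)"
    by (simp add: measure_pmf.emeasure_eq_measure)
  also have "\<dots> \<le> exp (- (c\<^sub>1 / 16 * n * z powr (- (\<tau> - 1))))"
  proof -
    have ps: "c\<^sub>1 / 2 * z powr (- (\<tau> - 1)) \<le> ps"
      unfolding ps_def S_def using Q z by (rule prob_window)
    \<comment> \<open>Vertex \<open>n\<close> is not counted, and \<open>n - 1 \<ge> n / 2\<close>.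
      The exponent is thus at least \<open>1/8 - 1/32 \<ge> 1/16\<close> times
      \<open>c\<^sub>1 * n * z powr (- (\<tau> - 1))\<close>.\<close>
    have "n / 2 * (c\<^sub>1 / 2 * z powr (- (\<tau> - 1))) \<le> real (n - 1) * ps"
      using n ps c\<^sub>1 by (intro mult_mono) (auto simp: of_nat_diff)
    moreover have "0 \<le> c\<^sub>1 * n * z powr (- (\<tau> - 1))" using c\<^sub>1 by simp
    ultimately show ?thesis by (simp add: algebra_simps)
  qed
  finally show ?thesis .
qed

end

section \<open>Paths, passage time and hopcount for a fixed pairing\<close>

lemma pairing_graph_fin_digraph:
  assumes "M \<in> pairings (half_edges n d)"
  shows "fin_digraph (pairing_graph n M)"
proof
  have U: "\<Union>M = half_edges n d" using pairings_Union[OF assms] .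
  have in_H: "fst h \<in> half_edges n d \<and> snd h \<in> half_edges n d" if "h \<in> arcs (pairing_graph n M)" for h
  proof -
    have "{fst h, snd h} \<in> M" using that by (simp add: arcs_pairing_graph)
    then have "{fst h, snd h} \<subseteq> \<Union>M" by (rule Union_upper)
    then show ?thesis unfolding U by simp
  qed
  show "tail (pairing_graph n M) h \<in> verts (pairing_graph n M)"
    "head (pairing_graph n M) h \<in> verts (pairing_graph n M)" if "h \<in> arcs (pairing_graph n M)" for h
    using in_H[OF that] by (auto simp: half_edges_eq)
  show "finite (verts (pairing_graph n M))" by simp
  show "finite (arcs (pairing_graph n M))"
    by (rule finite_subset[of _ "half_edges n d \<times> half_edges n d"])
      (use in_H finite_half_edges in \<open>auto simp: mem_Times_iff\<close>)
qed

lemma path_weight_simps [simp]: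
  "path_weight Y [] = 0"
  "path_weight Y (h # p) = Y {fst h, snd h} + path_weight Y p"
  "path_weight Y (p @ q) = path_weight Y p + path_weight Y q"
  by (simp_all add: path_weight_def case_prod_unfold)

lemma path_weight_ge_length:
  assumes "\<And>h h'. 1 \<le> Y {h, h'}"
  shows "real (length p) \<le> path_weight Y p"
  by (induction p) (use assms in \<open>auto intro: add_mono\<close>)

text \<open>Weights are positive, so cutting cycles does not increase the weight: if the new vertex
  already lies on the path, only the part of the path that starts there is kept.\<close>

lemma apath_if_conn:
  assumes M: "M \<in> pairings (half_edges n d)" and Y: "\<And>h h'. 1 \<le> Y {h, h'}"
    and "conn M Y x u w" "u \<in> {1..n}"
  shows "\<exists>p. pre_digraph.apath (pairing_graph n M) u p w \<and> path_weight Y p \<le> x"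
proof -
  interpret fin_digraph "pairing_graph n M" by (rule pairing_graph_fin_digraph[OF M])
  show ?thesis
    using assms(3,4)
  proof (induction rule: conn.induct)
    case (conn_refl x u)
    then show ?case by (intro exI[of _ "[]"]) (simp add: apath_Nil_iff)
  next
    case (conn_step a b y x w)
    have arc: "(a, b) \<in> arcs (pairing_graph n M)" using conn_step(1) by (simp add: arcs_pairing_graph)
    then have b: "fst b \<in> {1..n}" using head_in_verts[OF arc] by simp
    obtain p where p: "apath (fst b) p w" "path_weight Y p \<le> x" using conn_step.IH[OF b] by blast
    have y: "0 \<le> y" using Y[of a b] conn_step(2) by linarith
    show ?case
    proof (cases "fst a \<in> set (awalk_verts (fst b) p)")
      case True
      have "awalk (fst b) p w" using p(1) by (simp add: apath_def)
      from awalk_decomp[OF this True] obtain q r where qr: "p = q @ r" "awalk (fst b) q (fst a)" "awalk (fst a) r w"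
        by blast
      then have "awlast (fst b) q = fst a" by auto
      then have "apath (fst a) r w" using p(1) unfolding qr(1) apath_append_iff by simp
      moreover have "path_weight Y r \<le> y + x"
        using p(2) path_weight_ge_length[of Y q, OF Y] y unfolding qr(1) by simp
      ultimately show ?thesis by blast
    next
      case False
      have "apath (fst a) ((a, b) # p) w"
        using p(1) False arc by (simp add: apath_Cons_iff)
      moreover have "path_weight Y ((a, b) # p) \<le> y + x" using p(2) conn_step(2) by simp
      ultimately show ?thesis by blast
    qed
  qed
qed

lemma passage_time_le_if_conn:
  assumes "M \<in> pairings (half_edges n d)" "\<And>h h'. 1 \<le> Y {h, h'}" "conn M Y x u w" "u \<in> {1..n}"
  shows "passage_time n M Y u w \<le> ereal x"
proof -
  obtain p where "pre_digraph.apath (pairing_graph n M) u p w" "path_weight Y p \<le> x"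
    using apath_if_conn[OF assms] by blast
  then show ?thesis unfolding passage_time_def by (intro INF_lower2) auto
qed

text \<open>The infimum is attained because there are finitely many self-avoiding paths, and a
  minimising path has at most as many edges as its weight. Without a path the passage time is
  infinite.\<close>

lemma hopcount_le_passage_time:
  assumes M: "M \<in> pairings (half_edges n d)" and Y: "\<And>h h'. 1 \<le> Y {h, h'}"
  shows "ereal_of_enat (hopcount n M Y u v) \<le> passage_time n M Y u v"
proof (cases "\<exists>p. pre_digraph.apath (pairing_graph n M) u p v")
  case True
  interpret fin_digraph "pairing_graph n M" by (rule pairing_graph_fin_digraph[OF M])
  let ?P = "{p. apath u p v}"
  have "Inf ((\<lambda>p. ereal (path_weight Y p)) ` ?P) \<in> (\<lambda>p. ereal (path_weight Y p)) ` ?P"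
    using True apaths_finite[of u v] by (subst cInf_eq_Min) (auto intro!: Min_in)
  then obtain p where p: "apath u p v" "ereal (path_weight Y p) = passage_time n M Y u v"
    unfolding passage_time_def by auto
  then have "hopcount n M Y u v \<le> enat (length p)"
    unfolding hopcount_def by (intro INF_lower2[of p]) auto
  then have "ereal_of_enat (hopcount n M Y u v) \<le> ereal_of_enat (enat (length p))"
    by (simp only: ereal_of_enat_le_iff)
  also have "\<dots> \<le> ereal (path_weight Y p)" using path_weight_ge_length[of Y p, OF Y] by simp
  finally show ?thesis using p(2) by simp
next
  case False
  then show ?thesis by (simp add: passage_time_def top_ereal_def)
qed

lemma hopcount_ge:
  assumes "\<And>p. pre_digraph.apath (pairing_graph n M) u p v \<Longrightarrow> l < real (length p)"
  shows "ereal l \<le> ereal_of_enat (hopcount n M Y u v)"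
proof -
  let ?A = "{p. pre_digraph.apath (pairing_graph n M) u p v \<and> ereal (path_weight Y p) = passage_time n M Y u v}"
  have "enat (nat \<lceil>l\<rceil>) \<le> hopcount n M Y u v"
    unfolding hopcount_def
  proof (rule INF_greatest)
    fix p assume "p \<in> ?A"
    then have "l < real (length p)" using assms by simp
    then show "enat (nat \<lceil>l\<rceil>) \<le> enat (length p)" by (auto simp: nat_le_iff ceiling_le_iff)
  qed
  then have "ereal_of_enat (enat (nat \<lceil>l\<rceil>)) \<le> ereal_of_enat (hopcount n M Y u v)"
    by (simp only: ereal_of_enat_le_iff)
  moreover have "ereal l \<le> ereal_of_enat (enat (nat \<lceil>l\<rceil>))" by (simp, linarith)
  ultimately show ?thesis by (rule order.trans[rotated])
qed

text \<open>Replaces an infimum over a random set of paths by one over the countable type of all arc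
  lists, which makes measurability routine.\<close>

lemma INF_Collect_eq:
  fixes f :: "'a \<Rightarrow> ereal"
  shows "(INF x\<in>{x. P x}. f x) = (INF x. if P x then f x else \<infinity>)"
proof (rule antisym)
  show "(INF x\<in>{x. P x}. f x) \<le> (INF x. if P x then f x else \<infinity>)"
    by (rule INF_greatest) (simp add: INF_lower)
  show "(INF x. if P x then f x else \<infinity>) \<le> (INF x\<in>{x. P x}. f x)"
  proof (rule INF_greatest)
    fix x assume "x \<in> {x. P x}"
    then show "(INF x. if P x then f x else \<infinity>) \<le> f x"
      by (intro INF_lower2[of x]) auto
  qed
qed

lemma ereal_of_enat_INF:
  fixes f :: "'a \<Rightarrow> nat"
  shows "ereal_of_enat (INF x\<in>A. enat (f x)) = (INF x\<in>A. ereal (real (f x)))"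
proof (cases "A = {}")
  case True
  then show ?thesis by (simp add: top_enat_def top_ereal_def)
next
  case False
  then obtain a where a: "a \<in> A" "\<And>x. x \<in> A \<Longrightarrow> f a \<le> f x"
    using ex_has_least_nat[of "\<lambda>x. x \<in> A" _ f] by blast
  have "(INF x\<in>A. enat (f x)) = enat (f a)"
    by (intro antisym INF_greatest INF_lower a(1)) (simp add: a(2))
  moreover have "(INF x\<in>A. ereal (real (f x))) = ereal (real (f a))"
    by (intro antisym INF_greatest INF_lower a(1)) (simp add: a(2))
  ultimately show ?thesis by simp
qed

section \<open>Measurability of passage time and hopcount\<close>

context weights
begin

lemma weighted_cm_eq: "weighted_cm D F n = measure_pmf (sample_pmf D n) \<Otimes>\<^sub>M PY"
  by (simp add: weighted_cm_def sample_pmf_def PY_def)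

lemma measurable_path_weight [measurable]: "(\<lambda>Y. path_weight Y p) \<in> borel_measurable PY"
  by (induction p) (simp_all add: borel_measurable_add)

lemma measurable_fst_pred [measurable]: "Measurable.pred (measure_pmf S \<Otimes>\<^sub>M PY) (\<lambda>\<omega>. R (fst \<omega>))"
  by (rule measurable_compose[OF measurable_fst]) simp

lemma measurable_passage_time_rv [measurable]: "passage_time_rv n \<in> borel_measurable (measure_pmf S \<Otimes>\<^sub>M PY)"
proof -
  let ?R = "\<lambda>p x. case x of (M, u, v) \<Rightarrow> pre_digraph.apath (pairing_graph n M) u p v"
  have "passage_time_rv n = (\<lambda>\<omega>. INF p. if ?R p (fst \<omega>) then ereal (path_weight (snd \<omega>) p) else \<infinity>)"
  proof (rule ext)
    fix \<omega> :: "(half_edge set set \<times> nat \<times> nat) \<times> (half_edge set \<Rightarrow> real)"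
    obtain M u v Y where \<omega>: "\<omega> = ((M, u, v), Y)" by (metis prod.collapse)
    show "passage_time_rv n \<omega> = (INF p. if ?R p (fst \<omega>) then ereal (path_weight (snd \<omega>) p) else \<infinity>)"
      unfolding \<omega> passage_time_rv_def passage_time_def
      by (simp add: INF_Collect_eq)
  qed
  also have "\<dots> \<in> borel_measurable (measure_pmf S \<Otimes>\<^sub>M PY)"
    by measurable
  finally show ?thesis .
qed

lemma measurable_hopcount_rv [measurable]: "hopcount_rv n \<in> borel_measurable (measure_pmf S \<Otimes>\<^sub>M PY)"
proof -
  let ?R = "\<lambda>p x. case x of (M, u, v) \<Rightarrow> pre_digraph.apath (pairing_graph n M) u p v"
  have "hopcount_rv n = (\<lambda>\<omega>. INF p. if ?R p (fst \<omega>) \<and> ereal (path_weight (snd \<omega>) p) = passage_time_rv n \<omega>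
      then ereal (real (length p)) else \<infinity>)"
  proof (rule ext)
    fix \<omega> :: "(half_edge set set \<times> nat \<times> nat) \<times> (half_edge set \<Rightarrow> real)"
    obtain M u v Y where \<omega>: "\<omega> = ((M, u, v), Y)" by (metis prod.collapse)
    show "hopcount_rv n \<omega> = (INF p. if ?R p (fst \<omega>) \<and> ereal (path_weight (snd \<omega>) p) = passage_time_rv n \<omega>
      then ereal (real (length p)) else \<infinity>)"
      unfolding \<omega> hopcount_rv_def hopcount_def passage_time_rv_def prod.case ereal_of_enat_INF
      by (simp add: INF_Collect_eq)
  qed
  also have "\<dots> \<in> borel_measurable (measure_pmf S \<Otimes>\<^sub>M PY)"
    by measurable
  finally show ?thesis .
qed

lemma AE_weight: "AE y in F. P y \<Longrightarrow> AE Y in PY. P (Y e)"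
  unfolding PY_def by (rule PY.AE_component) auto

lemma AE_weights_ge_1:
  assumes "AE y in F. 1 \<le> y"
  shows "AE Y in PY. \<forall>h h'. 1 \<le> Y {h, h'}"
  unfolding AE_all_countable by (intro allI AE_weight[of "\<lambda>y. 1 \<le> y"] assms)

end

text \<open>\<open>F_pos\<close> is how the infimum 0 of the support of \<open>X\<close> enters:
  edges of weight at most \<open>1 + \<epsilon>\<close> keep a positive density for every
  \<open>\<epsilon>\<close>.\<close>

locale percolation = power_law + weights +
  assumes F_ge_1: "AE y in F. 1 \<le> y"
    and F_pos: "\<And>\<epsilon>. 0 < \<epsilon> \<Longrightarrow> 0 < prob {..1 + \<epsilon>}"
begin

lemma space_weighted_cm: "space (weighted_cm D F n) = UNIV"
  by (simp add: weighted_cm_eq space_pair_measure space_PY)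

lemma prob_space_weighted_cm: "prob_space (weighted_cm D F n)"
proof -
  interpret P: pair_prob_space "measure_pmf (sample_pmf D n)" PY
    by unfold_locales
  show ?thesis unfolding weighted_cm_eq by (rule P.prob_space_axioms)
qed

lemma emeasure_weighted_cm:
  assumes "A \<in> sets (weighted_cm D F n)"
  shows "emeasure (weighted_cm D F n) A = (\<integral>\<^sup>+x. ennreal (PYp.prob (Pair x -` A)) \<partial>sample_pmf D n)"
  using PYp.emeasure_pair_measure_alt[of A "measure_pmf (sample_pmf D n)"] assms
  by (simp add: weighted_cm_eq PYp.emeasure_eq_measure)

lemma sets_slow: "{\<omega>. \<not> passage_time_rv n \<omega> \<le> x} \<in> sets (weighted_cm D F n)"
proof -
  have "Measurable.pred (weighted_cm D F n) (\<lambda>\<omega>. \<not> passage_time_rv n \<omega> \<le> x)"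
    unfolding weighted_cm_eq by measurable
  then show ?thesis by (simp add: pred_def space_weighted_cm)
qed

text \<open>On the exceptional set \<open>A\<close> of degree sequences the conditional probability
  is bounded by 1, elsewhere by \<open>\<beta>\<close>.\<close>

lemma prob_slow_le:
  fixes x \<beta> \<eta> :: real
  assumes n: "1 \<le> n"
    and good: "\<And>d u v. d \<in> set_pmf (Pi_pmf {1..n} 0 (\<lambda>_. D)) \<Longrightarrow> d \<notin> A \<Longrightarrow> u \<in> {1..n} \<Longrightarrow> v \<in> {1..n} \<Longrightarrow>
      avg (half_edges n d) (\<lambda>M. PYp.prob {Y. \<not> passage_time n M Y u v \<le> ereal x}) \<le> \<beta>"
    and A: "measure_pmf.prob (Pi_pmf {1..n} 0 (\<lambda>_. D)) A \<le> \<eta>" and \<beta>: "0 \<le> \<beta>"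
  shows "measure (weighted_cm D F n) {\<omega>. \<not> passage_time_rv n \<omega> \<le> ereal x} \<le> \<beta> + \<eta>"
proof -
  interpret P: prob_space "weighted_cm D F n" by (rule prob_space_weighted_cm)
  let ?P = "Pi_pmf {1..n} 0 (\<lambda>_. D)"
  define f where "f M u v = PYp.prob {Y. \<not> passage_time n M Y u v \<le> ereal x}" for M u v
  have f01: "0 \<le> f M u v" "f M u v \<le> 1" for M u v by (auto simp: f_def)
  let ?A = "{\<omega>. \<not> passage_time_rv n \<omega> \<le> ereal x}"
  have \<eta>: "0 \<le> \<eta>" using A measure_nonneg[of ?P A] by linarith
  have sA: "?A \<in> sets (weighted_cm D F n)" by (rule sets_slow)
  have "emeasure (weighted_cm D F n) ?A = (\<integral>\<^sup>+(M, u, v). ennreal (f M u v) \<partial>sample_pmf D n)"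
    unfolding emeasure_weighted_cm[OF sA]
    by (intro nn_integral_cong) (auto simp: f_def passage_time_rv_def vimage_def)
  also have "\<dots> = (\<integral>\<^sup>+d. ennreal ((\<Sum>u\<in>{1..n}. \<Sum>v\<in>{1..n}. avg (half_edges n d) (\<lambda>M. f M u v)) / n\<^sup>2) \<partial>?P)"
    using f01 by (intro nn_integral_sample_pmf n)
  also have "\<dots> \<le> (\<integral>\<^sup>+d. ennreal \<beta> + indicator A d \<partial>?P)"
  proof (intro nn_integral_mono_AE AE_pmfI)
    fix d assume d: "d \<in> set_pmf ?P"
    have le: "(\<Sum>u\<in>{1..n}. \<Sum>v\<in>{1..n}. avg (half_edges n d) (\<lambda>M. f M u v)) / n\<^sup>2 \<le> b"
      if "\<And>u v. u \<in> {1..n} \<Longrightarrow> v \<in> {1..n} \<Longrightarrow> avg (half_edges n d) (\<lambda>M. f M u v) \<le> b" for b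
    proof -
      have "(\<Sum>u\<in>{1..n}. \<Sum>v\<in>{1..n}. avg (half_edges n d) (\<lambda>M. f M u v)) \<le> (\<Sum>u\<in>{1..n}. \<Sum>v\<in>{1..n}. b)"
        using that by (intro sum_mono)
      also have "\<dots> = b * n\<^sup>2" by (simp add: power2_eq_square)
      finally show ?thesis using n by (simp add: divide_le_eq)
    qed
    show "ennreal ((\<Sum>u\<in>{1..n}. \<Sum>v\<in>{1..n}. avg (half_edges n d) (\<lambda>M. f M u v)) / n\<^sup>2) \<le> ennreal \<beta> + indicator A d"
    proof (cases "d \<in> A")
      case True
      have "avg (half_edges n d) (\<lambda>M. f M u v) \<le> 1" for u v
        using avg_mono[of "half_edges n d" "\<lambda>M. f M u v" "\<lambda>_. 1"] f01 avg_const_le[of 1 "half_edges n d"] by force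
      then have "ennreal ((\<Sum>u\<in>{1..n}. \<Sum>v\<in>{1..n}. avg (half_edges n d) (\<lambda>M. f M u v)) / n\<^sup>2) \<le> ennreal 1"
        by (intro ennreal_leI le)
      then show ?thesis using True by (simp add: add_increasing)
    next
      case False
      have "(\<Sum>u\<in>{1..n}. \<Sum>v\<in>{1..n}. avg (half_edges n d) (\<lambda>M. f M u v)) / n\<^sup>2 \<le> \<beta>"
        unfolding f_def by (rule le[unfolded f_def]) (rule good[OF d False])
      then show ?thesis using False by (simp add: ennreal_leI)
    qed
  qed
  also have "\<dots> = ennreal \<beta> + emeasure ?P A"
    by (subst nn_integral_add) auto
  also have "\<dots> \<le> ennreal \<beta> + ennreal \<eta>"
    using A by (intro add_mono order.refl) (simp add: measure_pmf.emeasure_eq_measure ennreal_leI)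
  also have "\<dots> = ennreal (\<beta> + \<eta>)"
    using \<beta> \<eta> by (subst ennreal_plus) auto
  finally show ?thesis
    using \<beta> \<eta> unfolding P.emeasure_eq_measure by (subst (asm) ennreal_le_iff) auto
qed

text \<open>A degree sequence is exceptional if its sum, its maximum or the size of one of the
  windows is out of bounds; otherwise \<open>avg_bad_windows\<close> applies.\<close>

lemma prob_slow:
  fixes z :: "nat \<Rightarrow> real" and B Q a s \<Delta> q t t' \<mu> :: real and n k r :: nat
  defines "p \<equiv> prob {..t}" and "c \<equiv> c\<^sub>1 / 32"
  assumes n: "2 \<le> n" "2 * r + 1 \<le> n"
    and \<mu>: "(\<integral>\<^sup>+t. ennreal (real t) \<partial>D) \<le> ennreal \<mu>" "0 \<le> \<mu>" and a: "0 < a" and \<Delta>: "2 \<le> \<Delta>"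
    and z: "\<And>i. z (Suc i) = z i powr B" "2 \<le> z 0" "2 * Q \<le> z 0" "5 \<le> z k" "\<And>i. i \<le> k \<Longrightarrow> z i \<le> z k" "\<And>i. 1 \<le> z i"
    and B: "1 < B" and Q: "1 \<le> Q" "C\<^sub>1 * Q powr (- (\<tau> - 1)) \<le> c\<^sub>1 / 2" and s: "2 \<le> s * (B - 1)"
    and R: "real (1 + r + k) \<le> c / 2 * real n * z k powr (- (\<tau> - 1))"
    and Qk: "Q * z k \<le> c / 4 * real n * z k powr (- (\<tau> - 2))"
    and t: "0 \<le> t" "0 \<le> t'"
    and big: "\<And>i. i \<le> k \<Longrightarrow> exp (- (p * c / (16 * a)) * z i powr (1 - B * (\<tau> - 2))) \<le> z i powr (- s) / 2"
    and q: "0 \<le> q" "q \<le> 1" "q \<le> c / (2 * a) * z 0 powr (- (\<tau> - 2))"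
  shows "measure (weighted_cm D F n) {\<omega>. \<not> passage_time_rv n \<omega> \<le> ereal (2 * (real r * t' + real k * t) + t)} \<le>
     (2 * ((1 - q) ^ r + real r * (prob {t'<..} + real (1 + r + k) * \<Delta> / real n + z 0 powr (- s))) +
      (real n)\<^sup>2 * exp (- (p * (z k - 1)\<^sup>2 / (16 * (a * real n))))) +
     ((\<mu> + 1) / a + real n * (C\<^sub>1 * (\<Delta> - 1) powr (- (\<tau> - 1))) +
      (real k + 1) * exp (- (c\<^sub>1 / 16 * real n * z k powr (- (\<tau> - 1)))))"
proof -
  let ?P = "Pi_pmf {1..n} 0 (\<lambda>_. D)"
  define A1 where "A1 = {d. a * n < (\<Sum>i\<in>{1..n}. real (d i)) + 1}"
  define A2 where "A2 = {d. \<exists>i\<in>{1..n}. \<Delta> < real (d i) + 1}"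
  define A3 where "A3 i = {d. card (window n d Q (z i)) < c\<^sub>1 / 32 * real n * z i powr (- (\<tau> - 1))}" for i
  let ?A = "A1 \<union> A2 \<union> (\<Union>i\<in>{..k}. A3 i)"
  have n1: "1 \<le> n" using n by simp
  have c0: "0 < c" using c\<^sub>1 by (simp add: c_def)
  have PA: "measure_pmf.prob ?P ?A \<le> (\<mu> + 1) / a + real n * (C\<^sub>1 * (\<Delta> - 1) powr (- (\<tau> - 1))) +
      (real k + 1) * exp (- (c\<^sub>1 / 16 * real n * z k powr (- (\<tau> - 1))))"
  proof -
    have "measure_pmf.prob ?P ?A \<le> measure_pmf.prob ?P (A1 \<union> A2) + measure_pmf.prob ?P (\<Union>i\<in>{..k}. A3 i)"
      by (rule measure_Un_le) auto
    also have "measure_pmf.prob ?P (A1 \<union> A2) \<le> measure_pmf.prob ?P A1 + measure_pmf.prob ?P A2"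
      by (rule measure_Un_le) auto
    also have "measure_pmf.prob ?P A1 \<le> (\<mu> + 1) / a"
      unfolding A1_def by (rule prob_degree_sum[OF \<mu> a n1])
    also have "measure_pmf.prob ?P A2 \<le> n * (C\<^sub>1 * (\<Delta> - 1) powr (- (\<tau> - 1)))"
      unfolding A2_def by (rule prob_max_degree[OF \<Delta>])
    also have "measure_pmf.prob ?P (\<Union>i\<in>{..k}. A3 i) \<le> (\<Sum>i\<in>{..k}. measure_pmf.prob ?P (A3 i))"
      by (rule measure_pmf.finite_measure_subadditive_finite) auto
    also have "\<dots> \<le> (\<Sum>i\<in>{..k}. exp (- (c\<^sub>1 / 16 * real n * z k powr (- (\<tau> - 1)))))"
    proof (rule sum_mono)
      fix i assume i: "i \<in> {..k}"
      have "measure_pmf.prob ?P (A3 i) \<le> exp (- (c\<^sub>1 / 16 * real n * z i powr (- (\<tau> - 1))))"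
        unfolding A3_def by (rule prob_few_in_window[OF Q z(6) n(1)])
      \<comment> \<open>The highest window is the sparsest; its bound is the weakest and serves for
        all.\<close>
      also have "\<dots> \<le> exp (- (c\<^sub>1 / 16 * real n * z k powr (- (\<tau> - 1))))"
      proof -
        have "z k powr (- (\<tau> - 1)) \<le> z i powr (- (\<tau> - 1))"
          using z(5)[of i] z(6)[of i] i \<tau> by (intro powr_mono2') auto
        then have "c\<^sub>1 / 16 * real n * z k powr (- (\<tau> - 1)) \<le> c\<^sub>1 / 16 * real n * z i powr (- (\<tau> - 1))"
          using c\<^sub>1 by (intro mult_left_mono) auto
        then show ?thesis by simp
      qed
      finally show "measure_pmf.prob ?P (A3 i) \<le> exp (- (c\<^sub>1 / 16 * real n * z k powr (- (\<tau> - 1))))" .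
    qed
    also have "\<dots> = (real k + 1) * exp (- (c\<^sub>1 / 16 * real n * z k powr (- (\<tau> - 1))))" by simp
    finally show ?thesis by simp
  qed
  let ?\<beta> = "2 * ((1 - q) ^ r + real r * (prob {t'<..} + real (1 + r + k) * \<Delta> / real n + z 0 powr (- s))) +
      (real n)\<^sup>2 * exp (- (p * (z k - 1)\<^sup>2 / (16 * (a * real n))))"
  show ?thesis
  proof (rule prob_slow_le[OF n1 _ PA])
    show "0 \<le> ?\<beta>"
      using q \<Delta> by (intro add_nonneg_nonneg mult_nonneg_nonneg divide_nonneg_nonneg zero_le_power) auto
    fix d u v assume d: "d \<in> set_pmf ?P" and dA: "d \<notin> ?A" and uv: "u \<in> {1..n}" "v \<in> {1..n}"
    have d2: "2 \<le> d i" if "i \<in> {1..n}" for i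
      using that d set_pmf_D by (auto simp: set_Pi_pmf PiE_dflt_def)
    have sumd: "(\<Sum>i\<in>{1..n}. real (d i)) + 1 \<le> a * n" using dA by (simp add: A1_def not_less)
    have maxd: "real (d i) + 1 \<le> \<Delta>" if "i \<in> {1..n}" for i
      using dA that unfolding A2_def by (simp add: not_less)
    have win: "c * n * z i powr (- (\<tau> - 1)) \<le> card (window n d Q (z i))" if "i \<le> k" for i
      using dA that unfolding A3_def c_def by (simp add: not_less)
    have R': "real (1 + r + k) \<le> c / 2 * real n * z k powr (- (\<tau> - 1))" using R by simp
    obtain E where E: "\<And>M. E M \<in> sets PY"
      "\<And>M Y. M \<in> pairings (half_edges n d) \<Longrightarrow> Y \<notin> E M \<Longrightarrow> conn M Y (2 * (real r * t' + real k * t) + t) u v"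
      "avg (half_edges n d) (\<lambda>M. PYp.prob (E M)) \<le>
      2 * ((1 - q) ^ r + real r * (prob {t'<..} + real (1 + r + k) * \<Delta> / real n + z 0 powr (- s))) +
      (real n)\<^sup>2 * exp (- (prob {..t} * (z k - 1)\<^sup>2 / (16 * (a * real n))))"
      by (rule avg_bad_windows[OF n1 n(2) d2 sumd maxd z(1-4) B Q(1) \<tau>(1) c0 s win order.refl R' Qk t
            big[unfolded p_def] q uv]) (assumption | (rule that; assumption))+
    have "avg (half_edges n d) (\<lambda>M. PYp.prob {Y. \<not> passage_time n M Y u v \<le> ereal (2 * (real r * t' + real k * t) + t)})
        \<le> avg (half_edges n d) (\<lambda>M. PYp.prob (E M))"
    proof (rule avg_mono)
      fix M assume M: "M \<in> pairings (half_edges n d)"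
      show "PYp.prob {Y. \<not> passage_time n M Y u v \<le> ereal (2 * (real r * t' + real k * t) + t)} \<le> PYp.prob (E M)"
      proof (rule PYp.finite_measure_mono_AE[OF _ E(1)])
        show "AE Y in PY. Y \<in> {Y. \<not> passage_time n M Y u v \<le> ereal (2 * (real r * t' + real k * t) + t)} \<longrightarrow> Y \<in> E M"
          using AE_weights_ge_1[OF F_ge_1]
        proof eventually_elim
          case (elim Y)
          show ?case
          proof
            assume slow: "Y \<in> {Y. \<not> passage_time n M Y u v \<le> ereal (2 * (real r * t' + real k * t) + t)}"
            show "Y \<in> E M"
            proof (rule ccontr)
              assume "Y \<notin> E M"
              from passage_time_le_if_conn[OF M _ E(2)[OF M this] uv(1)] elim slow show False by simp
            qed
          qed
        qed
      qed
    qed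
    also have "\<dots> \<le> ?\<beta>" using E(3) unfolding p_def by simp
    finally show "avg (half_edges n d) (\<lambda>M. PYp.prob {Y. \<not> passage_time n M Y u v \<le> ereal (2 * (real r * t' + real k * t) + t)}) \<le> ?\<beta>" .
  qed
qed

lemma tail_F_tendsto_0: "((\<lambda>x. prob {x<..}) \<longlongrightarrow> 0) at_top"
proof -
  interpret F: real_distribution F
    by unfold_locales (simp_all add: sets_F)
  have "prob {x<..} = 1 - cdf F x" for x
  proof -
    have "{x<..} = space F - {..x}" by (auto simp: space_F)
    then show ?thesis unfolding cdf_def using prob_compl[of "{..x}"] by (simp add: sets_F)
  qed
  moreover have "((\<lambda>x. 1 - cdf F x) \<longlongrightarrow> 1 - 1) at_top"
    by (intro tendsto_diff tendsto_const F.cdf_lim_at_top_prob)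
  ultimately show ?thesis by simp
qed

lemma measure_slow_mono:
  assumes "x \<le> y"
  shows "measure (weighted_cm D F n) {\<omega>. \<not> passage_time_rv n \<omega> \<le> ereal y} \<le>
    measure (weighted_cm D F n) {\<omega>. \<not> passage_time_rv n \<omega> \<le> ereal x}"
proof -
  interpret P: prob_space "weighted_cm D F n" by (rule prob_space_weighted_cm)
  have "ereal x \<le> ereal y" using assms by simp
  then show ?thesis
    by (intro P.finite_measure_mono sets_slow) (auto intro: order.trans)
qed

lemma mult_powr_powr: "0 < (x::real) \<Longrightarrow> x * (x powr u) powr v = x powr (1 + u * v)"
  by (simp add: powr_powr powr_add)

lemma powr_div_self: "0 < (x::real) \<Longrightarrow> x powr u / x = x powr (u - 1)"
  by (simp add: powr_diff)

lemma not_slow: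
  assumes l: "2 / \<bar>ln (\<tau> - 2)\<bar> < l"
  shows "(\<lambda>n. measure (weighted_cm D F n) {\<omega>. \<not> passage_time_rv n \<omega> \<le> ereal (l * ln (ln n))}) \<longlonglongrightarrow> 0"
proof (rule LIMSEQ_I)
  fix \<eta>' :: real assume \<eta>': "0 < \<eta>'"
  \<comment> \<open>The final bound collects twelve contributions of at most \<open>\<eta>\<close>,
    hence a thirteenth of \<open>\<eta>'\<close>.\<close>
  define \<eta> where "\<eta> = min (\<eta>' / 13) (1 / 2)"
  have \<eta>: "0 < \<eta>" "\<eta> < 1" "12 * \<eta> < \<eta>'" using \<eta>' by (auto simp: \<eta>_def)
  have t2: "0 < \<tau> - 2" "\<tau> - 2 < 1" using \<tau> by auto
  define lk where "lk = \<bar>ln (\<tau> - 2)\<bar>"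
  have lk: "lk = - ln (\<tau> - 2)" "0 < lk" using t2 by (auto simp: lk_def ln_less_zero_iff)
  have "0 < 2 / lk" using lk(2) by simp
  then have l0: "0 < l" using l unfolding lk_def by linarith
  have "2 < l * lk" using l lk(2) unfolding lk_def[symmetric] by (simp only: pos_divide_less_eq)
  then have "2 / l < lk" using l0 by (simp only: pos_divide_less_eq mult.commute)
  \<comment> \<open>\<open>lB < lk\<close> gives \<open>B * (\<tau> - 2) < 1\<close>;
    \<open>2 / l < lB\<close> makes the two climbs, of about \<open>ln (ln n) / lB\<close> steps
    each, together shorter than \<open>l * ln (ln n)\<close>.\<close>
  define lB where "lB = (lk + 2 / l) / 2"
  have lB: "2 / l < lB" "lB < lk" "0 < lB"
  proof -
    have "0 < 2 / l" using l0 by simp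
    then show "2 / l < lB" "lB < lk" "0 < lB"
      using \<open>2 / l < lk\<close> lk(2) unfolding lB_def by (simp_all only: field_simps)
  qed
  have llB: "2 < l * lB" using lB l0 by (simp add: field_simps)
  define B where "B = exp lB"
  have B1: "1 < B" using lB by (simp add: B_def)
  define \<delta> where "\<delta> = 1 - B * (\<tau> - 2)"
  have \<delta>: "0 < \<delta>"
  proof -
    have "B < exp lk" using lB by (simp add: B_def)
    also have "exp lk = 1 / (\<tau> - 2)" using lk t2 by (simp add: exp_minus inverse_eq_divide)
    finally have "B * (\<tau> - 2) < 1" using t2 by (simp add: field_simps)
    then show ?thesis by (simp add: \<delta>_def)
  qed
  \<comment> \<open>With this choice \<open>2 * t / lB\<close> is the midpoint of
    \<open>2 / lB\<close> and \<open>l\<close>. The climbs over edges of weight at most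
    \<open>t\<close> thus leave the slack \<open>\<zeta>\<close> for the two starts and the final
    edge.\<close>
  define \<epsilon> where "\<epsilon> = (l * lB / 2 - 1) / 2"
  define t where "t = 1 + \<epsilon>"
  define \<zeta> where "\<zeta> = l - 2 * t / lB"
  have \<epsilon>: "0 < \<epsilon>" using llB by (simp add: \<epsilon>_def)
  have t0: "0 < t" using \<epsilon> by (simp add: t_def)
  have "2 * t / lB = 1 / lB + l / 2" using lB by (simp add: t_def \<epsilon>_def field_simps)
  moreover have "1 / lB < l / 2" using llB lB by (simp add: field_simps)
  ultimately have \<zeta>: "0 < \<zeta>" by (simp add: \<zeta>_def)
  define p where "p = prob {..t}"
  have p: "0 < p" using F_pos[OF \<epsilon>] by (simp add: p_def t_def)
  define c where "c = c\<^sub>1 / 32"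
  have c: "0 < c" using c\<^sub>1 by (simp add: c_def)
  have "((\<lambda>Q. C\<^sub>1 * Q powr (- (\<tau> - 1))) \<longlongrightarrow> 0) at_top"
  proof -
    have "((\<lambda>Q::real. Q powr (- (\<tau> - 1))) \<longlongrightarrow> 0) at_top"
      using \<tau> by (intro tendsto_neg_powr filterlim_ident) auto
    from tendsto_mult[OF tendsto_const this, of C\<^sub>1] show ?thesis by simp
  qed
  then have "\<forall>\<^sub>F Q in at_top. C\<^sub>1 * Q powr (- (\<tau> - 1)) < c\<^sub>1 / 2 \<and> 1 \<le> Q"
    using c\<^sub>1 by (intro eventually_conj order_tendstoD(2)[of _ 0] eventually_ge_at_top) auto
  then obtain Q where Q: "1 \<le> Q" "C\<^sub>1 * Q powr (- (\<tau> - 1)) \<le> c\<^sub>1 / 2"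
    by (auto simp: eventually_at_top_linorder dest: less_imp_le)
  obtain \<mu> where \<mu>: "(\<integral>\<^sup>+t. ennreal (real t) \<partial>D) \<le> ennreal \<mu>" "0 \<le> \<mu>"
  proof -
    have s': "1 < \<tau> / 2" "\<tau> / 2 < \<tau> - 1" using \<tau> by auto
    obtain m0 where m0: "1 \<le> m0" "(\<integral>\<^sup>+t. ennreal ((real t + 1) powr (\<tau> / 2)) \<partial>D) \<le> ennreal m0"
      using finite_moment[OF s'] .
    have "real x \<le> (real x + 1) powr (\<tau> / 2)" for x
    proof -
      have "real x + 1 = (real x + 1) powr 1" by simp
      also have "\<dots> \<le> (real x + 1) powr (\<tau> / 2)" using s' by (intro powr_mono) auto
      finally show ?thesis by simp
    qed
    then have "(\<integral>\<^sup>+t. ennreal (real t) \<partial>D) \<le> (\<integral>\<^sup>+t. ennreal ((real t + 1) powr (\<tau> / 2)) \<partial>D)"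
      by (intro nn_integral_mono ennreal_leI)
    then show thesis using m0 by (intro that[of m0]) auto
  qed
  \<comment> \<open>The first argument makes Markov's bound at most \<open>\<eta>\<close>; the
    maximum with \<open>c\<close> ensures \<open>c / (2 * a) \<le> 1\<close>, so that
    \<open>q\<close> below is a probability.\<close>
  define a where "a = max ((\<mu> + 1) / \<eta>) c"
  have a: "0 < a" "c \<le> a" "(\<mu> + 1) / a \<le> \<eta>"
  proof -
    show "0 < a" "c \<le> a" using c by (auto simp: a_def)
    have "(\<mu> + 1) / \<eta> \<le> a" by (simp add: a_def)
    then show "(\<mu> + 1) / a \<le> \<eta>" using \<open>0 < a\<close> \<eta> by (simp add: field_simps)
  qed
  \<comment> \<open>\<open>s * (B - 1) \<ge> 2\<close> is for the climb;
    \<open>s \<ge> 2 > b\<close> lets \<open>K powr (- s)\<close> outweigh the number of steps of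
    the start, which is of order \<open>K powr b\<close>.\<close>
  define s where "s = 2 + 2 / (B - 1)"
  have sx: "2 \<le> (2 + 2 / x) * x" "2 \<le> 2 + 2 / x" if "0 < x" for x :: real
    using that by (simp_all add: distrib_right)
  have s: "2 \<le> s * (B - 1)" "2 \<le> s"
    unfolding s_def using sx[of "B - 1"] B1 by (simp_all only: diff_gt_0_iff_gt)
  \<comment> \<open>\<open>z 0\<close> will lie between \<open>K\<close> and
    \<open>K powr B\<close>, so \<open>K powr (- b)\<close> is a lower bound for
    \<open>z 0 powr (- (\<tau> - 2))\<close>.\<close>
  define b where "b = B * (\<tau> - 2)"
  have b: "0 < b" "b < 1" using \<delta> B1 t2 by (auto simp: b_def \<delta>_def)
  have limK2: "((\<lambda>z. exp (- (p * c / (16 * a)) * z powr \<delta>) * z powr s) \<longlongrightarrow> 0) at_top"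
  proof -
    define C where "C = p * c / (16 * a)"
    have "0 < C" using p c a by (simp add: C_def)
    then have "((\<lambda>z. exp (- C * z powr \<delta>) * z powr s) \<longlongrightarrow> 0) at_top"
      using \<delta> s by real_asymp
    then show ?thesis unfolding C_def .
  qed
  have evK2: "\<forall>\<^sub>F z in at_top. exp (- (p * c / (16 * a)) * z powr \<delta>) \<le> z powr (- s) / 2"
  proof -
    have "\<forall>\<^sub>F z in at_top. exp (- (p * c / (16 * a)) * z powr \<delta>) * z powr s < 1 / 2"
      by (rule order_tendstoD(2)[OF limK2]) simp
    then show ?thesis
      using eventually_gt_at_top[of 0]
    proof eventually_elim
      case (elim z)
      have "e \<le> w powr (- s) / 2" if "e * w powr s < 1 / 2" "0 < w" for e w :: real
        using that by (simp add: powr_minus field_simps)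
      from this[OF elim] show ?case .
    qed
  qed
  define c5 where "c5 = c / (2 * a)"
  have c5: "0 < c5" "c5 \<le> 1" using a c by (auto simp: c5_def field_simps)
  define Lg where "Lg = ln (1 / \<eta>)"
  have Lg: "0 < Lg" using \<eta> by (simp add: Lg_def)
  have limK3: "((\<lambda>K. (Lg / (c5 * K powr (- b)) + 1) * K powr (- s)) \<longlongrightarrow> 0) at_top"
  proof -
    have "((\<lambda>K::real. Lg / c5 * K powr (- (s - b)) + K powr (- s)) \<longlongrightarrow> 0) at_top"
    proof -
      have "((\<lambda>K::real. K powr (- (s - b))) \<longlongrightarrow> 0) at_top" "((\<lambda>K::real. K powr (- s)) \<longlongrightarrow> 0) at_top"
        using s b by (auto intro!: tendsto_neg_powr filterlim_ident)
      from tendsto_add[OF tendsto_mult[OF tendsto_const this(1), of "Lg / c5"] this(2)] show ?thesis by simp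
    qed
    moreover have "\<forall>\<^sub>F K in at_top. Lg / c5 * K powr (- (s - b)) + K powr (- s) = (Lg / (c5 * K powr (- b)) + 1) * K powr (- s)"
      using eventually_gt_at_top[of 0]
    proof eventually_elim
      case (elim K)
      have "K powr (- (s - b)) = K powr (- s) / K powr (- b)"
        by (simp add: powr_diff[symmetric])
      then show ?case using c5 elim by (simp add: field_simps)
    qed
    ultimately show ?thesis by (rule Lim_transform_eventually)
  qed
  have "\<forall>\<^sub>F K in at_top. (\<forall>z\<ge>K. exp (- (p * c / (16 * a)) * z powr \<delta>) \<le> z powr (- s) / 2) \<and>
      (Lg / (c5 * K powr (- b)) + 1) * K powr (- s) < \<eta> \<and> 3 \<le> K \<and> 2 * Q \<le> K"
    using eventually_all_ge_at_top[OF evK2] order_tendstoD(2)[OF limK3 \<eta>(1)]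
    by (intro eventually_conj eventually_ge_at_top) auto
  then obtain K where K: "\<And>z. K \<le> z \<Longrightarrow> exp (- (p * c / (16 * a)) * z powr \<delta>) \<le> z powr (- s) / 2"
      "(Lg / (c5 * K powr (- b)) + 1) * K powr (- s) < \<eta>" "3 \<le> K" "2 * Q \<le> K"
    by (auto simp: eventually_at_top_linorder)
  have lnK: "1 \<le> ln K"
  proof -
    have "exp 1 \<le> (3::real)" by (rule exp_le)
    then have "exp 1 \<le> K" using K(3) by linarith
    then show ?thesis using K(3) by (simp add: ln_ge_iff)
  qed
  define q where "q = c5 * K powr (- b)"
  have q: "0 < q" "q \<le> 1"
  proof -
    show "0 < q" using c5 K(3) by (simp add: q_def)
    have "K powr (- b) \<le> K powr 0" using K(3) b by (intro powr_mono) auto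
    then have "K powr (- b) \<le> 1" using K(3) by simp
    then show "q \<le> 1" using c5 by (simp add: q_def mult_le_one)
  qed
  \<comment> \<open>Independent of \<open>n\<close>, and large enough for
    \<open>(1 - q) ^ r \<le> exp (- Lg) = \<eta>\<close>.\<close>
  define r where "r = nat \<lceil>Lg / q\<rceil>"
  have r: "Lg / q \<le> r" "r \<le> Lg / q + 1"
    using Lg q unfolding r_def by (auto simp: less_imp_le)
  have qr: "(1 - q) ^ r \<le> \<eta>"
  proof -
    have "(1 - q) ^ r \<le> exp (- q) ^ r"
      using q exp_ge_add_one_self[of "- q"] by (intro power_mono) auto
    also have "\<dots> = exp (- (q * r))" by (simp add: exp_of_nat_mult[symmetric] mult.commute)
    also have "\<dots> \<le> exp (- Lg)" using r(1) q by (simp add: field_simps)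
    also have "\<dots> = \<eta>" using \<eta> by (simp add: Lg_def ln_div)
    finally show ?thesis .
  qed
  have rK: "r * K powr (- s) \<le> \<eta>"
  proof -
    have "r * K powr (- s) \<le> (Lg / q + 1) * K powr (- s)" using r(2) by (intro mult_right_mono) auto
    then show ?thesis using K(2) by (simp add: q_def)
  qed
  \<comment> \<open>\<open>\<alpha> < 1 / (\<tau> - 1)\<close> guarantees vertices of degree about
    \<open>n powr \<alpha>\<close>, and \<open>\<alpha> > 1 / 2\<close> makes the number of edges
    between two of them, of order \<open>n powr (2 * \<alpha> - 1)\<close>, diverge.
    \<open>\<gamma> > 1 / (\<tau> - 1)\<close> keeps all degrees below
    \<open>n powr \<gamma>\<close>, and \<open>\<gamma> < 1\<close> makes the half-edges of the
    visited vertices negligible.\<close>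
  define \<alpha> where "\<alpha> = (1 / 2 + 1 / (\<tau> - 1)) / 2"
  define \<gamma> where "\<gamma> = (1 / (\<tau> - 1) + 1) / 2"
  have \<tau>1: "1 / 2 < 1 / (\<tau> - 1)" "1 / (\<tau> - 1) < 1" using \<tau> by (auto simp: field_simps)
  have "1 / 2 < (1 / 2 + x) / 2 \<and> (1 / 2 + x) / 2 < x \<and> x < (x + 1) / 2 \<and> (x + 1) / 2 < 1"
    if "1 / 2 < x" "x < 1" for x :: real
    using that by simp
  from this[OF \<tau>1] have \<alpha>: "1 / 2 < \<alpha>" "\<alpha> < 1 / (\<tau> - 1)" "\<alpha> < 1"
    and \<gamma>: "1 / (\<tau> - 1) < \<gamma>" "\<gamma> < 1" "0 < \<gamma>"
    unfolding \<alpha>_def[symmetric] \<gamma>_def[symmetric] using \<tau>1 by (auto intro: less_trans)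
  have \<alpha>\<gamma>: "\<alpha> * (\<tau> - 1) < 1" "1 < \<gamma> * (\<tau> - 1)"
    using \<alpha>(2) \<gamma>(1) \<tau> by (simp_all add: pos_less_divide_eq pos_divide_less_eq)
  define \<theta>1 where "\<theta>1 = 1 - \<alpha> * (\<tau> - 1)"
  define \<theta>2 where "\<theta>2 = 2 * \<alpha> - 1"
  define \<theta>3 where "\<theta>3 = \<gamma> * (\<tau> - 1) - 1"
  define \<theta>4 where "\<theta>4 = 1 - \<gamma>"
  have \<theta>: "0 < \<theta>1" "0 < \<theta>2" "0 < \<theta>3" "0 < \<theta>4"
    unfolding \<theta>1_def \<theta>2_def \<theta>3_def \<theta>4_def using \<alpha>\<gamma> \<alpha>(1) \<gamma>(2) by simp_all
  \<comment> \<open>It tends to infinity, so that boundedly many edges obey it with high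
    probability, yet \<open>r * t' n\<close> takes at most a quarter of the slack.\<close>
  define t' where "t' n = \<zeta> * ln (ln (real n)) / (4 * (real r + 1))" for n
  define C2 where "C2 = c\<^sub>1 / 16"
  define C3 where "C3 = p / (64 * a)"
  define C4 where "C4 = C\<^sub>1 * 2 powr (\<tau> - 1)"
  define rr where "rr = real r"
  have pos: "0 < C2" "0 < C3" "0 < C4" "0 \<le> rr"
    using c\<^sub>1 p a C1_ge_1 by (auto simp: C2_def C3_def C4_def rr_def)
  have c2: "0 < c / 2" "0 < c / 4" using c by auto
  have \<alpha>0: "0 < \<alpha>" using \<alpha> by simp
  have ev1: "\<forall>\<^sub>F n::nat in sequentially. 2 * rr + 1 \<le> real n"
    by real_asymp
  have ev2: "\<forall>\<^sub>F n::nat in sequentially. rr + 2 + ln (ln (real n)) / lB \<le> c / 2 * real n powr \<theta>1"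
    using c \<theta> lB by real_asymp
  have ev3: "\<forall>\<^sub>F n::nat in sequentially. Q \<le> c / 4 * real n powr \<theta>1"
    using c \<theta> by real_asymp
  have ev4: "\<forall>\<^sub>F n::nat in sequentially. 5 \<le> real n powr \<alpha>"
    using \<alpha>0 by real_asymp
  have ev5: "\<forall>\<^sub>F n::nat in sequentially. 1 \<le> \<alpha> * ln (real n) / ln K"
    using \<alpha>0 lnK by real_asymp
  have ev6: "\<forall>\<^sub>F n::nat in sequentially. rr * prob {t' n<..} < \<eta>"
  proof -
    define \<kappa> where "\<kappa> = \<zeta> / (4 * (real r + 1))"
    have "0 < \<kappa>" using \<zeta> by (simp add: \<kappa>_def)
    then have "filterlim (\<lambda>n::nat. \<kappa> * ln (ln (real n))) at_top sequentially" by real_asymp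
    then have "filterlim t' at_top sequentially" by (simp add: t'_def[abs_def] \<kappa>_def)
    from filterlim_compose[OF tail_F_tendsto_0 this] have "(\<lambda>n. prob {t' n<..}) \<longlonglongrightarrow> 0" .
    from tendsto_mult[OF tendsto_const this, of rr] have "(\<lambda>n. rr * prob {t' n<..}) \<longlonglongrightarrow> 0" by simp
    from order_tendstoD(2)[OF this \<eta>(1)] show ?thesis .
  qed
  have ev7: "\<forall>\<^sub>F n::nat in sequentially. rr * ((rr + 2 + ln (ln (real n)) / lB) * real n powr (- \<theta>4)) < \<eta>"
  proof -
    have "(\<lambda>n::nat. (rr + 2 + ln (ln (real n)) / lB) * real n powr (- \<theta>4)) \<longlonglongrightarrow> 0"
      using \<theta> lB by real_asymp
    from tendsto_mult[OF tendsto_const this, of rr]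
    have "(\<lambda>n::nat. rr * ((rr + 2 + ln (ln (real n)) / lB) * real n powr (- \<theta>4))) \<longlonglongrightarrow> 0" by simp
    from order_tendstoD(2)[OF this \<eta>(1)] show ?thesis .
  qed
  have ev8: "\<forall>\<^sub>F n::nat in sequentially. (real n)\<^sup>2 * exp (- (C3 * real n powr \<theta>2)) < \<eta>"
  proof -
    have "(\<lambda>n::nat. (real n)\<^sup>2 * exp (- (C3 * real n powr \<theta>2))) \<longlonglongrightarrow> 0"
      using \<theta> pos by real_asymp
    from order_tendstoD(2)[OF this \<eta>(1)] show ?thesis .
  qed
  have ev9: "\<forall>\<^sub>F n::nat in sequentially. C4 * real n powr (- \<theta>3) < \<eta>"
  proof -
    have "(\<lambda>n::nat. C4 * real n powr (- \<theta>3)) \<longlonglongrightarrow> 0"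
      using \<theta> pos by real_asymp
    from order_tendstoD(2)[OF this \<eta>(1)] show ?thesis .
  qed
  have ev10: "\<forall>\<^sub>F n::nat in sequentially. (ln (ln (real n)) / lB + 1) * exp (- (C2 * real n powr \<theta>1)) < \<eta>"
  proof -
    have "(\<lambda>n::nat. (ln (ln (real n)) / lB + 1) * exp (- (C2 * real n powr \<theta>1))) \<longlonglongrightarrow> 0"
      using \<theta> pos lB by real_asymp
    from order_tendstoD(2)[OF this \<eta>(1)] show ?thesis .
  qed
  have ev11: "\<forall>\<^sub>F n::nat in sequentially. 2 \<le> real n powr \<gamma>"
    using \<gamma> by real_asymp
  have ev12: "\<forall>\<^sub>F n::nat in sequentially. t \<le> \<zeta> / 2 * ln (ln (real n))"
    using \<zeta> by real_asymp
  have "\<forall>\<^sub>F n in sequentially. norm (measure (weighted_cm D F n)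
      {\<omega>. \<not> passage_time_rv n \<omega> \<le> ereal (l * ln (ln n))} - 0) < \<eta>'"
    using ev1 ev2 ev3 ev4 ev5 ev6 ev7 ev8 ev9 ev10 ev11 ev12 eventually_ge_at_top[of 3]
  proof eventually_elim
    case (elim n)
    note e1 = elim(1) and e2 = elim(2) and e3 = elim(3) and e4 = elim(4) and e5 = elim(5) and e6 = elim(6)
      and e7 = elim(7) and e8 = elim(8) and e9 = elim(9) and e10 = elim(10) and e11 = elim(11) and e12 = elim(12)
      and n3 = elim(13)
    have n0: "0 < real n" using n3 by simp
    have lnn: "0 < ln (real n)" using n3 by simp
    have lln: "0 < ln (ln (real n))"
    proof -
      have "0 < \<zeta> / 2 * ln (ln (real n))" using e12 t0 by linarith
      then show ?thesis using \<zeta> by (simp add: zero_less_mult_iff)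
    qed
    define y where "y = \<alpha> * ln (real n)"
    have y0: "0 < y" using \<alpha>0 lnn by (simp add: y_def)
    define k where "k = nat \<lfloor>ln (y / ln K) / lB\<rfloor>"
    have lnyK: "0 \<le> ln (y / ln K)" using e5 by (simp add: y_def)
    then have k: "real k \<le> ln (y / ln K) / lB" "ln (y / ln K) / lB < real k + 1"
      using lB unfolding k_def by (auto simp: divide_nonneg_nonneg less_imp_le)
    have kl: "real k \<le> ln (ln (real n)) / lB"
    proof -
      have "y / ln K \<le> ln (real n)"
      proof -
        have "y \<le> ln (real n) * 1" using \<alpha> lnn by (simp add: y_def)
        also have "\<dots> \<le> ln (real n) * ln K" using lnK lnn by (intro mult_left_mono) auto
        finally show ?thesis using lnK by (simp add: divide_le_eq)
      qed
      then have "ln (y / ln K) \<le> ln (ln (real n))"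
        using y0 lnK lnn by (subst ln_le_cancel_iff) auto
      then have "ln (y / ln K) / lB \<le> ln (ln (real n)) / lB" using lB by (intro divide_right_mono) auto
      then show ?thesis using k(1) by linarith
    qed
    have Bk: "B ^ j = exp (lB * real j)" for j by (simp add: B_def exp_of_nat2_mult)
    have yK: "0 < y / ln K" using y0 lnK by simp
    have Bk1: "B ^ k \<le> y / ln K"
    proof -
      have "lB * real k \<le> ln (y / ln K)" using k(1) lB by (simp add: field_simps)
      then have "exp (lB * real k) \<le> exp (ln (y / ln K))" by simp
      then show ?thesis using yK by (simp add: Bk)
    qed
    have Bk2: "y / ln K \<le> B * B ^ k"
    proof -
      have "ln (y / ln K) \<le> lB * (real k + 1)" using k(2) lB by (simp add: field_simps)
      then have "exp (ln (y / ln K)) \<le> exp (lB * (real k + 1))" by simp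
      also have "\<dots> = B * B ^ k" unfolding Bk by (simp add: B_def distrib_left exp_add)
      finally show ?thesis using yK by simp
    qed
    have Bk0: "0 < B ^ k" using B1 by simp
    \<comment> \<open>The sequence is normalised at the top: \<open>z k = n powr \<alpha>\<close>
      holds exactly, and the rounding in \<open>k\<close> is pushed into \<open>z 0\<close>, which
      varies between \<open>K\<close> and \<open>K powr B\<close>.\<close>
    define z where "z i = exp (y / B ^ k * B ^ i)" for i
    have z_step: "z (Suc i) = z i powr B" for i by (simp add: z_def powr_def mult_ac)
    have zk: "z k = real n powr \<alpha>" using Bk0 B1 n0 by (simp add: z_def y_def powr_def)
    have z0K: "K \<le> z 0"
    proof -
      have "ln K \<le> y / B ^ k" using Bk1 Bk0 lnK by (simp add: field_simps)
      then have "exp (ln K) \<le> z 0" by (simp add: z_def)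
      then show ?thesis using K(3) by simp
    qed
    have z0K': "z 0 \<le> K powr B"
    proof -
      have "y / B ^ k \<le> B * ln K" using Bk2 Bk0 lnK by (simp add: field_simps)
      then have "z 0 \<le> exp (B * ln K)" by (simp add: z_def)
      then show ?thesis using K(3) by (simp add: powr_def)
    qed
    have zmono: "z i \<le> z j" if "i \<le> j" for i j
      unfolding z_def using that B1 y0 Bk0 by (intro exp_le_cancel_iff[THEN iffD2] mult_left_mono power_increasing) auto
    have z1: "K \<le> z i" for i using z0K zmono[of 0 i] by simp
    have npow: "real n * (real n powr \<alpha>) powr (- (\<tau> - 1)) = real n powr \<theta>1"
      "real n * (real n powr \<alpha>) powr (- (\<tau> - 2)) = real n powr \<theta>1 * real n powr \<alpha>"
      "real n * (C\<^sub>1 * (real n powr \<gamma> / 2) powr (- (\<tau> - 1))) = C4 * real n powr (- \<theta>3)"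
      "real n powr \<gamma> / real n = real n powr (- \<theta>4)"
      "(real n powr \<alpha>)\<^sup>2 / real n = real n powr \<theta>2"
    proof -
      have \<theta>': "1 + \<alpha> * (- (\<tau> - 1)) = \<theta>1" "1 + \<alpha> * (- (\<tau> - 2)) = \<theta>1 + \<alpha>"
        "1 + \<gamma> * (- (\<tau> - 1)) = - \<theta>3" "\<gamma> - 1 = - \<theta>4" "2 * \<alpha> - 1 = \<theta>2"
        by (simp_all add: \<theta>1_def \<theta>2_def \<theta>3_def \<theta>4_def algebra_simps)
      show "real n * (real n powr \<alpha>) powr (- (\<tau> - 1)) = real n powr \<theta>1"
        unfolding mult_powr_powr[OF n0] \<theta>' ..
      show "real n * (real n powr \<alpha>) powr (- (\<tau> - 2)) = real n powr \<theta>1 * real n powr \<alpha>"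
        unfolding mult_powr_powr[OF n0] \<theta>' powr_add ..
      have half: "(x / 2) powr (- v) = x powr (- v) * 2 powr v" for x v :: real
        by (simp add: powr_divide powr_minus divide_simps)
      have "real n * (C\<^sub>1 * (real n powr \<gamma> / 2) powr (- (\<tau> - 1))) =
          C\<^sub>1 * 2 powr (\<tau> - 1) * (real n * (real n powr \<gamma>) powr (- (\<tau> - 1)))"
        unfolding half by (simp only: mult_ac)
      also have "\<dots> = C4 * real n powr (- \<theta>3)"
        unfolding mult_powr_powr[OF n0] \<theta>' C4_def ..
      finally show "real n * (C\<^sub>1 * (real n powr \<gamma> / 2) powr (- (\<tau> - 1))) = C4 * real n powr (- \<theta>3)" .
      show "real n powr \<gamma> / real n = real n powr (- \<theta>4)"
        unfolding powr_div_self[OF n0] \<theta>' ..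
      have "(real n powr \<alpha>)\<^sup>2 = real n powr (2 * \<alpha>)"
        by (simp add: power2_eq_square powr_add[symmetric])
      then show "(real n powr \<alpha>)\<^sup>2 / real n = real n powr \<theta>2"
        by (simp only: powr_div_self[OF n0] \<theta>')
    qed
    \<comment> \<open>The slack \<open>\<zeta> * ln (ln n)\<close> is spent as a quarter on each
      start and a half on the final edge.\<close>
    have path: "2 * (real r * t' n + real k * t) + t \<le> l * ln (ln (real n))"
    proof -
      have "real r * t' n \<le> \<zeta> / 4 * ln (ln (real n))"
      proof -
        have "real r / (real r + 1) * (\<zeta> / 4 * ln (ln (real n))) \<le> 1 * (\<zeta> / 4 * ln (ln (real n)))"
          using \<zeta> lln by (intro mult_right_mono) (auto simp: divide_simps)
        then show ?thesis by (simp add: t'_def field_simps)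
      qed
      then have rt: "real r * t' n \<le> \<zeta> * ln (ln (real n)) / 4" by simp
      have kt: "real k * t \<le> ln (ln (real n)) / lB * t" using kl t0 by (intro mult_right_mono) auto
      have tt: "t \<le> \<zeta> * ln (ln (real n)) / 2" using e12 by simp
      have lX: "l * ln (ln (real n)) = \<zeta> * ln (ln (real n)) + 2 * (ln (ln (real n)) / lB * t)"
        by (simp add: \<zeta>_def algebra_simps)
      have "2 * (real r * t' n + real k * t) + t \<le>
          2 * (\<zeta> * ln (ln (real n)) / 4 + ln (ln (real n)) / lB * t) + \<zeta> * ln (ln (real n)) / 2"
        by (intro add_mono mult_left_mono rt kt tt) simp
      then show ?thesis unfolding lX by simp
    qed
    have "measure (weighted_cm D F n) {\<omega>. \<not> passage_time_rv n \<omega> \<le> ereal (2 * (real r * t' n + real k * t) + t)} \<le>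
     (2 * ((1 - q) ^ r + real r * (prob {t' n<..} + real (1 + r + k) * (real n powr \<gamma>) / real n + z 0 powr (- s))) +
      (real n)\<^sup>2 * exp (- (prob {..t} * (z k - 1)\<^sup>2 / (16 * (a * real n))))) +
     ((\<mu> + 1) / a + real n * (C\<^sub>1 * (real n powr \<gamma> - 1) powr (- (\<tau> - 1))) +
      (real k + 1) * exp (- (c\<^sub>1 / 16 * real n * z k powr (- (\<tau> - 1)))))"
    proof (rule prob_slow[where B = B and Q = Q and z = z and k = k and r = r and a = a and s = s
          and \<Delta> = "real n powr \<gamma>" and q = q and t = t and t' = "t' n" and \<mu> = \<mu> and n = n])
      show "2 \<le> n" using n3 by simp
      have "real (2 * r + 1) \<le> real n" using e1 by (simp add: rr_def)
      then show "2 * r + 1 \<le> n" by (simp only: of_nat_le_iff)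
      show "2 \<le> z 0" "2 * Q \<le> z 0" using z0K K by auto
      show "5 \<le> z k" unfolding zk by (rule e4)
      show "1 \<le> z i" for i using z1[of i] K(3) by linarith
      have "real (1 + r + k) \<le> c / 2 * (real n powr \<theta>1)"
      proof -
        have "1 + rr + real k \<le> X" if "rr + 2 + w \<le> X" "real k \<le> w" for w X
          using that by linarith
        from this[OF e2 kl] show ?thesis by (simp add: rr_def)
      qed
      then show "real (1 + r + k) \<le> c\<^sub>1 / 32 / 2 * real n * z k powr (- (\<tau> - 1))"
        unfolding zk mult.assoc npow(1) c_def .
      have "Q * real n powr \<alpha> \<le> c / 4 * real n powr \<theta>1 * real n powr \<alpha>"
        using e3 by (intro mult_right_mono) auto
      then show "Q * z k \<le> c\<^sub>1 / 32 / 4 * real n * z k powr (- (\<tau> - 2))"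
        unfolding zk mult.assoc npow(2) c_def by simp
      show "exp (- (prob {..t} * (c\<^sub>1 / 32) / (16 * a)) * z i powr (1 - B * (\<tau> - 2))) \<le> z i powr (- s) / 2" for i
        using K(1)[OF z1[of i]] unfolding p_def c_def \<delta>_def .
      show "q \<le> c\<^sub>1 / 32 / (2 * a) * z 0 powr (- (\<tau> - 2))"
      proof -
        have "K powr (- b) = (K powr B) powr (- (\<tau> - 2))" unfolding powr_powr b_def by (simp only: mult_minus_right)
        also have "\<dots> \<le> z 0 powr (- (\<tau> - 2))"
          using z0K' z0K K(3) t2 by (intro powr_mono2') auto
        finally have "q \<le> c5 * z 0 powr (- (\<tau> - 2))" unfolding q_def using c5 by (intro mult_left_mono) auto
        then show ?thesis unfolding c5_def c_def .
      qed
      show "0 \<le> t' n" unfolding t'_def using \<zeta> lln by (intro divide_nonneg_nonneg mult_nonneg_nonneg) auto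
      show "2 \<le> s * (B - 1)" by (rule s(1))
      show "z (Suc i) = z i powr B" for i by (rule z_step)
      show "z i \<le> z k" if "i \<le> k" for i using that by (rule zmono)
      show "0 \<le> t" "0 \<le> q" using t0 q by simp_all
      show "(\<integral>\<^sup>+t. ennreal (real t) \<partial>D) \<le> ennreal \<mu>" by (rule \<mu>(1))
      show "0 \<le> \<mu>" by (rule \<mu>(2))
      show "0 < a" by (rule a(1))
      show "2 \<le> real n powr \<gamma>" by (rule e11)
      show "1 < B" by (rule B1)
      show "1 \<le> Q" by (rule Q(1))
      show "C\<^sub>1 * Q powr (- (\<tau> - 1)) \<le> c\<^sub>1 / 2" by (rule Q(2))
      show "q \<le> 1" by (rule q(2))
    qed
    also have "\<dots> \<le> (2 * (\<eta> + (\<eta> + \<eta> + \<eta>)) + \<eta>) + (\<eta> + \<eta> + \<eta>)"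
    proof (intro add_mono mult_left_mono)
      show "(1 - q) ^ r \<le> \<eta>" by (rule qr)
      have "real r * (real (1 + r + k) * (real n powr \<gamma>) / real n) \<le> \<eta>"
      proof -
        have "real r * (real (1 + r + k) * (real n powr \<gamma>) / real n) = rr * (real (1 + r + k) * real n powr (- \<theta>4))"
          unfolding rr_def npow(4)[symmetric] by simp
        also have "\<dots> \<le> rr * ((rr + 2 + ln (ln (real n)) / lB) * real n powr (- \<theta>4))"
          using kl pos(4) unfolding rr_def by (intro mult_left_mono mult_right_mono) auto
        finally show ?thesis using e7 by linarith
      qed
      moreover have "real r * z 0 powr (- s) \<le> \<eta>"
      proof -
        have "z 0 powr (- s) \<le> K powr (- s)" using z0K K(3) s by (intro powr_mono2') auto
        then have "real r * z 0 powr (- s) \<le> real r * K powr (- s)" by (intro mult_left_mono) auto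
        then show ?thesis using rK by linarith
      qed
      ultimately show "real r * (prob {t' n<..} + real (1 + r + k) * (real n powr \<gamma>) / real n + z 0 powr (- s)) \<le> \<eta> + \<eta> + \<eta>"
        using e6 unfolding rr_def by (simp only: distrib_left)
      show "(real n)\<^sup>2 * exp (- (prob {..t} * (z k - 1)\<^sup>2 / (16 * (a * real n)))) \<le> \<eta>"
      proof -
        have "real n powr \<alpha> / 2 \<le> z k - 1" using e4 unfolding zk by linarith
        then have "(real n powr \<alpha> / 2)\<^sup>2 \<le> (z k - 1)\<^sup>2" by (intro power_mono) auto
        then have "p * (real n powr \<alpha> / 2)\<^sup>2 / (16 * (a * real n)) \<le> p * (z k - 1)\<^sup>2 / (16 * (a * real n))"
          using p a n0 by (intro divide_right_mono mult_left_mono) auto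
        moreover have "p * (real n powr \<alpha> / 2)\<^sup>2 / (16 * (a * real n)) = C3 * ((real n powr \<alpha>)\<^sup>2 / real n)"
          using a n0 by (simp add: C3_def power_divide field_simps)
        ultimately have "C3 * real n powr \<theta>2 \<le> p * (z k - 1)\<^sup>2 / (16 * (a * real n))"
          unfolding npow(5) by simp
        then have "(real n)\<^sup>2 * exp (- (p * (z k - 1)\<^sup>2 / (16 * (a * real n)))) \<le> (real n)\<^sup>2 * exp (- (C3 * real n powr \<theta>2))"
          by (intro mult_left_mono) auto
        then show ?thesis using e8 unfolding p_def by linarith
      qed
      show "(\<mu> + 1) / a \<le> \<eta>" by (rule a(3))
      show "real n * (C\<^sub>1 * (real n powr \<gamma> - 1) powr (- (\<tau> - 1))) \<le> \<eta>"
      proof -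
        have "(real n powr \<gamma> - 1) powr (- (\<tau> - 1)) \<le> (real n powr \<gamma> / 2) powr (- (\<tau> - 1))"
          using e11 \<tau> n0 by (intro powr_mono2') auto
        then have "real n * (C\<^sub>1 * (real n powr \<gamma> - 1) powr (- (\<tau> - 1))) \<le>
            real n * (C\<^sub>1 * (real n powr \<gamma> / 2) powr (- (\<tau> - 1)))"
          using C1_ge_1 by (intro mult_left_mono) auto
        then show ?thesis unfolding npow(3) using e9 by linarith
      qed
      show "(real k + 1) * exp (- (c\<^sub>1 / 16 * real n * z k powr (- (\<tau> - 1)))) \<le> \<eta>"
      proof -
        have "(real k + 1) * exp (- (C2 * real n powr \<theta>1)) \<le> (ln (ln (real n)) / lB + 1) * exp (- (C2 * real n powr \<theta>1))"
          using kl by (intro mult_right_mono) auto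
        then show ?thesis unfolding zk mult.assoc npow(1) using e10 unfolding C2_def by linarith
      qed
    qed auto
    finally have "measure (weighted_cm D F n) {\<omega>. \<not> passage_time_rv n \<omega> \<le> ereal (2 * (real r * t' n + real k * t) + t)} \<le> 12 * \<eta>"
      by simp
    moreover have "measure (weighted_cm D F n) {\<omega>. \<not> passage_time_rv n \<omega> \<le> ereal (l * ln (ln n))} \<le>
        measure (weighted_cm D F n) {\<omega>. \<not> passage_time_rv n \<omega> \<le> ereal (2 * (real r * t' n + real k * t) + t)}"
      by (rule measure_slow_mono[OF path])
    ultimately show ?case using \<eta>(3) by simp
  qed
  then show "\<exists>N. \<forall>n\<ge>N. norm (measure (weighted_cm D F n)
      {\<omega>. \<not> passage_time_rv n \<omega> \<le> ereal (l * ln (ln n))} - 0) < \<eta>'"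
    by (simp add: eventually_sequentially)
qed

end

section \<open>Convergence in law\<close>

text \<open>Convergence in probability to a constant suffices: values away from \<open>c\<close>,
  including the infinite ones, contribute at most \<open>2 * K\<close> times a vanishing
  probability, where \<open>K\<close> bounds the test function.\<close>

lemma converges_in_law_return:
  fixes c :: real and Z :: "nat \<Rightarrow> 'b \<Rightarrow> ereal"
  assumes P: "\<And>n. prob_space (P n)" and Z: "\<And>n. Z n \<in> borel_measurable (P n)"
    and conv: "\<And>\<epsilon>. 0 < \<epsilon> \<Longrightarrow>
      (\<lambda>n. measure (P n) {\<omega> \<in> space (P n). Z n \<omega> \<notin> {ereal (c - \<epsilon>)..ereal (c + \<epsilon>)}}) \<longlonglongrightarrow> 0"
  shows "converges_in_law P Z (return borel (ereal c))"
  unfolding converges_in_law_def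
proof (intro allI impI, elim conjE)
  fix f :: "ereal \<Rightarrow> real"
  assume f: "continuous_on UNIV f" and bf: "bounded (range f)"
  have mf [measurable]: "f \<in> borel_measurable borel"
    using f by (rule borel_measurable_continuous_onI)
  obtain K where K: "\<And>x. \<bar>f x\<bar> \<le> K"
    using bf by (auto simp: bounded_iff)
  then have K0: "0 \<le> K" by (meson abs_ge_zero order.trans)
  have "(\<lambda>n. \<integral>x. f x \<partial>distr (P n) borel (Z n)) \<longlonglongrightarrow> f (ereal c)"
  proof (rule LIMSEQ_I)
    fix r :: real assume r: "0 < r"
    have "continuous_on UNIV (\<lambda>x::real. f (ereal x))"
      by (rule continuous_on_compose2[OF f]) (auto intro: continuous_on_ereal)
    then have "isCont (\<lambda>x::real. f (ereal x)) c"
      by (simp add: continuous_on_eq_continuous_at)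
    then obtain s where s: "0 < s" "\<And>x. \<bar>x - c\<bar> < s \<Longrightarrow> \<bar>f (ereal x) - f (ereal c)\<bar> < r / 2"
      using r unfolding continuous_at_eps_delta by (metis half_gt_zero dist_real_def)
    define \<epsilon> where "\<epsilon> = s / 2"
    have \<epsilon>: "0 < \<epsilon>" "\<epsilon> < s" using s by (auto simp: \<epsilon>_def)
    have near: "\<bar>f z - f (ereal c)\<bar> \<le> r / 2" if "z \<in> {ereal (c - \<epsilon>)..ereal (c + \<epsilon>)}" for z
    proof -
      have "z \<noteq> \<infinity>" "z \<noteq> -\<infinity>" using that by auto
      then obtain x where x: "z = ereal x" by (cases z) auto
      have "c - \<epsilon> \<le> x" "x \<le> c + \<epsilon>" using that by (simp_all add: x)
      then have "\<bar>x - c\<bar> < s" using \<epsilon>(2) by linarith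
      from s(2)[OF this] show ?thesis by (simp add: x)
    qed
    define b where "b n = measure (P n) {\<omega> \<in> space (P n). Z n \<omega> \<notin> {ereal (c - \<epsilon>)..ereal (c + \<epsilon>)}}" for n
    have "(\<lambda>n. 2 * K * b n) \<longlonglongrightarrow> 2 * K * 0"
      unfolding b_def by (intro tendsto_mult tendsto_const conv \<epsilon>)
    then have ev: "\<forall>\<^sub>F n in sequentially. 2 * K * b n < r / 2"
      using r by (intro order_tendstoD) auto
    have "\<forall>\<^sub>F n in sequentially. norm ((\<integral>x. f x \<partial>distr (P n) borel (Z n)) - f (ereal c)) < r"
      using ev
    proof eventually_elim
      case (elim n)
      interpret Pn: prob_space "P n" by (rule P)
      let ?S = "{\<omega> \<in> space (P n). Z n \<omega> \<notin> {ereal (c - \<epsilon>)..ereal (c + \<epsilon>)}}"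
      note Z [measurable]
      have S [measurable]: "?S \<in> sets (P n)" by measurable
      have int: "integrable (P n) (\<lambda>\<omega>. f (Z n \<omega>))"
        using K by (intro Pn.integrable_const_bound[of _ K]) auto
      have "(\<integral>x. f x \<partial>distr (P n) borel (Z n)) - f (ereal c) = (\<integral>\<omega>. f (Z n \<omega>) - f (ereal c) \<partial>P n)"
        using int by (simp add: integral_distr Pn.prob_space)
      also have "norm \<dots> \<le> (\<integral>\<omega>. \<bar>f (Z n \<omega>) - f (ereal c)\<bar> \<partial>P n)"
        using integral_norm_bound[of "P n" "\<lambda>\<omega>. f (Z n \<omega>) - f (ereal c)"] by simp
      also have "\<dots> \<le> (\<integral>\<omega>. r / 2 + 2 * K * indicator ?S \<omega> \<partial>P n)"
      proof (rule integral_mono)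
        show "integrable (P n) (\<lambda>\<omega>. \<bar>f (Z n \<omega>) - f (ereal c)\<bar>)"
          using int by (intro integrable_abs Bochner_Integration.integrable_diff) auto
        show "integrable (P n) (\<lambda>\<omega>. r / 2 + 2 * K * indicator ?S \<omega>)"
          by (intro Bochner_Integration.integrable_add) (auto simp: Pn.emeasure_eq_measure)
        show "\<bar>f (Z n \<omega>) - f (ereal c)\<bar> \<le> r / 2 + 2 * K * indicator ?S \<omega>" if "\<omega> \<in> space (P n)" for \<omega>
        proof (cases "\<omega> \<in> ?S")
          case True
          have "\<bar>f (Z n \<omega>) - f (ereal c)\<bar> \<le> 2 * K"
            using K[of "Z n \<omega>"] K[of "ereal c"] by linarith
          then show ?thesis using True r by simp
        next
          case False
          then show ?thesis using near[of "Z n \<omega>"] that by simp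
        qed
      qed
      also have "\<dots> = r / 2 + 2 * K * b n"
        unfolding b_def by (subst Bochner_Integration.integral_add) (auto simp: Pn.prob_space Pn.emeasure_eq_measure)
      finally show ?case using elim by simp
    qed
    then show "\<exists>N. \<forall>n\<ge>N. norm ((\<integral>x. f x \<partial>distr (P n) borel (Z n)) - f (ereal c)) < r"
      by (simp add: eventually_sequentially)
  qed
  also have "f (ereal c) = (\<integral>x. f x \<partial>return borel (ereal c))"
    by (simp add: integral_return)
  finally show "(\<lambda>n. \<integral>x. f x \<partial>distr (P n) borel (Z n)) \<longlonglongrightarrow> (\<integral>x. f x \<partial>return borel (ereal c))" .
qed

text \<open>The real line has a countable base, so the points below \<open>c\<close>, none of which
  is in the support, are covered by countably many null basic open sets.\<close>

lemma AE_ge_if_supp_ge: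
  fixes \<mu> :: "real measure"
  assumes sets: "sets \<mu> = sets borel" and supp: "\<And>x. x \<in> supp \<mu> \<Longrightarrow> c \<le> x"
  shows "AE x in \<mu>. c \<le> x"
proof -
  obtain B :: "real set set" where B: "countable B" "topological_basis B"
    using ex_countable_basis by blast
  define N where "N = {b \<in> B. emeasure \<mu> b = 0}"
  have "\<Union>N \<in> null_sets \<mu>"
  proof -
    have "(\<Union>b\<in>N. b) \<in> null_sets \<mu>"
    proof (rule null_sets_UN')
      show "countable N" using B(1) by (simp add: N_def)
      show "b \<in> null_sets \<mu>" if "b \<in> N" for b
        using that topological_basis_open[OF B(2)] by (auto simp: N_def null_sets_def sets)
    qed
    then show ?thesis by simp
  qed
  moreover have "{x \<in> space \<mu>. \<not> c \<le> x} \<subseteq> \<Union>N"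
  proof
    fix x assume "x \<in> {x \<in> space \<mu>. \<not> c \<le> x}"
    then have "x \<notin> supp \<mu>" using supp by auto
    then obtain U where U: "open U" "x \<in> U" "emeasure \<mu> U = 0"
      by (auto simp: supp_def not_gr_zero)
    obtain b where b: "b \<in> B" "x \<in> b" "b \<subseteq> U"
      using topological_basisE[OF B(2) U(1,2)] by blast
    have "emeasure \<mu> b \<le> emeasure \<mu> U"
      using b(3) U(1) by (intro emeasure_mono) (auto simp: sets)
    then have "b \<in> N" using b(1) U(3) by (simp add: N_def)
    then show "x \<in> \<Union>N" using b(2) by blast
  qed
  ultimately show ?thesis by (intro AE_I'[of "\<Union>N"])
qed

context percolation
begin

lemma AE_good:
  assumes "1 \<le> n"
  shows "AE \<omega> in weighted_cm D F n.
    (\<exists>d. fst (fst \<omega>) \<in> pairings (half_edges n d)) \<and> (\<forall>h h'. 1 \<le> snd \<omega> {h, h'})"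
proof -
  interpret P: pair_sigma_finite "measure_pmf (sample_pmf D n)" PY
    by unfold_locales
  have "\<exists>d. M \<in> pairings (half_edges n d)" if "(M, uv) \<in> set_pmf (sample_pmf D n)" for M uv
  proof -
    have "M \<in> set_pmf (configuration_model D n)"
      using that by (simp add: sample_pmf_def set_pair_pmf)
    then obtain d where "M \<in> set_pmf (pmf_of_set (pairings (half_edges n d)))"
      by (auto simp: configuration_model_def)
    then show ?thesis
      using pairings_ne[OF finite_half_edges even_card_half_edges[OF assms]]
        finite_pairings[OF finite_half_edges] by (auto simp: set_pmf_of_set)
  qed
  then have "AE x in sample_pmf D n. AE Y in PY.
      (\<exists>d. fst x \<in> pairings (half_edges n d)) \<and> (\<forall>h h'. 1 \<le> Y {h, h'})"
    using AE_weights_ge_1[OF F_ge_1] by (auto simp: AE_measure_pmf_iff)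
  moreover have "Measurable.pred (measure_pmf (sample_pmf D n) \<Otimes>\<^sub>M PY)
      (\<lambda>\<omega>. (\<exists>d. fst (fst \<omega>) \<in> pairings (half_edges n d)) \<and> (\<forall>h h'. 1 \<le> snd \<omega> {h, h'}))"
    by (intro pred_intros_logic measurable_fst_pred) measurable
  ultimately show ?thesis
    unfolding weighted_cm_eq by (intro P.AE_pair_measure) (auto simp: pred_def)
qed

text \<open>Stated for any \<open>Z\<close> between hopcount and passage time, so that both
  conclusions follow at once: \<open>no_short_path\<close> bounds the hopcount from below and
  \<open>not_slow\<close> the passage time from above.\<close>

lemma converges_in_law_between:
  assumes Z: "\<And>n. Z n \<in> borel_measurable (weighted_cm D F n)"
    and between: "\<And>n M u v Y d. M \<in> pairings (half_edges n d) \<Longrightarrow> (\<And>h h'. 1 \<le> Y {h, h'}) \<Longrightarrow>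
      hopcount_rv n ((M, u, v), Y) \<le> Z n ((M, u, v), Y) \<and> Z n ((M, u, v), Y) \<le> passage_time_rv n ((M, u, v), Y)"
  shows "converges_in_law (weighted_cm D F) (\<lambda>n \<omega>. Z n \<omega> / ereal (ln (ln (real n))))
    (return borel (ereal (2 / \<bar>ln (\<tau> - 2)\<bar>)))"
proof (rule converges_in_law_return)
  show "prob_space (weighted_cm D F n)" for n by (rule prob_space_weighted_cm)
  show "(\<lambda>\<omega>. Z n \<omega> / ereal (ln (ln (real n)))) \<in> borel_measurable (weighted_cm D F n)" for n
    using Z[of n] by measurable
  define lk where "lk = 2 / \<bar>ln (\<tau> - 2)\<bar>"
  have "ln (\<tau> - 2) < 0" using \<tau> by (simp add: ln_less_zero_iff)
  then have lk: "0 < lk" by (simp add: lk_def)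
  fix \<epsilon> :: real assume \<epsilon>: "0 < \<epsilon>"
  \<comment> \<open>\<open>no_short_path\<close> asks for a positive constant, but
    \<open>lk - \<epsilon>\<close> may be negative.\<close>
  define l1 where "l1 = max (lk / 2) (lk - \<epsilon>)"
  have l1: "0 < l1" "l1 < lk" "lk - \<epsilon> \<le> l1" using \<epsilon> lk by (auto simp: l1_def)
  define A1 where "A1 n = {(M, u, v). \<exists>p. pre_digraph.apath (pairing_graph n M) u p v \<and> length p \<le> l1 * ln (ln (real n))}" for n
  define A2 where "A2 n = {\<omega>. \<not> passage_time_rv n \<omega> \<le> ereal ((lk + \<epsilon>) * ln (ln (real n)))}" for n
  have lim1: "(\<lambda>n. measure_pmf.prob (sample_pmf D n) (A1 n)) \<longlonglongrightarrow> 0"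
    unfolding A1_def using l1(1,2) unfolding lk_def by (rule no_short_path)
  have lim2: "(\<lambda>n. measure (weighted_cm D F n) (A2 n)) \<longlonglongrightarrow> 0"
    unfolding A2_def using \<epsilon> by (intro not_slow) (simp add: lk_def)
  have "\<forall>\<^sub>F n in sequentially. norm (measure (weighted_cm D F n)
      {\<omega> \<in> space (weighted_cm D F n). Z n \<omega> / ereal (ln (ln (real n))) \<notin> {ereal (lk - \<epsilon>)..ereal (lk + \<epsilon>)}})
    \<le> measure_pmf.prob (sample_pmf D n) (A1 n) + measure (weighted_cm D F n) (A2 n)"
  proof -
    have "\<forall>\<^sub>F n::nat in sequentially. 0 < ln (ln (real n))" by real_asymp
    with eventually_ge_at_top[of "1::nat"] show ?thesis
    proof eventually_elim
      case (elim n)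
      interpret P: prob_space "weighted_cm D F n" by (rule prob_space_weighted_cm)
      let ?ll = "ln (ln (real n))"
      let ?A = "fst -` A1 n :: ((half_edge set set \<times> nat \<times> nat) \<times> (half_edge set \<Rightarrow> real)) set"
      have sA1: "?A \<in> sets (weighted_cm D F n)"
      proof -
        have "Measurable.pred (weighted_cm D F n) (\<lambda>\<omega>. fst \<omega> \<in> A1 n)"
          unfolding weighted_cm_eq by (rule measurable_fst_pred)
        then show ?thesis by (simp add: pred_def space_weighted_cm vimage_def)
      qed
      have sA2: "A2 n \<in> sets (weighted_cm D F n)" unfolding A2_def by (rule sets_slow)
      have mA1: "P.prob ?A = measure_pmf.prob (sample_pmf D n) (A1 n)"
      proof -
        have "Pair x -` ?A = (if x \<in> A1 n then space PY else {})" for x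
          by (auto simp: space_PY)
        then have "emeasure (weighted_cm D F n) ?A = (\<integral>\<^sup>+x. indicator (A1 n) x \<partial>sample_pmf D n)"
          unfolding emeasure_weighted_cm[OF sA1]
          by (intro nn_integral_cong) (simp add: PYp.prob_space indicator_def)
        then show ?thesis
          by (simp add: P.emeasure_eq_measure measure_pmf.emeasure_eq_measure)
      qed
      have "P.prob {\<omega> \<in> space (weighted_cm D F n). Z n \<omega> / ereal ?ll \<notin> {ereal (lk - \<epsilon>)..ereal (lk + \<epsilon>)}} \<le> P.prob (?A \<union> A2 n)"
      proof (rule P.finite_measure_mono_AE)
        show "?A \<union> A2 n \<in> P.events" using sA1 sA2 by (rule sets.Un)
        show "AE \<omega> in weighted_cm D F n.
            \<omega> \<in> {\<omega> \<in> space (weighted_cm D F n). Z n \<omega> / ereal ?ll \<notin> {ereal (lk - \<epsilon>)..ereal (lk + \<epsilon>)}} \<longrightarrow> \<omega> \<in> ?A \<union> A2 n"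
          using AE_good[OF elim(1)]
        proof eventually_elim
          fix \<omega> :: "(half_edge set set \<times> nat \<times> nat) \<times> (half_edge set \<Rightarrow> real)"
          assume good: "(\<exists>d. fst (fst \<omega>) \<in> pairings (half_edges n d)) \<and> (\<forall>h h'. 1 \<le> snd \<omega> {h, h'})"
          obtain M u v Y where \<omega>: "\<omega> = ((M, u, v), Y)" by (metis prod.collapse)
          obtain d where M: "M \<in> pairings (half_edges n d)" using good by (auto simp: \<omega>)
          have Y: "\<And>h h'. 1 \<le> Y {h, h'}" using good by (auto simp: \<omega>)
          have "hopcount_rv n \<omega> \<le> Z n \<omega> \<and> Z n \<omega> \<le> passage_time_rv n \<omega>"
            unfolding \<omega> by (rule between[OF M]) (rule Y)
          then have Z_le: "hopcount_rv n \<omega> \<le> Z n \<omega>" "Z n \<omega> \<le> passage_time_rv n \<omega>" by auto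
          have "Z n \<omega> / ereal ?ll \<in> {ereal (lk - \<epsilon>)..ereal (lk + \<epsilon>)}" if "\<omega> \<notin> ?A" "\<omega> \<notin> A2 n"
          proof -
            have "ereal (?ll * (lk - \<epsilon>)) \<le> ereal (l1 * ?ll)"
              using l1(3) elim(2) by (simp add: mult.commute)
            also have "\<dots> \<le> hopcount_rv n \<omega>"
              unfolding \<omega> hopcount_rv_def prod.case
            proof (rule hopcount_ge)
              fix p assume "pre_digraph.apath (pairing_graph n M) u p v"
              then show "l1 * ?ll < real (length p)"
                using that(1) unfolding \<omega> A1_def by (auto simp: not_le)
            qed
            also note Z_le(1)
            finally have 1: "ereal ?ll * ereal (lk - \<epsilon>) \<le> Z n \<omega>" by simp
            note Z_le(2)
            also have "passage_time_rv n \<omega> \<le> ereal ((lk + \<epsilon>) * ?ll)" using that(2) by (simp add: A2_def)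
            finally have 2: "Z n \<omega> \<le> ereal ?ll * ereal (lk + \<epsilon>)" by (simp add: mult.commute)
            show ?thesis
              using 1 2 elim(2) by (simp add: ereal_le_divide_pos ereal_divide_le_pos)
          qed
          then show "\<omega> \<in> {\<omega> \<in> space (weighted_cm D F n). Z n \<omega> / ereal ?ll \<notin> {ereal (lk - \<epsilon>)..ereal (lk + \<epsilon>)}} \<longrightarrow> \<omega> \<in> ?A \<union> A2 n"
            by blast
        qed
      qed
      also have "\<dots> \<le> P.prob ?A + P.prob (A2 n)"
        by (rule measure_Un_le[OF sA1 sA2])
      finally show ?case using mA1 by simp
    qed
  qed
  from Lim_null_comparison[OF this] tendsto_add[OF lim1 lim2]
  show "(\<lambda>n. measure (weighted_cm D F n) {\<omega> \<in> space (weighted_cm D F n).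
      Z n \<omega> / ereal (ln (ln (real n))) \<notin> {ereal (2 / \<bar>ln (\<tau> - 2)\<bar> - \<epsilon>)..ereal (2 / \<bar>ln (\<tau> - 2)\<bar> + \<epsilon>)}}) \<longlonglongrightarrow> 0"
    unfolding lk_def by simp
qed

end

theorem theorem1p8:
  fixes D :: "nat pmf" and X :: "real measure" and \<tau> c\<^sub>1 C\<^sub>1 :: real
  assumes "0 < c\<^sub>1" and "c\<^sub>1 \<le> C\<^sub>1" and "2 < \<tau>" and "\<tau> < 3"
    and "\<And>x::real. x \<ge> 1 \<Longrightarrow>
           c\<^sub>1 * x powr (-(\<tau> - 1)) \<le> measure_pmf.prob D {k. real k > x} \<and>
           measure_pmf.prob D {k. real k > x} \<le> C\<^sub>1 * x powr (-(\<tau> - 1))"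
    and "measure_pmf.prob D {k. k \<ge> 2} = 1"
    and "real_distribution X"
    and "continuous_on UNIV (cdf X)"
    and "Inf (ereal ` supp X) = 0"
  shows "converges_in_law (weighted_cm D (distr X borel (\<lambda>x. 1 + x)))
           (\<lambda>n \<omega>. passage_time_rv n \<omega> / ereal (ln (ln (real n))))
           (return borel (ereal (2 / \<bar>ln (\<tau> - 2)\<bar>))) \<and>
         converges_in_law (weighted_cm D (distr X borel (\<lambda>x. 1 + x)))
           (\<lambda>n \<omega>. hopcount_rv n \<omega> / ereal (ln (ln (real n))))
           (return borel (ereal (2 / \<bar>ln (\<tau> - 2)\<bar>)))"
proof -
  interpret X: real_distribution X by fact
  let ?F = "distr X borel (\<lambda>x. 1 + x)"
  have meas [measurable]: "(\<lambda>x. 1 + x) \<in> X \<rightarrow>\<^sub>M (borel :: real measure)" by simp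
  interpret F: prob_space ?F by (rule X.prob_space_distr[OF meas])
  have supp: "0 \<le> x" if "x \<in> supp X" for x
  proof -
    have "Inf (ereal ` supp X) \<le> ereal x" using that by (intro Inf_lower) auto
    then show ?thesis using assms(9) by simp
  qed
  \<comment> \<open>As the infimum is 0, the support has a point below \<open>\<epsilon>\<close>,
    and the open half-line containing it has positive mass.\<close>
  have X_pos: "0 < X.prob {..<\<epsilon>}" if "0 < \<epsilon>" for \<epsilon>
  proof -
    have "Inf (ereal ` supp X) < ereal \<epsilon>" using assms(9) that by simp
    then obtain x where "x \<in> supp X" "x < \<epsilon>" unfolding Inf_less_iff by auto
    then have "0 < emeasure X {..<\<epsilon>}" by (auto simp: supp_def)
    then show ?thesis by (simp add: X.emeasure_eq_measure)
  qed
  interpret percolation D \<tau> c\<^sub>1 C\<^sub>1 ?F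
  proof (unfold_locales)
    show "AE y in ?F. 1 \<le> y"
      using AE_ge_if_supp_ge[of X 0] supp by (simp add: AE_distr_iff)
    show "0 < F.prob {..1 + \<epsilon>}" if "0 < \<epsilon>" for \<epsilon>
    proof -
      have S: "(\<lambda>x. 1 + x) -` {..1 + \<epsilon>} = {..\<epsilon>}" by auto
      have "F.prob {..1 + \<epsilon>} = X.prob {..\<epsilon>}"
        by (subst measure_distr) (simp_all add: S)
      moreover have "X.prob {..<\<epsilon>} \<le> X.prob {..\<epsilon>}"
        by (intro X.finite_measure_mono) auto
      ultimately show ?thesis using X_pos[OF that] by linarith
    qed
  qed (use assms in auto)
  show ?thesis
  proof (intro conjI converges_in_law_between)
    show "passage_time_rv n \<in> borel_measurable (weighted_cm D ?F n)"
      "hopcount_rv n \<in> borel_measurable (weighted_cm D ?F n)" for n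
      unfolding weighted_cm_eq by measurable
  qed (auto simp: hopcount_rv_def passage_time_rv_def intro: hopcount_le_passage_time)
qed

end
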